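(* Assume that $F(x)$ and $F'(x)=\frac{\partial}{\partial x}F(x,\underline a)$ have no common factors, i.e. $F'(x_i)\ne0$ for $i=1,\dots,\mu$. Let $\beta_1,\dots,\beta_\alpha\in\overline K$ be the (distinct) roots of $f_2(x)F_0(x)$. Then $v=\sum_{i=1}^\mu\int f(x_i,y_i)\,dx_i$ is given by $$v=\sum_{j=1}^\alpha\mathrm{res}_{\beta_j}\Big(\sum_{\ell=1}^n f(x,y^{(\ell)})\log_{\beta_j}\theta(y^{(\ell)})\Big)-\varPi\Big(\sum_{\ell=1}^n f(x,y^{(\ell)})\log_\infty\theta(y^{(\ell)})\Big)+C$$ $$=\sum_{j=1}^\alpha\mathrm{res}_{\beta_j}(\widehat S_{\beta_j}(x))-\varPi(\widehat S_\infty(x))+C,$$ where $C$ is a constant of integration; that is, $$\sum_{i=1}^\mu f(x_i,y_i)\,dx_i=\delta\Big(\sum_{j=1}^\alpha\mathrm{res}_{\beta_j}(\widehat S_{\beta_j}(x))-\varPi(\widehat S_\infty(x))\Big).$$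
   Context: Let $K\subseteq\mathbb{C}$ be a computable field (its elements have explicit representations in which the field operations can be done algorithmically), with algebraic closure $\overline K$. Let $\chi(y)=\chi(x,y)\in K[x,y]$ be monic of degree $n$ in $y$ and irreducible over $\mathbb{C}$; put $\chi'(y)=\frac{\partial\chi}{\partial y}(x,y)$ and let $y^{(1)},\dots,y^{(n)}$ be the roots of $\chi(x,y)$ viewed as a polynomial in $y$ over $K(x)$, in a splitting field. Let $\theta(y)=\theta(x,y,\underline a)=\sum_{j=0}^{n-1}q_j(x)y^j\neq 0$, where the $q_j$ are polynomials in $x$, some of whose coefficients are parameters $\underline a=a_1,a_2,\dots$ (finitely many), the other coefficients lying in $K$. A subset of the $a_i$ is algebraically independent over $K(x)$, and each remaining $a_i$ is a linear combination, with coefficients in $K$, of $1$ and the independent ones. $\delta$ is the differential with respect to $\underline a$ with $x$ and the $y^{(\ell)}$ held constant: $\delta h=\sum_i\frac{\partial h}{\partial a_i}da_i$; derivations $\partial/\partial a_i$ are extended uniquely to algebraic extensions. Let $r(x)=\prod_{\ell=1}^n\theta(x,y^{(\ell)},\underline a)\in K[x,\underline a]$. Factor $r(x)=F_0(x)F(x)$ with $F_0(x)\in K[x]$, $F(x)=F(x,\underline a)\in K[x,\underline a]$, where, as polynomials in $x$, all roots of $F_0$ are algebraic over $K$ and no root of $F$ is algebraic over $K$ ($K$ being replaced by a finite extension if needed). Let $(x_1,y_1),\dots,(x_\mu,y_\mu)$ be the solutions, in an algebraic closure of $K(\underline a)$, of $\chi(x,y)=\theta(x,y,\underline a)=0$ with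 $x_i$ transcendental over $K$ (equivalently $dx_i\ne0$); the $x_i$ are the roots of $F(x)$, and $dx_i=\sum_k\frac{\partial x_i}{\partial a_k}da_k$. Let $f(x,y)$ be a rational function over $K$, represented modulo $\chi$ as $f(x,y)=\dfrac{f_1(x,y)}{f_2(x)\chi'(y)}$ with $f_1\in K[x,y]$, $0\neq f_2\in K[x]$. Puiseux expansions and logarithms. For $\beta\in\overline K$ the roots $y^{(\ell)}$ have Puiseux expansions in $x-\beta$ (fractional exponents with bounded denominators, coefficients in $\overline K$), and also Puiseux expansions in $\frac1x$ at $\infty$. Using these, write $$\theta(y^{(\ell)})=c_{\beta,\ell}(x-\beta)^{e_{\beta,\ell}}(1+W_{\beta,\ell}),\qquad \theta(y^{(\ell)})=c_{\infty,\ell}\,x^{e_{\infty,\ell}}(1+W_{\infty,\ell}),$$ where $c_{\beta,\ell},c_{\infty,\ell}$ are nonzero elements $\lambda_0+\lambda_1a_1+\lambda_2a_2+\cdots$ with $\lambda_i\in\overline K$, the exponents $e$ are rational, and $W_{\beta,\ell}$ (resp. $W_{\infty,\ell}$) is a Puiseux series involving only positive powers of $x-\beta$ (resp. $\frac1x$). For such $c$, $\log(c)$ denotes an element of a differential extension field of $\overline K(\underline a)$ with $\frac{\partial\log(c)}{\partial a_i}=\frac1c\frac{\partial c}{\partial a_i}$ for all $i$ (the derivations commuting). Define, for $\beta\in\overline K\cup\{\infty\}$, $$\log_\beta\theta(y^{(\ell)})=\log(c_{\beta,\ell})+\sum_{k=1}^\infty\frac{(-1)^{k-1}W_{\beta,\ell}^k}{k},\qquad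 \widehat S_\beta(x)=\sum_{\ell=1}^n f(x,y^{(\ell)})\log_\beta\theta(y^{(\ell)}),$$ where $f(x,y^{(\ell)})$ is expanded via the Puiseux series of $y^{(\ell)}$ at $\beta$. $\mathrm{res}_\beta$ of a Puiseux series in $x-\beta$ is the coefficient of $\frac1{x-\beta}$; $\varPi$ of a Puiseux series in $\frac1x$ is the coefficient of $\frac1x$. The indefinite integral is understood as an antiderivative: $v=G+C$ means $\delta G=\sum_{i=1}^\mu f(x_i,y_i)\,dx_i$. *)

theory Defs
  imports
    Complex_Main
    "HOL-Library.Poly_Mapping"
    "HOL-Computational_Algebra.Computational_Algebra"
begin

subsection \<open>Computable fields\<close>

text \<open>
  \<open>recursive_fun k f\<close>: the restriction of \<open>f\<close> to lists of length \<open>k\<close> is a total recursive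
  function of \<open>k\<close> arguments (Kleene's characterisation: closure of the initial functions under
  composition, primitive recursion and minimisation of regular functions).
\<close>
inductive recursive_fun :: "nat \<Rightarrow> (nat list \<Rightarrow> nat) \<Rightarrow> bool" where
  zero: "recursive_fun k (\<lambda>_. 0)"
| succ: "recursive_fun 1 (\<lambda>xs. Suc (hd xs))"
| proj: "i < k \<Longrightarrow> recursive_fun k (\<lambda>xs. xs ! i)"
| comp: "recursive_fun (length gs) f \<Longrightarrow> (\<forall>g\<in>set gs. recursive_fun k g) \<Longrightarrow>
           recursive_fun k (\<lambda>xs. f (map (\<lambda>g. g xs) gs))"
| prec: "recursive_fun k f \<Longrightarrow> recursive_fun (Suc (Suc k)) g \<Longrightarrow>
           recursive_fun (Suc k) (\<lambda>xs. rec_nat (f (tl xs)) (\<lambda>n r. g (n # r # tl xs)) (hd xs))"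
| mini: "recursive_fun (Suc k) f \<Longrightarrow> (\<forall>xs. length xs = k \<longrightarrow> (\<exists>n. f (n # xs) = 0)) \<Longrightarrow>
           recursive_fun k (\<lambda>xs. LEAST n. f (n # xs) = 0)"

definition is_subfield :: "'a::field set \<Rightarrow> bool" where
  "is_subfield S \<longleftrightarrow> 0 \<in> S \<and> 1 \<in> S \<and>
     (\<forall>u\<in>S. \<forall>v\<in>S. u + v \<in> S \<and> u - v \<in> S \<and> u * v \<in> S \<and> u / v \<in> S)"

text \<open>
  The elements of \<open>K\<close> are represented by codes in \<open>nat\<close>, such that equality of represented elements
  is decidable and the field operations are computable on codes.
\<close>
definition computable_field :: "'a::field set \<Rightarrow> bool" where
  "computable_field K \<longleftrightarrow> is_subfield K \<and>
     (\<exists>\<nu> :: nat \<Rightarrow> 'a. range \<nu> = K \<and>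
        (\<exists>eq. recursive_fun 2 eq \<and> (\<forall>i j. eq [i, j] = 0 \<longleftrightarrow> \<nu> i = \<nu> j)) \<and>
        (\<exists>add. recursive_fun 2 add \<and> (\<forall>i j. \<nu> (add [i, j]) = \<nu> i + \<nu> j)) \<and>
        (\<exists>sub. recursive_fun 2 sub \<and> (\<forall>i j. \<nu> (sub [i, j]) = \<nu> i - \<nu> j)) \<and>
        (\<exists>mul. recursive_fun 2 mul \<and> (\<forall>i j. \<nu> (mul [i, j]) = \<nu> i * \<nu> j)) \<and>
        (\<exists>dv. recursive_fun 2 dv \<and> (\<forall>i j. \<nu> j \<noteq> 0 \<longrightarrow> \<nu> (dv [i, j]) = \<nu> i / \<nu> j)))"


subsection \<open>Field extensions\<close>

definition poly_over :: "'a::zero set \<Rightarrow> 'a poly \<Rightarrow> bool" where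
  "poly_over S p \<longleftrightarrow> (\<forall>i. coeff p i \<in> S)"

text \<open>
  Polynomials in \<open>x\<close> and \<open>y\<close> have type \<open>'a poly poly\<close>; the outer variable is \<open>y\<close>, the variable of
  the coefficients is \<open>x\<close>.
\<close>
definition poly2_over :: "'a::zero set \<Rightarrow> 'a poly poly \<Rightarrow> bool" where
  "poly2_over S p \<longleftrightarrow> (\<forall>j. poly_over S (coeff p j))"

definition algebraic_over :: "'a::field set \<Rightarrow> 'a \<Rightarrow> bool" where
  "algebraic_over S z \<longleftrightarrow> (\<exists>p. p \<noteq> 0 \<and> poly_over S p \<and> poly p z = 0)"

definition generated_subfield :: "'a::field set \<Rightarrow> 'a set" where
  "generated_subfield A = \<Inter>{S. is_subfield S \<and> A \<subseteq> S}"

definition field_hom_on :: "'a::field set \<Rightarrow> ('a \<Rightarrow> 'b::field) \<Rightarrow> bool" where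
  "field_hom_on S h \<longleftrightarrow> h 0 = 0 \<and> h 1 = 1 \<and>
     (\<forall>u\<in>S. \<forall>v\<in>S. h (u + v) = h u + h v \<and> h (u * v) = h u * h v)"

definition ring_embedding :: "('a::comm_ring_1 \<Rightarrow> 'b::comm_ring_1) \<Rightarrow> bool" where
  "ring_embedding h \<longleftrightarrow> inj h \<and> h 1 = 1 \<and>
     (\<forall>u v. h (u + v) = h u + h v \<and> h (u * v) = h u * h v)"

text \<open>
  Polynomials in the variables \<open>a\<^sub>0, a\<^sub>1, \<dots>\<close> are finitely supported maps from exponent vectors to
  coefficients.
\<close>
definition mpoly_eval :: "(nat \<Rightarrow> 'a::comm_ring_1) \<Rightarrow> ((nat \<Rightarrow>\<^sub>0 nat) \<Rightarrow>\<^sub>0 'a) \<Rightarrow> 'a" where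
  "mpoly_eval v p =
     (\<Sum>e\<in>Poly_Mapping.keys p. Poly_Mapping.lookup p e *
        (\<Prod>i\<in>Poly_Mapping.keys e. v i ^ Poly_Mapping.lookup e i))"

definition mpoly_over :: "'a::comm_ring_1 set \<Rightarrow> nat set \<Rightarrow> ((nat \<Rightarrow>\<^sub>0 nat) \<Rightarrow>\<^sub>0 'a) \<Rightarrow> bool" where
  "mpoly_over S I p \<longleftrightarrow> (\<forall>e. Poly_Mapping.lookup p e \<in> S) \<and>
     (\<forall>e\<in>Poly_Mapping.keys p. Poly_Mapping.keys e \<subseteq> I)"

definition polynomials_in :: "'a::comm_ring_1 set \<Rightarrow> nat set \<Rightarrow> (nat \<Rightarrow> 'a) \<Rightarrow> 'a set" where
  "polynomials_in S I v = mpoly_eval v ` {p. mpoly_over S I p}"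

definition algebraically_independent :: "'a::field set \<Rightarrow> nat set \<Rightarrow> (nat \<Rightarrow> 'a) \<Rightarrow> bool" where
  "algebraically_independent S I v \<longleftrightarrow>
     (\<forall>p. mpoly_over S I p \<and> mpoly_eval v p = 0 \<longrightarrow> p = 0)"

text \<open>The field \<open>S(x)\<close> inside a field into which the polynomials in \<open>x\<close> are embedded by \<open>emb\<close>.\<close>
definition rational_functions_in ::
    "('a::field poly \<Rightarrow> 'b::field) \<Rightarrow> 'a set \<Rightarrow> 'b set" where
  "rational_functions_in emb S = {emb p / emb q | p q. poly_over S p \<and> poly_over S q \<and> q \<noteq> 0}"


subsection \<open>Substitution into polynomials in \<open>x\<close> and \<open>y\<close>\<close>

text \<open>\<open>p(X, y)\<close> and \<open>p(X, Y)\<close>, the coefficients of \<open>p\<close> being carried over by \<open>h\<close>.\<close>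
definition subst_x :: "('a::comm_ring_1 \<Rightarrow> 'b::comm_ring_1) \<Rightarrow> 'a poly poly \<Rightarrow> 'b \<Rightarrow> 'b poly" where
  "subst_x h p X = map_poly (\<lambda>q. poly (map_poly h q) X) p"

definition eval2 :: "('a::comm_ring_1 \<Rightarrow> 'b::comm_ring_1) \<Rightarrow> 'a poly poly \<Rightarrow> 'b \<Rightarrow> 'b \<Rightarrow> 'b" where
  "eval2 h p X Y = poly (subst_x h p X) Y"

text \<open>The rational function \<open>num / den\<close> at \<open>(X, Y)\<close>.\<close>
definition ratfun2 ::
    "('a::comm_ring_1 \<Rightarrow> 'b::field) \<Rightarrow> 'a poly poly \<Rightarrow> 'a poly poly \<Rightarrow> 'b \<Rightarrow> 'b \<Rightarrow> 'b" where
  "ratfun2 h num den X Y = eval2 h num X Y / eval2 h den X Y"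

text \<open>
  \<open>y 0, \<dots>, y (n - 1)\<close> are the roots, with multiplicity, of the monic \<open>\<chi>(X, y)\<close> in an extension of
  its coefficient field.
\<close>
definition roots_of ::
    "('a::comm_ring_1 \<Rightarrow> 'b::field) \<Rightarrow> 'a poly poly \<Rightarrow> 'b \<Rightarrow> nat \<Rightarrow> (nat \<Rightarrow> 'b) \<Rightarrow> bool" where
  "roots_of h \<chi> X n y \<longleftrightarrow> subst_x h \<chi> X = (\<Prod>l<n. [:- y l, 1:])"


subsection \<open>Derivations, differentials and logarithms\<close>

definition derivation :: "('a::field \<Rightarrow> 'a) \<Rightarrow> bool" where
  "derivation d \<longleftrightarrow> (\<forall>u v. d (u + v) = d u + d v \<and> d (u * v) = d u * v + u * d v)"

text \<open>
  The differential \<open>\<delta> h = (\<Sum>i\<in>I. \<partial>h/\<partial>a\<^sub>i da\<^sub>i)\<close> is given by its coordinates with respect to the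
  basis \<open>da\<^sub>i\<close>, where \<open>i\<close> runs through the indices of the independent parameters and
  \<open>D i = \<partial>/\<partial>a\<^sub>i\<close>.
\<close>
definition differential :: "nat set \<Rightarrow> (nat \<Rightarrow> 'a \<Rightarrow> 'a) \<Rightarrow> 'a::field \<Rightarrow> nat \<Rightarrow> 'a" where
  "differential I D h = (\<lambda>i. if i \<in> I then D i h else 0)"

definition is_logarithm :: "nat set \<Rightarrow> (nat \<Rightarrow> 'a \<Rightarrow> 'a) \<Rightarrow> 'a::field \<Rightarrow> 'a \<Rightarrow> bool" where
  "is_logarithm I D c l \<longleftrightarrow> (\<forall>i\<in>I. D i l = 1 / c * D i c)"


subsection \<open>Puiseux expansions\<close>

text \<open>
  A Puiseux series whose exponents have the common denominator \<open>N\<close> is a Laurent series in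
  \<open>t = (x - \<beta>) powr (1/N)\<close>, respectively \<open>t = (1/x) powr (1/N)\<close> at infinity. So \<open>x\<close> itself is the
  series \<open>\<beta> + t ^ N\<close>, respectively \<open>t ^ (-N)\<close>; the coefficient of \<open>1/(x - \<beta>)\<close> is that of
  \<open>t ^ (-N)\<close>, and the coefficient of \<open>1/x\<close> at infinity is that of \<open>t ^ N\<close>.
\<close>
definition x_at :: "nat \<Rightarrow> 'a::field \<Rightarrow> 'a fls" where
  "x_at N \<beta> = fls_const \<beta> + fls_X ^ N"

definition x_at_infinity :: "nat \<Rightarrow> 'a::field fls" where
  "x_at_infinity N = fls_X_inv ^ N"

definition puiseux_residue :: "nat \<Rightarrow> 'a::field fls \<Rightarrow> 'a" where
  "puiseux_residue N s = fls_nth s (- int N)"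

definition puiseux_Pi :: "nat \<Rightarrow> 'a::field fls \<Rightarrow> 'a" where
  "puiseux_Pi N s = fls_nth s (int N)"

text \<open>
  The decomposition \<open>g = c t\<^sup>m (1 + W)\<close> of a nonzero series \<open>g\<close>: the leading coefficient \<open>c\<close>
  and the power series \<open>W\<close> without constant term.
\<close>
definition fls_lead :: "'a::field fls \<Rightarrow> 'a" where
  "fls_lead g = fls_nth g (fls_subdegree g)"

definition fls_tail :: "'a::field fls \<Rightarrow> 'a fps" where
  "fls_tail g = fps_const (1 / fls_lead g) * fls_base_factor_to_fps g - 1"

text \<open>
  \<open>log c + (\<Sum>k\<ge>1. (-1) ^ (k - 1) * W ^ k / k)\<close>, where \<open>lg\<close> provides the logarithms of the leading
  coefficients; \<open>fps_ln 1\<close> is the series of \<open>log (1 + X)\<close>.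
\<close>
definition puiseux_log :: "('a \<Rightarrow> 'a) \<Rightarrow> 'a::field_char_0 fls \<Rightarrow> 'a fls" where
  "puiseux_log lg g = fls_const (lg (fls_lead g)) + fps_to_fls (fps_compose (fps_ln 1) (fls_tail g))"

text \<open>
  The series \<open>\<Sum>l. f(x, y\<^sup>l) * log \<theta>(x, y\<^sup>l)\<close> at a place, for \<open>f = num / den\<close>; \<open>X\<close> is the expansion of
  \<open>x\<close> at that place and \<open>y l\<close> are the expansions of the roots.
\<close>
definition S_hat ::
    "('k::comm_ring_1 \<Rightarrow> 'a) \<Rightarrow> ('a \<Rightarrow> 'a) \<Rightarrow> 'k poly poly \<Rightarrow> 'k poly poly \<Rightarrow>
     'a poly poly \<Rightarrow> nat \<Rightarrow> 'a fls \<Rightarrow> (nat \<Rightarrow> 'a fls) \<Rightarrow> 'a::field_char_0 fls" where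
  "S_hat \<iota> lg num den \<theta> n X y =
     (\<Sum>l<n. ratfun2 (\<lambda>z. fls_const (\<iota> z)) num den X (y l) * puiseux_log lg (eval2 fls_const \<theta> X (y l)))"

end

theory Submission
  imports Defs "Jordan_Normal_Form.Char_Poly" "HOL-Computational_Algebra.Field_as_Ring"
begin

text \<open>
  Fix a derivation \<open>D = \<partial>/\<partial>a\<^sub>i\<close> and let it act on Puiseux series coefficientwise. The
  expansions of \<open>x\<close>, \<open>y\<^sup>l\<close> and \<open>f\<close> are constants for it, and \<open>D (log \<theta>) = D \<theta> / \<theta>\<close>, so at each
  place the derivative of \<open>\<Sum>l. f(x, y\<^sup>l) log \<theta>(x, y\<^sup>l)\<close> is the expansion of one and the same
  rational function of \<open>x\<close>, the trace \<open>R = \<Sum>l. f(x, y\<^sup>l) (D \<theta> / \<theta>)(x, y\<^sup>l)\<close>. By Lagrange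
  interpolation \<open>R\<close> has denominator \<open>f\<^sub>2 r\<close>, where \<open>r = F\<^sub>0 F = A \<theta> + B \<chi>\<close> is the norm of \<open>\<theta>\<close>.
  The residues of \<open>R\<close> at the roots of \<open>f\<^sub>2 F\<^sub>0 F\<close> add up to the coefficient of \<open>1/x\<close> at infinity. At a
  (simple) root \<open>u\<close> of \<open>F\<close> the residue is \<open>- \<Sum>v. f(u, v) D u\<close>, as one sees by differentiating
  \<open>\<chi>(u, v) = \<theta>(u, v) = 0\<close>.
\<close>

hide_const (open) module.smult

subsection \<open>Subrings and partial homomorphisms\<close>

text \<open>The curve is irreducible over the complex numbers, but the computation takes place in
  the differential field \<open>'a\<close>, into which \<open>\<iota>\<close> carries only the
  algebraic closure of K. What is carried over is a consequence of irreducibility: for every g over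
  K not divisible by \<open>\<chi>\<close>, an identity A g + B \<open>\<chi>\<close> =
  \<open>\<rho>\<close> with a nonzero \<open>\<rho>\<close> in K[x]. Such an identity stays useful
  under every homomorphism that is injective on K[x]. Three kinds occur: into the extension field
  containing the roots \<open>y l\<close>, into Laurent series at a place, and evaluation of x at an
  element transcendental over K. The product formula for r is given in the first of these targets
  only. Hence r is identified with a determinant formed from \<open>\<chi>\<close> and
  \<open>\<theta>\<close>, which commutes with all homomorphisms. At the roots of F neither Puiseux
  expansions nor logarithms are given; there only the rational function R is expanded, in the
  unramified parameter x - u.\<close>

definition is_subring :: "'a::idom set \<Rightarrow> bool" where
  "is_subring S \<longleftrightarrow> 0 \<in> S \<and> 1 \<in> S \<and> (\<forall>u\<in>S. \<forall>v\<in>S. u + v \<in> S \<and> u - v \<in> S \<and> u * v \<in> S)"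

text \<open>The embedding \<open>\<iota>\<close> of the constants respects the operations only on
  the algebraic closure of K and is arbitrary elsewhere, so the algebra has to be relative to a
  subring.\<close>

definition ring_hom_on :: "'a::idom set \<Rightarrow> ('a \<Rightarrow> 'b::idom) \<Rightarrow> bool" where
  "ring_hom_on S h \<longleftrightarrow> h 0 = 0 \<and> h 1 = 1 \<and>
     (\<forall>u\<in>S. \<forall>v\<in>S. h (u + v) = h u + h v \<and> h (u * v) = h u * h v)"

lemma is_subring_UNIV [simp]: "is_subring UNIV"
  by (simp add: is_subring_def)

lemma is_subfield_imp_is_subring: "is_subfield S \<Longrightarrow> is_subring S"
  by (simp add: is_subfield_def is_subring_def)

context
  fixes S :: "'a::idom set"
  assumes S: "is_subring S"
begin

lemma subring_0: "0 \<in> S" and subring_1: "1 \<in> S"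
  and subring_add: "u \<in> S \<Longrightarrow> v \<in> S \<Longrightarrow> u + v \<in> S"
  and subring_diff: "u \<in> S \<Longrightarrow> v \<in> S \<Longrightarrow> u - v \<in> S"
  and subring_mult: "u \<in> S \<Longrightarrow> v \<in> S \<Longrightarrow> u * v \<in> S"
  using S by (auto simp: is_subring_def)

lemma subring_uminus: "u \<in> S \<Longrightarrow> - u \<in> S"
  using subring_diff[OF subring_0] by force

lemma subring_sum: "(\<And>i. i \<in> A \<Longrightarrow> f i \<in> S) \<Longrightarrow> sum f A \<in> S"
  by (induction A rule: infinite_finite_induct) (auto intro: subring_0 subring_add)

lemma subring_prod: "(\<And>i. i \<in> A \<Longrightarrow> f i \<in> S) \<Longrightarrow> prod f A \<in> S"
  by (induction A rule: infinite_finite_induct) (auto intro: subring_1 subring_mult)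

lemma subring_power: "u \<in> S \<Longrightarrow> u ^ k \<in> S"
  by (induction k) (auto intro: subring_1 subring_mult)

lemma subring_of_nat: "of_nat k \<in> S"
  by (induction k) (auto intro: subring_0 subring_1 subring_add)

lemma subring_det: "A \<in> carrier_mat n n \<Longrightarrow> (\<And>i j. i < n \<Longrightarrow> j < n \<Longrightarrow> A $$ (i, j) \<in> S) \<Longrightarrow> det A \<in> S"
  by (subst det_def', assumption)
    (auto intro!: subring_sum subring_mult subring_prod simp: sign_def subring_1 subring_uminus permutes_def
      dest: permutes_in_image[of _ "{0..<n}"])

text \<open>Iterating this lets the univariate lemmas serve for \<open>poly2_over\<close>, with
  polynomials in x over S as the coefficient ring.\<close>

lemma is_subring_poly_over: "is_subring {p. poly_over S p}"
  unfolding is_subring_def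
  by (auto simp: poly_over_def coeff_mult coeff_1 intro: subring_0 subring_1 subring_add subring_diff
      intro!: subring_sum subring_mult)

lemma poly_over_pCons: "poly_over S (pCons c p) \<longleftrightarrow> c \<in> S \<and> poly_over S p"
  unfolding poly_over_def by (auto simp: coeff_pCons split: nat.splits)

lemma poly_over_0: "poly_over S 0"
  by (simp add: poly_over_def subring_0)

lemma poly_over_smult: "c \<in> S \<Longrightarrow> poly_over S p \<Longrightarrow> poly_over S (smult c p)"
  by (simp add: poly_over_def subring_mult)

lemma poly_over_pderiv: "poly_over S p \<Longrightarrow> poly_over S (pderiv p)"
  unfolding poly_over_def coeff_pderiv by (auto intro!: subring_mult subring_of_nat simp del: of_nat_Suc)

lemma poly_in_subring: "poly_over S p \<Longrightarrow> z \<in> S \<Longrightarrow> poly p z \<in> S"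
  unfolding poly_altdef poly_over_def by (auto intro!: subring_sum subring_mult subring_power)

end

lemma poly_over_map_poly: "h 0 = 0 \<Longrightarrow> poly_over S p \<Longrightarrow> poly_over (h ` S) (map_poly h p)"
  by (auto simp: poly_over_def coeff_map_poly)

lemma poly_over_mono: "poly_over S p \<Longrightarrow> S \<subseteq> T \<Longrightarrow> poly_over T p"
  by (auto simp: poly_over_def)

lemma poly_over_UNIV [simp]: "poly_over UNIV p"
  by (simp add: poly_over_def)

lemma poly2_over_eq: "poly2_over S p \<longleftrightarrow> poly_over {q. poly_over S q} p"
  by (simp add: poly2_over_def poly_over_def)

context
  fixes S :: "'a::idom set" and h :: "'a \<Rightarrow> 'b::idom"
  assumes S: "is_subring S" and h: "ring_hom_on S h"
begin

lemma hom_on_0: "h 0 = 0" and hom_on_1: "h 1 = 1"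
  and hom_on_add: "u \<in> S \<Longrightarrow> v \<in> S \<Longrightarrow> h (u + v) = h u + h v"
  and hom_on_mult: "u \<in> S \<Longrightarrow> v \<in> S \<Longrightarrow> h (u * v) = h u * h v"
  using h by (auto simp: ring_hom_on_def)

lemma hom_on_diff: "u \<in> S \<Longrightarrow> v \<in> S \<Longrightarrow> h (u - v) = h u - h v"
  using hom_on_add[of "u - v" v] subring_diff[OF S, of u v] by simp

lemma hom_on_uminus: "u \<in> S \<Longrightarrow> h (- u) = - h u"
  using hom_on_diff[of 0 u] hom_on_0 subring_0[OF S] by simp

lemma hom_on_sum: "(\<And>i. i \<in> A \<Longrightarrow> f i \<in> S) \<Longrightarrow> h (sum f A) = (\<Sum>i\<in>A. h (f i))"
  by (induction A rule: infinite_finite_induct) (simp_all add: hom_on_0 hom_on_add subring_sum[OF S])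

lemma hom_on_of_nat: "h (of_nat k) = of_nat k"
  by (induction k) (simp_all add: hom_on_0 hom_on_1 hom_on_add subring_of_nat[OF S] subring_1[OF S])

lemma is_subring_hom_image: "is_subring (h ` S)"
  unfolding is_subring_def
proof (intro conjI ballI)
  show "0 \<in> h ` S" "1 \<in> h ` S"
    using subring_0[OF S] subring_1[OF S] hom_on_0 hom_on_1 by (force)+
  fix u' v' assume "u' \<in> h ` S" "v' \<in> h ` S"
  then obtain u v where uv: "u \<in> S" "v \<in> S" "u' = h u" "v' = h v" by blast
  show "u' + v' \<in> h ` S" "u' - v' \<in> h ` S" "u' * v' \<in> h ` S"
    using uv hom_on_add[of u v] hom_on_diff[of u v] hom_on_mult[of u v]
      subring_add[OF S, of u v] subring_diff[OF S, of u v] subring_mult[OF S, of u v] by (metis imageI)+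
qed

lemma ring_hom_on_map_poly: "ring_hom_on {p. poly_over S p} (map_poly h)"
  unfolding ring_hom_on_def
proof (intro conjI ballI)
  show "map_poly h 0 = 0" "map_poly h 1 = 1" by (simp_all add: hom_on_1)
  fix p q assume "p \<in> {p. poly_over S p}" "q \<in> {p. poly_over S p}"
  then have pq: "\<And>i. coeff p i \<in> S" "\<And>i. coeff q i \<in> S" by (auto simp: poly_over_def)
  show "map_poly h (p + q) = map_poly h p + map_poly h q"
    using pq by (intro poly_eqI) (simp add: coeff_map_poly hom_on_0 hom_on_add)
  show "map_poly h (p * q) = map_poly h p * map_poly h q"
    using pq by (intro poly_eqI)
      (simp add: coeff_map_poly hom_on_0 coeff_mult hom_on_sum hom_on_mult subring_mult[OF S])
qed

lemma map_poly_pderiv_on: "poly_over S p \<Longrightarrow> map_poly h (pderiv p) = pderiv (map_poly h p)"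
  by (intro poly_eqI) (simp add: coeff_map_poly hom_on_0 coeff_pderiv poly_over_def hom_on_mult
      subring_of_nat[OF S] hom_on_of_nat del: of_nat_Suc)

lemma map_poly_preimage:
  assumes "poly_over (h ` S) p"
  obtains p' where "poly_over S p'" "map_poly h p' = p"
proof
  \<comment> \<open>The separate value at 0 gives \<open>g 0 = 0\<close>, so that
    \<open>map_poly g\<close> acts on each coefficient.\<close>
  define g where "g c = (if c = 0 then 0 else SOME x. x \<in> S \<and> h x = c)" for c
  have g: "g c \<in> S \<and> h (g c) = c" if "c \<in> h ` S" for c
    using that someI_ex[of "\<lambda>x. x \<in> S \<and> h x = c"] subring_0[OF S] hom_on_0 by (auto simp: g_def)
  have g0: "g 0 = 0" by (simp add: g_def)
  show "poly_over S (map_poly g p)"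
    using assms g by (simp add: poly_over_def coeff_map_poly g0)
  show "map_poly h (map_poly g p) = p"
    using assms g by (intro poly_eqI) (simp add: poly_over_def coeff_map_poly g0 hom_on_0)
qed

end

lemma ring_hom_on_comp:
  assumes "ring_hom_on S h" "ring_hom_on T g" "h ` S \<subseteq> T"
  shows "ring_hom_on S (\<lambda>x. g (h x))"
  using assms unfolding ring_hom_on_def by (auto simp: image_subset_iff)

lemma ring_hom_on_subset: "ring_hom_on S h \<Longrightarrow> T \<subseteq> S \<Longrightarrow> ring_hom_on T h"
  unfolding ring_hom_on_def by blast

lemma ring_hom_on_poly: "ring_hom_on UNIV (\<lambda>p. poly p X)"
  by (simp add: ring_hom_on_def)

lemma ring_hom_on_eval:
  assumes "is_subring S" "ring_hom_on S h"
  shows "ring_hom_on {p. poly_over S p} (\<lambda>p. poly (map_poly h p) X)"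
  using ring_hom_on_comp[OF ring_hom_on_map_poly[OF assms] ring_hom_on_poly] by simp

lemma is_subring_poly2_over: "is_subring S \<Longrightarrow> is_subring {p. poly2_over S p}"
  using is_subring_poly_over[OF is_subring_poly_over, of S] by (simp add: poly2_over_eq)

lemma eval2_altdef: "eval2 h p X Y = poly (map_poly (\<lambda>q. poly (map_poly h q) X) p) Y"
  by (simp add: eval2_def subst_x_def)

lemma ring_hom_on_eval2:
  assumes "is_subring S" "ring_hom_on S h"
  shows "ring_hom_on {p. poly2_over S p} (\<lambda>p. eval2 h p X Y)"
  unfolding poly2_over_eq eval2_altdef
  by (intro ring_hom_on_eval is_subring_poly_over assms)

lemma ring_hom_on_fls_const: "ring_hom_on UNIV (fls_const :: 'a::idom \<Rightarrow> 'a fls)"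
  by (simp add: ring_hom_on_def fls_plus_const fls_const_mult_const)

lemma ring_hom_on_id: "ring_hom_on UNIV (\<lambda>x. x)"
  by (simp add: ring_hom_on_def)

lemma eval2_map_poly:
  assumes "g 0 = 0"  "h 0 = 0"
  shows "eval2 g (map_poly (map_poly h) p) X Y = eval2 (\<lambda>z. g (h z)) p X Y"
  unfolding eval2_altdef
  by (simp add: map_poly_map_poly o_def assms)

lemma subst_x_map_poly:
  assumes "g 0 = 0"  "h 0 = 0"
  shows "subst_x g (map_poly (map_poly h) p) X = subst_x (\<lambda>z. g (h z)) p X"
  unfolding subst_x_def
  by (simp add: map_poly_map_poly o_def assms)

lemma field_hom_zero_iff:
  assumes S: "is_subfield S" and h: "ring_hom_on S (h :: _ \<Rightarrow> 'b::field)" and u: "u \<in> S"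
  shows "h u = 0 \<longleftrightarrow> u = 0"
proof
  assume u0: "h u = 0"
  show "u = 0"
  proof (rule ccontr)
    assume "u \<noteq> 0"
    have "1 / u \<in> S" using S u by (simp add: is_subfield_def)
    then have "h (u * (1 / u)) = h u * h (1 / u)" using h u unfolding ring_hom_on_def by blast
    then show False using u0 \<open>u \<noteq> 0\<close> h by (simp add: ring_hom_on_def)
  qed
qed (use h in \<open>simp add: ring_hom_on_def\<close>)

lemma field_hom_inj_on:
  assumes S: "is_subfield S" and h: "ring_hom_on S (h :: _ \<Rightarrow> 'b::field)"
  shows "inj_on h S"
proof (rule inj_onI)
  fix u v assume uv: "u \<in> S" "v \<in> S" "h u = h v"
  note sr = is_subfield_imp_is_subring[OF S]
  have "h (u - v) = 0" using uv hom_on_diff[OF sr h, of u v] by simp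
  then show "u = v" using field_hom_zero_iff[OF S h, of "u - v"] subring_diff[OF sr] uv by auto
qed

lemma is_subfield_hom_image:
  assumes S: "is_subfield S" and h: "ring_hom_on S (h :: _ \<Rightarrow> 'b::field)"
  shows "is_subfield (h ` S)"
proof -
  note sr = is_subfield_imp_is_subring[OF S]
  have "u / v \<in> h ` S" if "u \<in> h ` S" "v \<in> h ` S" for u v
  proof -
    from that obtain x y where xy: "x \<in> S" "y \<in> S" "u = h x" "v = h y" by blast
    have d: "x / y \<in> S" using S xy by (auto simp: is_subfield_def)
    show ?thesis
    proof (cases "y = 0")
      case True
      then show ?thesis using xy h S by (force simp: ring_hom_on_def is_subfield_def)
    next
      case False
      then have "h (x / y * y) = h (x / y) * h y" using hom_on_mult[OF sr h] d xy by blast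
      then have "u / v = h (x / y)" using False xy field_hom_zero_iff[OF S h] by (simp add: field_simps)
      then show ?thesis using d by blast
    qed
  qed
  then show ?thesis
    using is_subring_hom_image[OF sr h] by (simp add: is_subfield_def is_subring_def)
qed

subsection \<open>Division and Bezout identities over a subring\<close>

text \<open>Scaling by the leading coefficient replaces division, so all coefficients stay in S.
  Bounding R by vanishing coefficients instead of its degree covers a zero remainder and a constant
  p uniformly.\<close>

lemma pseudo_division_over:
  fixes p g :: "'a::idom poly"
  assumes S: "is_subring S" and p: "poly_over S p" and g: "poly_over S g"
  obtains k H R where "poly_over S H" "poly_over S R" "smult (lead_coeff p ^ k) g = p * H + R"
    "\<And>j. j \<ge> degree p \<Longrightarrow> coeff R j = 0"
proof -
  have "\<exists>k H R. poly_over S H \<and> poly_over S R \<and> smult (lead_coeff p ^ k) g = p * H + R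
          \<and> (\<forall>j\<ge>degree p. coeff R j = 0)"
    using g
  proof (induction g)
    case 0
    show ?case
      by (intro exI[of _ 0] conjI) (auto intro: poly_over_0[OF S])
  next
    case (pCons a g)
    from pCons obtain k H R where IH: "poly_over S H" "poly_over S R"
      "smult (lead_coeff p ^ k) g = p * H + R" "\<forall>j\<ge>degree p. coeff R j = 0"
      by (auto simp: poly_over_pCons[OF S])
    have lc: "lead_coeff p \<in> S" using p by (simp add: poly_over_def)
    have a: "a \<in> S" using pCons.prems by (simp add: poly_over_pCons[OF S])
    define R1 where "R1 = pCons (lead_coeff p ^ k * a) R"
    define c where "c = coeff R1 (degree p)"
    have R1: "poly_over S R1"
      by (simp add: R1_def poly_over_pCons[OF S] IH a lc subring_mult[OF S] subring_power[OF S])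
    then have c: "c \<in> S" by (simp add: c_def poly_over_def)
    have sr: "is_subring {p. poly_over S p}" by (rule is_subring_poly_over[OF S])
    show ?case
    proof (intro exI conjI)
      show "poly_over S (smult (lead_coeff p) (pCons 0 H) + [:c:])"
        using subring_add[OF sr, of "smult (lead_coeff p) (pCons 0 H)" "[:c:]"] IH lc c
        by (simp add: poly_over_pCons[OF S] poly_over_smult[OF S] subring_0[OF S] poly_over_0[OF S]
            del: smult_pCons add_pCons)
      show "poly_over S (smult (lead_coeff p) R1 - smult c p)"
        using subring_diff[OF sr, of "smult (lead_coeff p) R1" "smult c p"] R1 lc c p
        by (simp add: poly_over_smult[OF S])
      have "smult (lead_coeff p ^ k) (pCons a g) = pCons (lead_coeff p ^ k * a) (p * H + R)"
        using IH(3) by simp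
      also have "\<dots> = p * pCons 0 H + R1"
        by (simp add: R1_def)
      finally have "smult (lead_coeff p) (smult (lead_coeff p ^ k) (pCons a g))
         = smult (lead_coeff p) (p * pCons 0 H + R1)" by simp
      then show "smult (lead_coeff p ^ Suc k) (pCons a g)
         = p * (smult (lead_coeff p) (pCons 0 H) + [:c:]) + (smult (lead_coeff p) R1 - smult c p)"
        by (simp add: algebra_simps smult_add_right)
      show "\<forall>j\<ge>degree p. coeff (smult (lead_coeff p) R1 - smult c p) j = 0"
      proof (intro allI impI)
        fix j assume j: "j \<ge> degree p"
        show "coeff (smult (lead_coeff p) R1 - smult c p) j = 0"
        proof (cases "j = degree p")
          case False
          with j obtain i where i: "j = Suc i" "i \<ge> degree p" by (cases j) auto
          then show ?thesis using IH(4) by (simp add: R1_def coeff_eq_0)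
        qed (simp add: c_def)
      qed
    qed
  qed
  then show ?thesis using that by blast
qed

lemma monic_division_over:
  fixes p g :: "'a::idom poly"
  assumes S: "is_subring S" and p: "poly_over S p" "lead_coeff p = 1" and g: "poly_over S g"
  obtains H R where "poly_over S H" "poly_over S R" "g = p * H + R"
    "\<And>j. j \<ge> degree p \<Longrightarrow> coeff R j = 0"
  using pseudo_division_over[OF S p(1) g] p(2) by (metis power_one smult_1_left)

lemma degree_less_if_coeff_0:
  "(\<And>j. j \<ge> n \<Longrightarrow> coeff R j = 0) \<Longrightarrow> R \<noteq> 0 \<Longrightarrow> degree R < n"
  by (meson leading_coeff_0_iff not_le)

lemma monic_dvd_small_imp_0:
  fixes p R :: "'a::idom poly"
  assumes "p dvd R" "\<And>j. j \<ge> degree p \<Longrightarrow> coeff R j = 0"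
  shows "R = 0"
  using assms degree_less_if_coeff_0 by (meson dvd_imp_degree_le not_le)

lemma monic_dvd_over:
  fixes p g :: "'a::idom poly"
  assumes S: "is_subring S" and p: "poly_over S p" "lead_coeff p = 1" and g: "poly_over S g" "p dvd g"
  obtains H where "poly_over S H" "g = p * H"
proof -
  obtain H R where HR: "poly_over S H" "poly_over S R" "g = p * H + R"
    "\<And>j. j \<ge> degree p \<Longrightarrow> coeff R j = 0"
    using monic_division_over[OF S p g(1)] by blast
  have "p dvd R" using g(2) HR(3) by (simp add: dvd_add_right_iff)
  then show ?thesis using that HR monic_dvd_small_imp_0[of p R] by simp
qed

text \<open>A combination of \<open>g\<close> and \<open>\<chi>\<close> of minimal degree divides, up to constants, both of them.\<close>
lemma bezout_prime_over:
  fixes \<chi> g :: "'a::idom poly"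
  assumes S: "is_subring S" and chi: "poly_over S \<chi>" "lead_coeff \<chi> = 1" "prime_elem \<chi>"
    and g: "poly_over S g" "\<not> \<chi> dvd g"
  obtains A B \<rho> where "poly_over S A" "poly_over S B" "\<rho> \<in> S" "\<rho> \<noteq> 0" "A * g + B * \<chi> = [:\<rho>:]"
proof -
  have sr: "is_subring {p. poly_over S p}" by (rule is_subring_poly_over[OF S])
  note cl = subring_0[OF sr] subring_1[OF sr] subring_add[OF sr] subring_diff[OF sr] subring_mult[OF sr]
  define J where "J p \<longleftrightarrow> (\<exists>A B. poly_over S A \<and> poly_over S B \<and> p = A * g + B * \<chi>)" for p
  have J_over: "poly_over S p" if "J p" for p
    using that cl g(1) chi(1) unfolding J_def by auto
  have J_g: "J g" unfolding J_def
    by (rule exI[of _ 1], rule exI[of _ 0]) (use cl in auto)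
  have J_chi: "J \<chi>" unfolding J_def
    by (rule exI[of _ 0], rule exI[of _ 1]) (use cl in auto)
  have J_comb: "J (smult c u - p * H)" if "J u" "J p" "c \<in> S" "poly_over S H" for c u p H
  proof -
    from that(1,2) obtain A B A' B' where AB: "poly_over S A" "poly_over S B" "u = A * g + B * \<chi>"
      "poly_over S A'" "poly_over S B'" "p = A' * g + B' * \<chi>" unfolding J_def by blast
    have "smult c u - p * H = (smult c A - A' * H) * g + (smult c B - B' * H) * \<chi>"
      by (simp add: AB algebra_simps smult_add_right)
    moreover have "poly_over S (smult c A - A' * H)" "poly_over S (smult c B - B' * H)"
      using cl AB that poly_over_smult[OF S] by auto
    ultimately show ?thesis unfolding J_def by blast
  qed
  have "\<exists>p. (J p \<and> p \<noteq> 0) \<and> (\<forall>q. J q \<and> q \<noteq> 0 \<longrightarrow> degree p \<le> degree q)"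
    using ex_has_least_nat[of "\<lambda>p. J p \<and> p \<noteq> 0" \<chi> degree] J_chi chi(3) by auto
  then obtain p where p: "J p" "p \<noteq> 0" and min: "\<And>q. J q \<Longrightarrow> q \<noteq> 0 \<Longrightarrow> degree p \<le> degree q"
    by blast
  have lc: "lead_coeff p \<in> S" using J_over[OF p(1)] by (simp add: poly_over_def)
  have divides: "\<exists>c H. c \<noteq> 0 \<and> smult c u = p * H" if u: "J u" for u
  proof -
    obtain k H R where HR: "poly_over S H" "poly_over S R" "smult (lead_coeff p ^ k) u = p * H + R"
      "\<And>j. j \<ge> degree p \<Longrightarrow> coeff R j = 0"
      using pseudo_division_over[OF S J_over[OF p(1)] J_over[OF u]] by metis
    have "J R"
      using J_comb[OF u p(1) _ HR(1), of "lead_coeff p ^ k"] HR(3) lc subring_power[OF S] by simp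
    then have "R = 0" using min[of R] HR(4) degree_less_if_coeff_0[of "degree p" R] by force
    then show ?thesis using HR(3) p(2) by (intro exI[of _ "lead_coeff p ^ k"]) auto
  qed
  have nu: "degree \<chi> \<noteq> 0"
  proof
    assume "degree \<chi> = 0"
    then have "\<chi> = 1" using chi(2) by (metis degree_0_id of_nat_1 one_pCons)
    then show False using chi(3) by simp
  qed
  have nd: "\<not> \<chi> dvd [:c:]" if "c \<noteq> 0" for c
    using that nu dvd_imp_degree_le[of \<chi> "[:c:]"] by auto
  obtain c H where cH: "c \<noteq> 0" "smult c \<chi> = p * H" using divides[OF J_chi] by blast
  obtain c' H' where cH': "c' \<noteq> 0" "smult c' g = p * H'" using divides[OF J_g] by blast
  \<comment> \<open>Primality holds in the full polynomial ring, while the combination p stays over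
    S. Since \<open>\<chi>\<close> has positive degree it divides no nonzero constant, so dividing p
    would force it to divide g. Hence \<open>\<chi>\<close> divides the cofactor H, and cancelling
    it leaves p as a divisor of a constant.\<close>
  have "\<not> \<chi> dvd p"
  proof
    assume "\<chi> dvd p"
    then have "\<chi> dvd [:c':] * g" using cH' by simp
    then show False using prime_elem_dvd_mult_iff[OF chi(3)] nd[OF cH'(1)] g(2) by blast
  qed
  moreover have "\<chi> dvd p * H" using cH(2) by (metis dvd_smult dvd_refl)
  ultimately have "\<chi> dvd H" using prime_elem_dvd_mult_iff[OF chi(3)] by blast
  then obtain H2 where H2: "H = \<chi> * H2" by (elim dvdE)
  have "\<chi> * [:c:] = \<chi> * (p * H2)" using cH(2) H2 by (simp add: mult_ac)
  then have "[:c:] = p * H2" using chi(3) by (metis mult_cancel_left prime_elem_not_zeroI)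
  then have "degree p = 0" using cH(1) p(2)
    by (metis add_is_0 degree_mult_eq degree_pCons_0 mult_eq_0_iff pCons_eq_0_iff)
  then obtain \<rho> where rho: "p = [:\<rho>:]" using degree_eq_zeroE by blast
  then have "\<rho> \<in> S" "\<rho> \<noteq> 0" using J_over[OF p(1)] p(2) by (auto simp: poly_over_pCons[OF S])
  then show ?thesis using that p(1) rho unfolding J_def by metis
qed

lemma complex_poly2_prime_elem: "irreducible p \<Longrightarrow> prime_elem (p :: complex poly poly)"
  by (simp add: prime_elem_iff_irreducible)

subsection \<open>Algebraic elements\<close>

text \<open>The family w is an eigenvector of M for z, so z is a root of the characteristic
  polynomial, which is monic with coefficients in S.\<close>

lemma algebraic_if_eigenvalue:
  fixes z :: "'a::field"
  assumes S: "is_subring S" and A: "finite A" and nz: "\<exists>i\<in>A. w i \<noteq> 0"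
    and M: "\<And>i j. i \<in> A \<Longrightarrow> j \<in> A \<Longrightarrow> M i j \<in> S"
    and ev: "\<And>i. i \<in> A \<Longrightarrow> z * w i = (\<Sum>j\<in>A. M i j * w j)"
  shows "algebraic_over S z"
proof -
  obtain e where e: "bij_betw e {0..<card A} A" using ex_bij_betw_nat_finite[OF A] by blast
  define n where "n = card A"
  define Q where "Q = mat n n (\<lambda>(i, j). M (e i) (e j))"
  define v where "v = vec n (\<lambda>i. w (e i))"
  have Q: "Q \<in> carrier_mat n n" by (simp add: Q_def)
  have eA: "e i \<in> A" if "i < n" for i using e that by (auto simp: bij_betw_def n_def)
  have "v \<noteq> 0\<^sub>v n"
  proof
    assume v0: "v = 0\<^sub>v n"
    from nz obtain a where a: "a \<in> A" "w a \<noteq> 0" by blast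
    then have "a \<in> e ` {0..<card A}" using e by (simp add: bij_betw_def)
    then obtain i where i: "i < n" "a = e i" by (auto simp: n_def)
    have "v $ i = 0" using v0 i by simp
    then show False using a i by (simp add: v_def)
  qed
  moreover have "Q *\<^sub>v v = z \<cdot>\<^sub>v v"
  proof (rule eq_vecI)
    fix i assume "i < dim_vec (z \<cdot>\<^sub>v v)"
    then have i: "i < n" by (simp add: v_def)
    have "(Q *\<^sub>v v) $ i = (\<Sum>j\<in>{0..<n}. M (e i) (e j) * w (e j))"
      using i by (simp add: Q_def v_def scalar_prod_def)
    also have "\<dots> = (\<Sum>j\<in>A. M (e i) j * w j)"
      using e unfolding n_def by (rule sum.reindex_bij_betw)
    also have "\<dots> = z * w (e i)" using ev[OF eA[OF i]] by simp
    finally show "(Q *\<^sub>v v) $ i = (z \<cdot>\<^sub>v v) $ i" using i by (simp add: v_def)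
  qed (simp add: Q_def v_def)
  ultimately have "eigenvalue Q z"
    unfolding eigenvalue_def eigenvector_def by (intro exI[of _ v]) (simp add: Q_def v_def)
  then have "poly (char_poly Q) z = 0" using eigenvalue_root_char_poly[OF Q] by blast
  moreover have "char_poly Q \<noteq> 0" using degree_monic_char_poly[OF Q] by auto
  moreover have "poly_over S (char_poly Q)"
  proof -
    have "char_poly_matrix Q $$ (i, j) \<in> {p. poly_over S p}" if "i < n" "j < n" for i j
    proof -
      have *: "- M (e i) (e j) \<in> S" using that M eA subring_uminus[OF S] by blast
      have "is_subring {p. poly_over S p}" by (rule is_subring_poly_over[OF S])
      then show ?thesis using that *
        by (auto simp: char_poly_matrix_def Q_def poly_over_pCons[OF S] poly_over_0[OF S]
            subring_0[OF S] subring_1[OF S] one_pCons)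
    qed
    then show ?thesis unfolding char_poly_def
      using subring_det[OF is_subring_poly_over[OF S], of "char_poly_matrix Q" n] Q by simp
  qed
  ultimately show ?thesis unfolding algebraic_over_def by blast
qed

lemma algebraic_over_monic:
  fixes u :: "'a::field"
  assumes S: "is_subfield S" and u: "algebraic_over S u"
  obtains p where "poly_over S p" "lead_coeff p = 1" "poly p u = 0" "degree p > 0"
proof -
  from u obtain p where p: "p \<noteq> 0" "poly_over S p" "poly p u = 0"
    by (auto simp: algebraic_over_def)
  define q where "q = smult (1 / lead_coeff p) p"
  have "1 / lead_coeff p \<in> S" using S p by (auto simp: is_subfield_def poly_over_def)
  then have "poly_over S q"
    using p poly_over_smult[OF is_subfield_imp_is_subring[OF S]] by (simp add: q_def)
  moreover have "lead_coeff q = 1" "poly q u = 0" using p by (simp_all add: q_def)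
  moreover have "degree q > 0"
  proof (rule ccontr)
    assume "\<not> degree q > 0"
    then have "q = [:1:]" using \<open>lead_coeff q = 1\<close> by (metis degree_0_id gr0I)
    then show False using \<open>poly q u = 0\<close> by simp
  qed
  ultimately show ?thesis using that by blast
qed

lemma poly_eq_sum_lessThan:
  fixes R :: "'a::comm_ring_1 poly"
  assumes "\<And>j. j \<ge> n \<Longrightarrow> coeff R j = 0"
  shows "poly R z = (\<Sum>j<n. coeff R j * z ^ j)"
proof -
  have "poly R z = (\<Sum>j\<le>degree R. coeff R j * z ^ j)" by (rule poly_altdef)
  also have "\<dots> = (\<Sum>j<n. coeff R j * z ^ j)"
  proof (rule sum.mono_neutral_cong)
    show "\<And>i. i \<in> {..degree R} - {..<n} \<Longrightarrow> coeff R i * z ^ i = 0" using assms by auto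
    show "\<And>i. i \<in> {..<n} - {..degree R} \<Longrightarrow> coeff R i * z ^ i = 0" by (simp add: coeff_eq_0)
  qed auto
  finally show ?thesis .
qed

text \<open>
  \<open>S[u, v]\<close> is spanned over \<open>S\<close> by the finitely many products \<open>u\<^sup>i v\<^sup>j\<close> with bounded exponents, so
  multiplication by any of its elements is given by a matrix over \<open>S\<close>.
\<close>
lemma algebraic_over_eval2:
  fixes u v :: "'a::field"
  assumes S: "is_subfield S" and u: "algebraic_over S u"
    and chi: "poly2_over S \<chi>" "lead_coeff \<chi> = 1" "eval2 (\<lambda>c. c) \<chi> u v = 0"
    and p: "poly2_over S p"
  shows "algebraic_over S (eval2 (\<lambda>c. c) p u v)"
proof -
  have sr: "is_subring S" by (rule is_subfield_imp_is_subring[OF S])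
  have sr1: "is_subring {p. poly_over S p}" by (rule is_subring_poly_over[OF sr])
  have sr2: "is_subring {p. poly2_over S p}" by (rule is_subring_poly2_over[OF sr])
  obtain P where P: "poly_over S P" "lead_coeff P = 1" "poly P u = 0" "degree P > 0"
    using algebraic_over_monic[OF S u] by blast
  let ?e = "\<lambda>p. eval2 (\<lambda>c. c) p u v"
  have hom: "ring_hom_on {p. poly2_over S p} ?e"
    using ring_hom_on_eval2[OF sr ring_hom_on_subset[OF ring_hom_on_id]] by simp
  define d n where "d = degree P" and "n = degree \<chi>"
  have n: "n > 0"
  proof (rule ccontr)
    assume "\<not> n > 0"
    then have "\<chi> = 1" using chi(2) by (metis degree_0_id gr0I n_def one_pCons)
    then show False using chi(3) by (simp add: eval2_def subst_x_def)
  qed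
  define A where "A = {..<n} \<times> {..<d}"
  define w where "w = (\<lambda>(j, i). u ^ i * v ^ j)"
  have red: "\<exists>c. (\<forall>k\<in>A. c k \<in> S) \<and> ?e f = (\<Sum>k\<in>A. c k * w k)" if f: "poly2_over S f" for f
  proof -
    obtain H R where HR: "poly2_over S H" "poly2_over S R" "f = \<chi> * H + R"
      "\<And>j. j \<ge> n \<Longrightarrow> coeff R j = 0"
      using monic_division_over[OF sr1, of \<chi> f] chi(1,2) f unfolding poly2_over_eq n_def by blast
    have "?e f = ?e \<chi> * ?e H + ?e R"
      using hom_on_add[OF sr2 hom, of "\<chi> * H" R] hom_on_mult[OF sr2 hom, of \<chi> H]
        subring_mult[OF sr2, of \<chi> H] HR chi(1) by simp
    then have "?e f = ?e R" using chi(3) by simp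
    also have "\<dots> = (\<Sum>j<n. poly (coeff R j) u * v ^ j)"
      unfolding eval2_altdef
      by (subst poly_eq_sum_lessThan[where n = n]) (simp_all add: coeff_map_poly HR(4))
    finally have eq: "?e f = (\<Sum>j<n. poly (coeff R j) u * v ^ j)" .
    have "\<exists>s. poly_over S s \<and> poly (coeff R j) u = (\<Sum>i<d. coeff s i * u ^ i)" for j
    proof -
      obtain h s where hs: "poly_over S h" "poly_over S s" "coeff R j = P * h + s"
        "\<And>i. i \<ge> d \<Longrightarrow> coeff s i = 0"
        using monic_division_over[OF sr P(1,2), of "coeff R j"] HR(2) unfolding poly2_over_def d_def by blast
      have "poly (coeff R j) u = poly s u" using hs(3) P(3) by simp
      then show ?thesis using hs poly_eq_sum_lessThan[of d s u] by auto
    qed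
    then obtain s where s: "\<And>j. poly_over S (s j)"
      "\<And>j. poly (coeff R j) u = (\<Sum>i<d. coeff (s j) i * u ^ i)" by metis
    have "?e f = (\<Sum>j<n. \<Sum>i<d. coeff (s j) i * w (j, i))"
      unfolding eq by (simp add: s(2) sum_distrib_left w_def mult_ac)
    also have "\<dots> = (\<Sum>k\<in>A. (case k of (j, i) \<Rightarrow> coeff (s j) i) * w k)"
      unfolding A_def by (simp add: sum.cartesian_product case_prod_unfold)
    finally show ?thesis using s(1)
      by (intro exI[of _ "\<lambda>(j, i). coeff (s j) i"]) (auto simp: poly_over_def)
  qed
  have mon: "poly2_over S (monom (monom 1 i) j)" "?e (monom (monom 1 i) j) = u ^ i * v ^ j" for i j
    using subring_0[OF sr] subring_1[OF sr]
    by (auto simp: poly2_over_def poly_over_def eval2_altdef map_poly_monom poly_monom)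
  \<comment> \<open>The matrix row for the monomial \<open>w a\<close> comes from reducing the
    product of p with that monomial.\<close>
  have "\<exists>c. (\<forall>k\<in>A. c k \<in> S) \<and> ?e p * w a = (\<Sum>k\<in>A. c k * w k)" if "a \<in> A" for a
  proof -
    obtain j i where a: "a = (j, i)" by fastforce
    have "poly2_over S (p * monom (monom 1 i) j)"
      using subring_mult[OF sr2] p mon(1) by blast
    moreover have "?e (p * monom (monom 1 i) j) = ?e p * w a"
      using hom_on_mult[OF sr2 hom, of p "monom (monom 1 i) j"] p mon by (simp add: a w_def)
    ultimately show ?thesis using red by metis
  qed
  then obtain M where "\<And>a. a \<in> A \<Longrightarrow> (\<forall>k\<in>A. M a k \<in> S) \<and> ?e p * w a = (\<Sum>k\<in>A. M a k * w k)"
    by metis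
  moreover have "w (0, 0) \<noteq> 0" "(0, 0) \<in> A" using n P(4) by (auto simp: w_def A_def d_def)
  moreover have "finite A" by (simp add: A_def)
  ultimately show ?thesis using algebraic_if_eigenvalue[OF sr, of A w M] by blast
qed

lemma algebraic_over_y:
  fixes u v :: "'a::field"
  assumes S: "is_subfield S" and u: "algebraic_over S u"
    and chi: "poly2_over S \<chi>" "lead_coeff \<chi> = 1" "eval2 (\<lambda>c. c) \<chi> u v = 0"
  shows "algebraic_over S v"
proof -
  have sr: "is_subring S" by (rule is_subfield_imp_is_subring[OF S])
  show ?thesis
    using algebraic_over_eval2[OF assms, of "[:0, 1:]"] subring_0[OF sr] subring_1[OF sr]
    by (simp add: eval2_def subst_x_def poly2_over_eq poly_over_pCons is_subring_poly_over sr
        poly_over_0 one_pCons map_poly_pCons)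
qed

lemma is_subfield_algebraic:
  fixes S :: "'a::field set"
  assumes S: "is_subfield S"
  shows "is_subfield {z. algebraic_over S z}" and "S \<subseteq> {z. algebraic_over S z}"
proof -
  have sr: "is_subring S" by (rule is_subfield_imp_is_subring[OF S])
  note over = poly2_over_eq poly_over_pCons is_subring_poly_over sr poly_over_0 subring_0[OF sr]
    subring_1[OF sr] subring_uminus[OF sr]
  show sub: "S \<subseteq> {z. algebraic_over S z}"
  proof
    fix z assume "z \<in> S"
    then have "poly_over S [:- z, 1:]" by (simp add: over)
    then show "z \<in> {z. algebraic_over S z}"
      unfolding algebraic_over_def by (auto intro!: exI[of _ "[:- z, 1:]"])
  qed
  have ops: "algebraic_over S (u + v) \<and> algebraic_over S (u - v) \<and> algebraic_over S (u * v)"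
    if u: "algebraic_over S u" and v: "algebraic_over S v" for u v
  proof -
    obtain P where P: "poly_over S P" "lead_coeff P = 1" "poly P v = 0" "degree P > 0"
      using algebraic_over_monic[OF S v] by blast
    \<comment> \<open>A monic equation of v, read as a curve whose coefficients do not involve x,
      has (u, v) as a point for any u. Sum, difference and product are then values of bivariate
      polynomials at that point.\<close>
    define \<chi> where "\<chi> = map_poly (\<lambda>c. [:c:]) P"
    have chi: "poly2_over S \<chi>" "lead_coeff \<chi> = 1" "eval2 (\<lambda>c. c) \<chi> u v = 0"
    proof -
      show "poly2_over S \<chi>" using P(1)
        by (auto simp: poly2_over_def \<chi>_def coeff_map_poly over) (simp add: poly_over_def)
      have "degree \<chi> = degree P" unfolding \<chi>_def by (rule degree_map_poly) simp
      then show "lead_coeff \<chi> = 1" using P(2) by (simp add: \<chi>_def coeff_map_poly)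
      show "eval2 (\<lambda>c. c) \<chi> u v = 0" using P(3)
        by (simp add: eval2_altdef \<chi>_def map_poly_map_poly o_def)
    qed
    have "eval2 (\<lambda>c. c) [:[:0, 1:], 1:] u v = u + v" "eval2 (\<lambda>c. c) [:[:0, 1:], -1:] u v = u - v"
      "eval2 (\<lambda>c. c) [:0, [:0, 1:]:] u v = u * v"
      by (simp_all add: eval2_altdef map_poly_pCons)
    moreover have "poly2_over S [:[:0, 1:], 1:]" "poly2_over S [:[:0, 1:], -1:]" "poly2_over S [:0, [:0, 1:]:]"
      by (simp_all add: over one_pCons)
    ultimately show ?thesis using algebraic_over_eval2[OF S u chi] by metis
  qed
  have inv: "algebraic_over S (1 / v)" if v: "algebraic_over S v" for v
  proof (cases "v = 0")
    case False
    from v obtain p where p: "p \<noteq> 0" "poly_over S p" "poly p v = 0"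
      by (auto simp: algebraic_over_def)
    have "poly (reflect_poly p) (inverse v) = 0"
      using False p(3) by (simp add: poly_reflect_poly_nz)
    moreover have "poly_over S (reflect_poly p)"
      using p(2) by (auto simp: poly_over_def coeff_reflect_poly over)
    ultimately show ?thesis using p(1) unfolding algebraic_over_def
      by (intro exI[of _ "reflect_poly p"]) (auto simp: inverse_eq_divide)
  qed (use sub over in auto)
  have dv: "algebraic_over S (u / v)" if "algebraic_over S u" "algebraic_over S v" for u v
    using ops[OF that(1) inv[OF that(2)]] by simp
  show "is_subfield {z. algebraic_over S z}"
    using sub ops dv over unfolding is_subfield_def by auto
qed

subsection \<open>Norms and traces\<close>

definition monic_rem :: "'a::idom poly \<Rightarrow> 'a poly \<Rightarrow> 'a poly" where
  "monic_rem \<chi> g = (SOME R. \<chi> dvd g - R \<and> (\<forall>j\<ge>degree \<chi>. coeff R j = 0))"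

lemma monic_rem:
  assumes "lead_coeff \<chi> = 1"
  shows "\<chi> dvd g - monic_rem \<chi> g" "\<And>j. j \<ge> degree \<chi> \<Longrightarrow> coeff (monic_rem \<chi> g) j = 0"
proof -
  obtain H R where "g = \<chi> * H + R" "\<And>j. j \<ge> degree \<chi> \<Longrightarrow> coeff R j = 0"
    using monic_division_over[of UNIV \<chi> g] assms by (metis is_subring_UNIV poly_over_UNIV)
  then have "\<exists>R. \<chi> dvd g - R \<and> (\<forall>j\<ge>degree \<chi>. coeff R j = 0)"
    by (intro exI[of _ R]) auto
  from someI_ex[OF this]
  show "\<chi> dvd g - monic_rem \<chi> g" "\<And>j. j \<ge> degree \<chi> \<Longrightarrow> coeff (monic_rem \<chi> g) j = 0"
    unfolding monic_rem_def by auto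
qed

lemma poly_hom_monic_rem:
  assumes chi: "lead_coeff \<chi> = 1" and h: "ring_hom_on UNIV h" and z: "poly (map_poly h \<chi>) z = 0"
  shows "poly (map_poly h (monic_rem \<chi> g)) z = poly (map_poly h g) z"
proof -
  have hom: "ring_hom_on UNIV (\<lambda>p. poly (map_poly h p) z)"
    using ring_hom_on_eval[OF is_subring_UNIV h] by simp
  obtain H where "g - monic_rem \<chi> g = \<chi> * H" using monic_rem(1)[OF chi, of g] by (elim dvdE)
  then have "poly (map_poly h (g - monic_rem \<chi> g)) z = 0"
    using hom_on_mult[OF is_subring_UNIV hom] z by simp
  then show ?thesis using hom_on_diff[OF is_subring_UNIV hom, of g "monic_rem \<chi> g"] by simp
qed

lemma poly_eq_0_if_roots:
  fixes y :: "'i \<Rightarrow> 'a::idom"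
  assumes A: "finite A" "inj_on y A" and p: "\<And>j. j \<ge> card A \<Longrightarrow> coeff p j = 0"
    and roots: "\<And>l. l \<in> A \<Longrightarrow> poly p (y l) = 0"
  shows "p = 0"
proof (rule ccontr)
  assume p0: "p \<noteq> 0"
  have "card A = card (y ` A)" using A by (simp add: card_image)
  also have "\<dots> \<le> card {x. poly p x = 0}"
    using roots p0 by (intro card_mono poly_roots_finite) auto
  also have "\<dots> \<le> degree p" by (rule poly_roots_degree[OF p0])
  finally show False using degree_less_if_coeff_0[of "card A" p] p p0 by simp
qed

text \<open>This is multiplication by \<open>\<theta>\<close> on polynomials modulo
  \<open>\<chi>\<close> in the basis 1, y, y^2, ..., row j holding the image of y^j. Its determinant
  is the norm of \<open>\<theta>\<close>, formed without reference to any roots.\<close>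

definition norm_matrix :: "'a::idom poly \<Rightarrow> 'a poly \<Rightarrow> 'a mat" where
  "norm_matrix \<chi> \<theta> = mat (degree \<chi>) (degree \<chi>) (\<lambda>(j, k). coeff (monic_rem \<chi> (monom 1 j * \<theta>)) k)"

text \<open>The first row of the adjugate combines the rows of the matrix to (det, 0, ..., 0). Read
  modulo \<open>\<chi>\<close>, it combines the multiples y^j \<open>\<theta>\<close> to the
  constant det.\<close>

lemma det_norm_matrix_bezout:
  assumes chi: "lead_coeff \<chi> = 1" "degree \<chi> > 0"
  obtains A B where "A * \<theta> + B * \<chi> = [:det (norm_matrix \<chi> \<theta>):]"
proof -
  define n M R where "n = degree \<chi>" and "M = norm_matrix \<chi> \<theta>"
    and "R j = monic_rem \<chi> (monom 1 j * \<theta>)" for j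
  have M: "M \<in> carrier_mat n n" by (simp add: M_def norm_matrix_def n_def)
  have "\<forall>j. \<exists>H. monom 1 j * \<theta> = \<chi> * H + R j"
    using monic_rem(1)[OF chi(1)] unfolding R_def by (metis add_diff_cancel_right' diff_add_cancel dvdE)
  then obtain H where H: "\<And>j. monom 1 j * \<theta> = \<chi> * H j + R j" by metis
  define c where "c j = adj_mat M $$ (0, j)" for j
  note adj = adj_mat[OF M]
  have "(\<Sum>j<n. smult (c j) (R j)) = [:det M:]"
  proof (rule poly_eqI)
    fix k
    show "coeff (\<Sum>j<n. smult (c j) (R j)) k = coeff [:det M:] k"
    proof (cases "k < n")
      case True
      have "coeff (\<Sum>j<n. smult (c j) (R j)) k = (\<Sum>j<n. c j * M $$ (j, k))"
        using True by (simp add: coeff_sum M_def norm_matrix_def n_def R_def)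
      also have "\<dots> = (adj_mat M * M) $$ (0, k)"
        using True chi(2) adj(1) M
        by (simp add: scalar_prod_def c_def n_def atLeast0LessThan)
      also have "\<dots> = coeff [:det M:] k"
        using True chi(2) unfolding adj(3) by (simp add: n_def coeff_pCons split: nat.splits)
      finally show ?thesis .
    next
      case False
      then have "coeff (R j) k = 0" for j using monic_rem(2)[OF chi(1)] by (simp add: R_def n_def)
      then show ?thesis using False chi(2) by (simp add: coeff_sum coeff_pCons n_def split: nat.splits)
    qed
  qed
  also have "(\<Sum>j<n. smult (c j) (R j))
      = (\<Sum>j<n. monom (c j) j) * \<theta> + (- (\<Sum>j<n. smult (c j) (H j))) * \<chi>"
  proof -
    have "smult (c j) (R j) = monom (c j) j * \<theta> - smult (c j) (H j) * \<chi>" for j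
    proof -
      have "R j = monom 1 j * \<theta> - H j * \<chi>" using H[of j] by (simp add: mult.commute)
      then have "smult (c j) (R j) = smult (c j) (monom 1 j) * \<theta> - smult (c j) (H j) * \<chi>"
        by (simp only: smult_diff_right mult_smult_left)
      then show ?thesis by (simp add: smult_monom)
    qed
    then show ?thesis by (simp add: sum_subtractf sum_distrib_right)
  qed
  finally show ?thesis using that unfolding M_def by blast
qed

text \<open>The Vandermonde matrix V of the roots diagonalises multiplication by
  \<open>\<theta>\<close>: evaluating the row of y^j at a root gives y^j times the value of
  \<open>\<theta>\<close> there, so M V = V \<open>\<Delta>\<close>.\<close>

lemma det_norm_matrix_eq_prod:
  fixes h :: "'a::idom \<Rightarrow> 'b::field"
  assumes chi: "lead_coeff \<chi> = 1" "degree \<chi> = n" and h: "ring_hom_on UNIV h"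
    and y: "inj_on y {..<n}" "map_poly h \<chi> = (\<Prod>l<n. [:- y l, 1:])"
  shows "h (det (norm_matrix \<chi> \<theta>)) = (\<Prod>l<n. poly (map_poly h \<theta>) (y l))"
proof -
  interpret hom: comm_ring_hom h
    using h by unfold_locales (auto simp: ring_hom_on_def)
  define M V \<Delta> where "M = map_mat h (norm_matrix \<chi> \<theta>)" and "V = mat n n (\<lambda>(j, l). y l ^ j)"
    and "\<Delta> = mat n n (\<lambda>(j, l). if j = l then poly (map_poly h \<theta>) (y l) else 0)"
  have car: "M \<in> carrier_mat n n" "V \<in> carrier_mat n n" "\<Delta> \<in> carrier_mat n n"
    by (simp_all add: M_def norm_matrix_def V_def \<Delta>_def chi)
  have root: "poly (map_poly h \<chi>) (y l) = 0" if "l < n" for l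
    unfolding y(2) poly_prod using that by (intro prod_zero) auto
  have hom': "ring_hom_on UNIV (\<lambda>p. poly (map_poly h p) z)" for z
    using ring_hom_on_eval[OF is_subring_UNIV h] by simp
  have "M * V = V * \<Delta>"
  proof (rule eq_matI)
    fix j l assume "j < dim_row (V * \<Delta>)" "l < dim_col (V * \<Delta>)"
    then have jl: "j < n" "l < n" using car by auto
    let ?R = "monic_rem \<chi> (monom 1 j * \<theta>)"
    have "(M * V) $$ (j, l) = (\<Sum>k<n. coeff (map_poly h ?R) k * y l ^ k)"
      using jl by (simp add: M_def V_def norm_matrix_def chi scalar_prod_def coeff_map_poly atLeast0LessThan)
    also have "\<dots> = poly (map_poly h ?R) (y l)"
      using monic_rem(2)[OF chi(1)] chi(2)
      by (subst poly_eq_sum_lessThan[where n = n]) (auto simp: coeff_map_poly)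
    also have "\<dots> = poly (map_poly h (monom 1 j * \<theta>)) (y l)"
      by (rule poly_hom_monic_rem[OF chi(1) h root[OF jl(2)]])
    also have "\<dots> = y l ^ j * poly (map_poly h \<theta>) (y l)"
      using hom_on_mult[OF is_subring_UNIV hom'] by (simp add: map_poly_monom poly_monom)
    also have "\<dots> = (\<Sum>k<n. y k ^ j * (if k = l then poly (map_poly h \<theta>) (y l) else 0))"
      using jl by (simp add: if_distrib[of "(*) _"] cong: if_cong)
    also have "\<dots> = (V * \<Delta>) $$ (j, l)"
      using jl by (simp add: V_def \<Delta>_def scalar_prod_def atLeast0LessThan)
    finally show "(M * V) $$ (j, l) = (V * \<Delta>) $$ (j, l)" .
  qed (use car in auto)
  then have "det M * det V = det V * det \<Delta>" using det_mult car by metis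
  \<comment> \<open>A kernel vector of the transpose would be the coefficient vector of a nonzero
    polynomial of degree below n that vanishes at n distinct points.\<close>
  moreover have "det V \<noteq> 0"
  proof
    assume "det V = 0"
    then have "det (transpose_mat V) = 0" using det_transpose[OF car(2)] by simp
    then obtain v where v: "v \<in> carrier_vec n" "v \<noteq> 0\<^sub>v n" "transpose_mat V *\<^sub>v v = 0\<^sub>v n"
      using det_0_iff_vec_prod_zero[of "transpose_mat V" n] car by auto
    define p where "p = (\<Sum>j<n. monom (v $ j) j)"
    have cp: "coeff p k = (if k < n then v $ k else 0)" for k
      by (simp add: p_def coeff_sum)
    have "poly p (y l) = 0" if "l < n" for l
    proof -
      have "(transpose_mat V *\<^sub>v v) $ l = (\<Sum>j<n. y l ^ j * v $ j)"
        using that v(1) by (simp add: V_def scalar_prod_def atLeast0LessThan)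
      then show ?thesis using v(3) that by (simp add: p_def poly_sum poly_monom mult.commute)
    qed
    then have "p = 0" using poly_eq_0_if_roots[of "{..<n}" y p] y(1) cp by auto
    then have "v $ j = 0" if "j < n" for j using cp[of j] that by simp
    then have "v = 0\<^sub>v n" using v(1) by (intro eq_vecI) auto
    then show False using v(2) by simp
  qed
  ultimately have "det M = det \<Delta>" by simp
  also have "det \<Delta> = prod_list (diag_mat \<Delta>)"
    by (rule det_upper_triangular[OF _ car(3)]) (auto simp: \<Delta>_def upper_triangular_def)
  also have "\<dots> = (\<Prod>l<n. poly (map_poly h \<theta>) (y l))"
    by (auto simp: diag_mat_def \<Delta>_def prod.list_conv_set_nth atLeast0LessThan intro!: prod.cong)
  finally show ?thesis by (simp add: M_def)
qed

text \<open>Lagrange interpolation writes p as the combination of the monic polynomials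
  \<open>E l\<close> = \<open>\<chi>\<close> / (y - \<open>y l\<close>) with exactly these quotients
  as coefficients; the claim compares the coefficients in degree n - 1, where n is the number of
  roots.\<close>

lemma lagrange_trace:
  fixes y :: "'i \<Rightarrow> 'a::field"
  assumes A: "finite A" "A \<noteq> {}" "inj_on y A" and p: "\<And>j. j \<ge> card A \<Longrightarrow> coeff p j = 0"
    and chi: "\<chi> = (\<Prod>l\<in>A. [:- y l, 1:])"
  shows "(\<Sum>l\<in>A. poly p (y l) / poly (pderiv \<chi>) (y l)) = coeff p (card A - 1)"
proof -
  define E where "E l = (\<Prod>k\<in>A - {l}. [:- y k, 1:])" for l
  have E0: "poly (E l) (y m) = 0" if "l \<in> A" "m \<in> A" "l \<noteq> m" for l m
    unfolding E_def poly_prod using that A by (intro prod_zero) auto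
  have E1: "poly (E l) (y l) \<noteq> 0" if "l \<in> A" for l
    unfolding E_def poly_prod using that A by (auto simp: inj_on_def)
  have dchi: "poly (pderiv \<chi>) (y l) = poly (E l) (y l)" if "l \<in> A" for l
  proof -
    have "poly (pderiv \<chi>) (y l) = (\<Sum>m\<in>A. poly (E m) (y l))"
      by (simp add: chi pderiv_prod pderiv_pCons poly_sum E_def)
    also have "\<dots> = (\<Sum>m\<in>A. if m = l then poly (E l) (y l) else 0)"
      using E0 that by (intro sum.cong) auto
    finally show ?thesis using that A by simp
  qed
  define c where "c l = poly p (y l) / poly (pderiv \<chi>) (y l)" for l
  have degE: "degree (E l) = card A - 1" if "l \<in> A" for l
    unfolding E_def using that A by (subst degree_prod_eq_sum_degree) auto
  have lcE: "lead_coeff (E l) = 1" for l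
    unfolding E_def by (simp add: lead_coeff_prod)
  have cA: "card A > 0" using A by (simp add: card_gt_0_iff)
  have "(\<Sum>l\<in>A. smult (c l) (E l)) - p = 0"
  proof (rule poly_eq_0_if_roots[OF A(1,3)])
    fix j assume j: "j \<ge> card A"
    have "coeff (E l) j = 0" if "l \<in> A" for l
      using j cA degE[OF that] by (intro coeff_eq_0) simp
    then show "coeff ((\<Sum>l\<in>A. smult (c l) (E l)) - p) j = 0"
      using p[OF j] by (simp add: coeff_sum)
  next
    fix m assume m: "m \<in> A"
    have "(\<Sum>l\<in>A. c l * poly (E l) (y m)) = (\<Sum>l\<in>A. if l = m then poly p (y m) else 0)"
      using E0 E1 m dchi by (intro sum.cong) (auto simp: c_def)
    then show "poly ((\<Sum>l\<in>A. smult (c l) (E l)) - p) (y m) = 0"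
      using A m by (simp add: poly_sum)
  qed
  then have "p = (\<Sum>l\<in>A. smult (c l) (E l))" by simp
  then have "coeff p (card A - 1) = coeff (\<Sum>l\<in>A. smult (c l) (E l)) (card A - 1)" by (rule arg_cong)
  also have "\<dots> = (\<Sum>l\<in>A. c l * coeff (E l) (card A - 1))"
    by (simp add: coeff_sum)
  also have "\<dots> = (\<Sum>l\<in>A. c l)"
  proof (intro sum.cong refl)
    fix l assume "l \<in> A"
    then show "c l * coeff (E l) (card A - 1) = c l" using degE[of l] lcE[of l] by simp
  qed
  finally show ?thesis by (simp add: c_def)
qed

text \<open>The right-hand side is the image of one element of the base ring that depends neither on
  h nor on the roots. This is why the traces at all places are expansions of the same function of
  x.\<close>

lemma sum_ratio_eq_trace:
  fixes h :: "'a::idom \<Rightarrow> 'b::field"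
  assumes chi: "lead_coeff \<chi> = 1" "degree \<chi> > 0" "card A = degree \<chi>" and h: "ring_hom_on UNIV h"
    and y: "finite A" "inj_on y A" "map_poly h \<chi> = (\<Prod>l\<in>A. [:- y l, 1:])"
  shows "(\<Sum>l\<in>A. poly (map_poly h g) (y l) / poly (map_poly h (pderiv \<chi>)) (y l))
    = h (coeff (monic_rem \<chi> g) (degree \<chi> - 1))"
proof -
  have root: "poly (map_poly h \<chi>) (y l) = 0" if "l \<in> A" for l
    unfolding y(3) poly_prod using that y(1) by (intro prod_zero) auto
  have pd: "map_poly h (pderiv \<chi>) = pderiv (map_poly h \<chi>)"
    by (rule map_poly_pderiv_on[OF is_subring_UNIV h]) simp
  have h0: "h 0 = 0" using h by (simp add: ring_hom_on_def)
  have "(\<Sum>l\<in>A. poly (map_poly h g) (y l) / poly (map_poly h (pderiv \<chi>)) (y l))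
     = (\<Sum>l\<in>A. poly (map_poly h (monic_rem \<chi> g)) (y l) / poly (pderiv (map_poly h \<chi>)) (y l))"
    by (intro sum.cong refl) (simp add: poly_hom_monic_rem[OF chi(1) h root] pd)
  also have "\<dots> = coeff (map_poly h (monic_rem \<chi> g)) (card A - 1)"
    using chi y monic_rem(2)[OF chi(1)]
    by (intro lagrange_trace) (auto simp: coeff_map_poly h0)
  finally show ?thesis by (simp add: coeff_map_poly h0 chi(3))
qed

subsection \<open>Derivations\<close>

definition ring_derivation :: "('a::idom \<Rightarrow> 'a) \<Rightarrow> bool" where
  "ring_derivation d \<longleftrightarrow> (\<forall>u v. d (u + v) = d u + d v \<and> d (u * v) = d u * v + u * d v)"

lemma derivation_imp_ring_derivation: "derivation d \<Longrightarrow> ring_derivation d"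
  by (simp add: derivation_def ring_derivation_def)

context
  fixes d :: "'a::idom \<Rightarrow> 'a"
  assumes d: "ring_derivation d"
begin

lemma deriv_add: "d (u + v) = d u + d v" and deriv_mult: "d (u * v) = d u * v + u * d v"
  using d by (auto simp: ring_derivation_def)

lemma deriv_0: "d 0 = 0"
  using deriv_add[of 0 0] by (metis add.right_neutral add_left_cancel)

lemma deriv_1: "d 1 = 0"
  using deriv_mult[of 1 1] by (metis add.right_neutral add_left_cancel mult_1_left mult_1_right)

lemma deriv_uminus: "d (- u) = - d u"
  using deriv_add[of u "- u"] deriv_0 by (simp add: eq_neg_iff_add_eq_0 add.commute)

lemma deriv_diff: "d (u - v) = d u - d v"
  using deriv_add[of u "- v"] deriv_uminus by simp

lemma deriv_sum: "d (sum f A) = (\<Sum>i\<in>A. d (f i))"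
  by (induction A rule: infinite_finite_induct) (simp_all add: deriv_0 deriv_add)

lemma deriv_of_nat: "d (of_nat k) = 0"
  by (induction k) (simp_all add: deriv_0 deriv_1 deriv_add)

lemma ring_derivation_map_poly: "ring_derivation (map_poly d)"
  unfolding ring_derivation_def
proof (intro allI conjI)
  fix p q :: "'a poly"
  show "map_poly d (p + q) = map_poly d p + map_poly d q"
    by (intro poly_eqI) (simp add: coeff_map_poly deriv_0 deriv_add)
  show "map_poly d (p * q) = map_poly d p * q + p * map_poly d q"
    by (intro poly_eqI) (simp add: coeff_map_poly deriv_0 coeff_mult deriv_sum deriv_mult sum.distrib)
qed

lemma deriv_poly: "d (poly p z) = poly (map_poly d p) z + poly (pderiv p) z * d z"
proof (induction p)
  case (pCons a p)
  then show ?case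
    by (simp add: map_poly_pCons deriv_0 deriv_add deriv_mult pderiv_pCons algebra_simps)
qed (simp add: deriv_0)

end

lemma ring_derivation_pderiv: "ring_derivation pderiv"
  by (simp add: ring_derivation_def pderiv_add pderiv_mult algebra_simps)

lemma derivation_divide:
  fixes d :: "'a::field \<Rightarrow> 'a"
  assumes d: "ring_derivation d" and v: "v \<noteq> 0"
  shows "d (u / v) = (d u * v - u * d v) / v\<^sup>2"
proof -
  have "d (u / v * v) = d (u / v) * v + u / v * d v" by (rule deriv_mult[OF d])
  then show ?thesis using v by (simp add: field_simps power2_eq_square)
qed

lemma derivation_divide_zero:
  fixes d :: "'a::field \<Rightarrow> 'a"
  assumes d: "ring_derivation d" and "d u = 0" "d v = 0"
  shows "d (u / v) = 0"
  using assms derivation_divide[OF d] deriv_0[OF d] by (cases "v = 0") auto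

lemma deriv_eval2:
  assumes d: "ring_derivation d" and h0: "h 0 = 0" and g0: "g 0 = 0"
    and dh: "\<And>c. d (h c) = h (g c)" and X: "d X = 0" and Y: "d Y = 0"
  shows "d (eval2 h p X Y) = eval2 h (map_poly (map_poly g) p) X Y"
proof -
  have 1: "d (poly (map_poly h q) X) = poly (map_poly h (map_poly g q)) X" for q
    by (simp add: deriv_poly[OF d] X map_poly_map_poly o_def h0 g0 deriv_0[OF d] dh)
  show ?thesis
    unfolding eval2_altdef
    by (simp add: deriv_poly[OF d, where z = Y] Y map_poly_map_poly o_def h0 g0 deriv_0[OF d] 1)
qed

text \<open>The chain rule for points (u, v) that move with the parameters, in contrast to a place,
  where the series for x and y are constants.\<close>

lemma deriv_eval2_total:
  fixes d :: "'a::idom \<Rightarrow> 'a"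
  assumes d: "ring_derivation d"
  shows "d (eval2 (\<lambda>c. c) p X Y) = eval2 (\<lambda>c. c) (map_poly (map_poly d) p) X Y
    + eval2 (\<lambda>c. c) (map_poly pderiv p) X Y * d X + eval2 (\<lambda>c. c) (pderiv p) X Y * d Y"
proof -
  have 1: "map_poly d (map_poly (\<lambda>q. poly q X) p)
     = map_poly (\<lambda>q. poly q X) (map_poly (map_poly d) p) + smult (d X) (map_poly (\<lambda>q. poly q X) (map_poly pderiv p))"
    by (intro poly_eqI) (simp add: coeff_map_poly deriv_0[OF d] deriv_poly[OF d] mult.commute)
  have "pderiv (map_poly (\<lambda>q. poly q X) p) = map_poly (\<lambda>q. poly q X) (pderiv p)"
    by (rule map_poly_pderiv_on[OF is_subring_UNIV ring_hom_on_poly, symmetric]) simp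
  then show ?thesis
    unfolding eval2_altdef by (simp add: deriv_poly[OF d] 1 mult.commute)
qed

subsection \<open>Coefficientwise derivations of Laurent series\<close>

definition fps_map :: "('a::zero \<Rightarrow> 'a) \<Rightarrow> 'a fps \<Rightarrow> 'a fps" where
  "fps_map d f = Abs_fps (\<lambda>n. d (fps_nth f n))"

definition fls_map :: "('a::zero \<Rightarrow> 'a) \<Rightarrow> 'a fls \<Rightarrow> 'a fls" where
  "fls_map d f = Abs_fls (\<lambda>n. d (fls_nth f n))"

lemma fps_map_nth [simp]: "fps_nth (fps_map d f) n = d (fps_nth f n)"
  by (simp add: fps_map_def)

lemma fls_map_nth: "d 0 = 0 \<Longrightarrow> fls_nth (fls_map d f) n = d (fls_nth f n)"
  unfolding fls_map_def
  by (rule nth_Abs_fls_lower_bound[where N = "fls_subdegree f"]) auto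

lemma fls_map_shift: "d 0 = 0 \<Longrightarrow> fls_map d (fls_shift m f) = fls_shift m (fls_map d f)"
  by (intro fls_eqI) (simp add: fls_map_nth)

lemma fls_map_fps_to_fls: "d 0 = 0 \<Longrightarrow> fls_map d (fps_to_fls f) = fps_to_fls (fps_map d f)"
  by (intro fls_eqI) (simp add: fls_map_nth)

lemma fls_map_const: "d 0 = 0 \<Longrightarrow> fls_map d (fls_const c) = fls_const (d c)"
  by (intro fls_eqI) (simp add: fls_map_nth)

lemma fls_eq_shift_fps: obtains m f where "g = fls_shift m (fps_to_fls f)"
  using fls_conv_base_factor_to_fps_shift_subdegree by blast

lemma fps_map_mult:
  assumes d: "ring_derivation d"
  shows "fps_map d (f * g) = fps_map d f * g + f * fps_map d g"
  by (intro fps_ext) (simp add: fps_mult_nth deriv_sum[OF d] deriv_mult[OF d] sum.distrib)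

lemma ring_derivation_fls_map:
  assumes d: "ring_derivation d"
  shows "ring_derivation (fls_map d)"
  unfolding ring_derivation_def
proof (intro allI conjI)
  fix u v :: "'a fls"
  note d0 = deriv_0[OF d]
  show "fls_map d (u + v) = fls_map d u + fls_map d v"
    by (intro fls_eqI) (simp add: fls_map_nth d0 deriv_add[OF d])
  obtain m f where u: "u = fls_shift m (fps_to_fls f)" using fls_eq_shift_fps by blast
  obtain k g where v: "v = fls_shift k (fps_to_fls g)" using fls_eq_shift_fps by blast
  show "fls_map d (u * v) = fls_map d u * v + u * fls_map d v"
    unfolding u v
    by (simp add: fls_times_both_shifted_simp fls_map_shift d0 fls_map_fps_to_fls fps_map_mult[OF d]
        flip: fls_times_fps_to_fls)
qed

text \<open>
  With \<open>L = log (1 + W)\<close>, the series \<open>d L - d W / (1 + W)\<close> has derivative zero and no constant term.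
\<close>
lemma fps_map_ln:
  fixes W :: "'a::field_char_0 fps"
  assumes d: "ring_derivation d" and W: "fps_nth W 0 = 0"
  shows "fps_map d (fps_compose (fps_ln 1) W) * (1 + W) = fps_map d W"
proof -
  define L where "L = fps_compose (fps_ln 1) W"
  define E where "E = fps_map d L - fps_map d W * inverse (1 + W)"
  note d0 = deriv_0[OF d]
  have inv: "inverse (1 + W) * (1 + W) = 1" by (rule inverse_mult_eq_1) (simp add: W)
  \<comment> \<open>The integer factors produced by formal differentiation are constants of
    d.\<close>
  have comm: "fps_map d (fps_deriv f) = fps_deriv (fps_map d f)" for f
    by (intro fps_ext) (simp add: deriv_mult[OF d] deriv_of_nat[OF d] deriv_add[OF d] deriv_1[OF d])
  have map1: "fps_map d (1 + W) = fps_map d W"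
    by (intro fps_ext) (simp add: deriv_add[OF d] d0 deriv_1[OF d])
  have "fps_deriv L * (1 + W) = (fps_compose (inverse (1 + fps_X)) W * (1 + W)) * fps_deriv W"
    unfolding L_def by (simp add: fps_compose_deriv[OF W] fps_ln_deriv mult_ac)
  also have "fps_compose (inverse (1 + fps_X)) W * (1 + W) = 1"
  proof -
    have "fps_compose (inverse (1 + fps_X)) W * fps_compose (1 + fps_X) W
       = fps_compose (inverse (1 + fps_X) * (1 + fps_X)) W"
      by (rule fps_compose_mult_distrib[OF W, symmetric])
    also have "inverse (1 + fps_X) * (1 + fps_X) = (1 :: 'a fps)"
      by (rule inverse_mult_eq_1) simp
    finally show ?thesis by (simp add: fps_compose_add_distrib fps_X_fps_compose_startby0 W)
  qed
  finally have L': "fps_deriv L * (1 + W) = fps_deriv W" by simp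
  have "fps_map d (fps_deriv L * (1 + W)) = fps_map d (fps_deriv W)" by (simp add: L')
  then have dL': "fps_deriv (fps_map d L) * (1 + W) + fps_deriv L * fps_map d W = fps_deriv (fps_map d W)"
    by (simp add: fps_map_mult[OF d] map1 comm)
  have E1: "E * (1 + W) = fps_map d L * (1 + W) - fps_map d W"
    unfolding E_def using inv by (simp add: left_diff_distrib mult.assoc)
  \<comment> \<open>The derivative of E (1 + W) is computed by the product rule and again from
    \<open>E1\<close>. The second result is E W', so E' (1 + W) must vanish.\<close>
  have "fps_deriv (E * (1 + W)) = fps_deriv E * (1 + W) + E * fps_deriv W"
    by (simp add: algebra_simps)
  also have "fps_deriv (E * (1 + W)) = fps_map d L * fps_deriv W - fps_deriv L * fps_map d W"
    unfolding E1 using dL' by (simp add: algebra_simps)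
  also have "\<dots> = E * fps_deriv W"
  proof -
    have "fps_deriv L = fps_deriv W * inverse (1 + W)"
      using arg_cong[OF L', of "\<lambda>f. f * inverse (1 + W)"] inv by (simp add: mult.assoc mult.commute[of "1 + W"])
    then show ?thesis unfolding E_def by (simp add: algebra_simps)
  qed
  finally have "fps_deriv E * (1 + W) = 0" by simp
  moreover have "1 + W \<noteq> 0" using inv by auto
  ultimately have "fps_deriv E = 0" by simp
  then have "E = fps_const (fps_nth E 0)" by (simp add: fps_deriv_eq_0_iff)
  also have "fps_nth E 0 = 0" by (simp add: E_def L_def d0 W)
  finally show ?thesis using E1 by (simp add: L_def)
qed

text \<open>With g = c t^m (1 + W), the coefficientwise d kills t^m, so d g / g = d c / c + d W / (1
  + W). The two summands are the derivatives of the two parts of \<open>puiseux_log\<close>, which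
  has no term for the logarithm of t^m.\<close>

lemma fls_map_puiseux_log:
  fixes g :: "'a::field_char_0 fls"
  assumes d: "ring_derivation d" and g: "g \<noteq> 0"
    and lg: "d (lg (fls_lead g)) = 1 / fls_lead g * d (fls_lead g)"
  shows "fls_map d (puiseux_log lg g) = fls_map d g / g"
proof -
  note d0 = deriv_0[OF d]
  define c W where "c = fls_lead g" and "W = fls_tail g"
  have c: "c \<noteq> 0" using g by (simp add: c_def fls_lead_def)
  have W0: "fps_nth W 0 = 0"
    using c unfolding W_def fls_tail_def by (simp add: c_def fls_lead_def)
  define B where "B = fps_const c * (1 + W)"
  have "fls_base_factor_to_fps g = B"
    unfolding B_def W_def fls_tail_def using c
    by (simp add: c_def mult.assoc[symmetric] del: fls_base_factor_def)
  then have gB: "g = fls_shift (- fls_subdegree g) (fps_to_fls B)"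
    using fls_conv_base_factor_to_fps_shift_subdegree[of g] by simp
  define L where "L = fps_compose (fps_ln 1) W"
  define P where "P = fps_const (lg c) + L"
  have log: "puiseux_log lg g = fps_to_fls P"
    unfolding puiseux_log_def L_def W_def c_def P_def by simp
  have PB: "fps_map d P * B = fps_map d B"
  proof -
    have 1: "fps_map d P = fps_const (d (lg c)) + fps_map d L"
      unfolding P_def by (intro fps_ext) (simp add: deriv_add[OF d] d0)
    have 2: "fps_map d (1 + W) = fps_map d W"
      by (intro fps_ext) (simp add: deriv_add[OF d] d0 deriv_1[OF d])
    have 3: "fps_map d (fps_const c) = fps_const (d c)"
      by (intro fps_ext) (simp add: d0)
    have 4: "fps_const (d (lg c)) * fps_const c = fps_const (d c)"
      using lg c unfolding c_def[symmetric] by simp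
    have "fps_map d P * B
       = (fps_const (d (lg c)) * fps_const c) * (1 + W) + fps_const c * (fps_map d L * (1 + W))"
      unfolding 1 B_def by (simp add: algebra_simps)
    also have "\<dots> = fps_map d B"
      unfolding 4 L_def fps_map_ln[OF d W0] B_def fps_map_mult[OF d] 2 3 by simp
    finally show ?thesis .
  qed
  define m where "m = - fls_subdegree g"
  have gB': "g = fls_shift m (fps_to_fls B)" using gB by (simp only: m_def)
  have "fls_map d (puiseux_log lg g) * g = fls_shift m (fps_to_fls (fps_map d P) * fps_to_fls B)"
    unfolding log by (subst gB') (simp add: fls_shifted_times_simps fls_map_fps_to_fls d0)
  also have "\<dots> = fls_shift m (fps_to_fls (fps_map d B))"
    by (simp add: PB flip: fls_times_fps_to_fls)
  also have "\<dots> = fls_map d g"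
    by (subst gB') (simp add: fls_map_shift fls_map_fps_to_fls d0)
  finally have "fls_map d (puiseux_log lg g) * g = fls_map d g" .
  then show ?thesis using g by (simp add: field_simps)
qed

subsection \<open>The residue theorem for rational functions\<close>

definition fls_eval :: "'a::field fls \<Rightarrow> 'a poly \<Rightarrow> 'a fls" where
  "fls_eval X p = poly (map_poly fls_const p) X"

lemma ring_hom_on_fls_eval: "ring_hom_on UNIV (fls_eval X)"
  using ring_hom_on_eval[OF is_subring_UNIV ring_hom_on_fls_const, of X] by (simp add: fls_eval_def[abs_def])

lemmas fls_eval_0 = hom_on_0[OF is_subring_UNIV ring_hom_on_fls_eval]
  and fls_eval_1 = hom_on_1[OF is_subring_UNIV ring_hom_on_fls_eval]
  and fls_eval_add = hom_on_add[OF is_subring_UNIV ring_hom_on_fls_eval UNIV_I UNIV_I]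
  and fls_eval_mult = hom_on_mult[OF is_subring_UNIV ring_hom_on_fls_eval UNIV_I UNIV_I]

lemma fls_eval_pCons: "fls_eval X (pCons c p) = fls_const c + X * fls_eval X p"
proof -
  have "map_poly fls_const (pCons c p) = pCons (fls_const c) (map_poly fls_const p)"
    by (intro poly_eqI) (simp add: coeff_map_poly coeff_pCons split: nat.splits)
  then show ?thesis by (simp add: fls_eval_def)
qed

lemma fls_eval_smult: "fls_eval X (smult c p) = fls_const c * fls_eval X p"
  using fls_eval_mult[of X "[:c:]" p] by (simp add: fls_eval_pCons fls_eval_0)

lemma fls_eval_power: "fls_eval X (p ^ k) = fls_eval X p ^ k"
  by (induction k) (simp_all add: fls_eval_1 fls_eval_mult)

text \<open>Over an algebraically closed field p splits into linear factors, and each becomes X - z,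
  which is nonzero because X is not constant.\<close>

lemma fls_eval_nonzero:
  fixes p :: "'a::alg_closed_field poly"
  assumes X: "\<And>z. X \<noteq> fls_const z" and p: "p \<noteq> 0"
  shows "fls_eval X p \<noteq> 0"
  using p
proof (induction "degree p" arbitrary: p rule: less_induct)
  case less
  show ?case
  proof (cases "degree p = 0")
    case True
    then obtain c where "p = [:c:]" using degree_eq_zeroE by blast
    then show ?thesis using less.prems by (simp add: fls_eval_pCons fls_eval_0)
  next
    case False
    then obtain z where "poly p z = 0" using alg_closed_imp_poly_has_root[of p] by auto
    then obtain q where q: "p = [:- z, 1:] * q" by (auto simp: poly_eq_0_iff_dvd elim: dvdE)
    with less.prems have "q \<noteq> 0" by auto
    then have "degree q < degree p" unfolding q by (subst degree_mult_eq) auto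
    then have "fls_eval X q \<noteq> 0" using less.hyps \<open>q \<noteq> 0\<close> by blast
    moreover have "fls_eval X [:- z, 1:] \<noteq> 0"
      using X[of z] by (simp add: fls_eval_pCons fls_eval_0)
    ultimately show ?thesis unfolding q fls_eval_mult by simp
  qed
qed

lemma x_at_not_const: "N > 0 \<Longrightarrow> x_at N c \<noteq> fls_const z"
proof
  assume "N > 0" "x_at N c = fls_const z"
  then have "fls_nth (x_at N c) (int N) = fls_nth (fls_const z) (int N)" by simp
  then show False using \<open>N > 0\<close> by (simp add: x_at_def)
qed

lemma x_at_infinity_not_const: "N > 0 \<Longrightarrow> x_at_infinity N \<noteq> fls_const z"
proof
  assume "N > 0" "x_at_infinity N = fls_const z"
  then have "fls_nth (x_at_infinity N) (- int N) = fls_nth (fls_const z) (- int N)" by simp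
  then show False using \<open>N > 0\<close> by (simp add: x_at_infinity_def)
qed

lemma fls_eval_x_at:
  assumes N: "N > 0"
  obtains f where "fls_eval (x_at N c) p = fps_to_fls f" "fps_nth f 0 = poly p c"
proof -
  have "\<exists>f. fls_eval (x_at N c) p = fps_to_fls f \<and> fps_nth f 0 = poly p c"
  proof (induction p)
    case (pCons a p)
    then obtain f where f: "fls_eval (x_at N c) p = fps_to_fls f" "fps_nth f 0 = poly p c" by blast
    have X: "x_at N c = fps_to_fls (fps_const c + fps_X ^ N)"
      by (simp add: x_at_def fps_to_fls_power)
    define x where "x = fps_const c + fps_X ^ N"
    have "fls_eval (x_at N c) (pCons a p) = fps_to_fls (fps_const a) + fps_to_fls x * fps_to_fls f"
      unfolding fls_eval_pCons f(1) by (simp add: X x_def)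
    also have "\<dots> = fps_to_fls (fps_const a + x * f)"
      by (simp add: fls_times_fps_to_fls)
    finally show ?case
      using N f(2) by (intro exI[of _ "fps_const a + x * f"]) (simp add: x_def fps_power_zeroth)
  qed (auto simp: fls_eval_0 intro: exI[of _ 0])
  then show ?thesis using that by blast
qed

lemma fls_eval_quotient_x_at:
  assumes N: "N > 0" and Q: "poly Q c \<noteq> 0"
  obtains f where "fls_eval (x_at N c) P / fls_eval (x_at N c) Q = fps_to_fls f"
    "fps_nth f 0 = poly P c / poly Q c"
proof -
  obtain p where p: "fls_eval (x_at N c) P = fps_to_fls p" "fps_nth p 0 = poly P c"
    using fls_eval_x_at[OF N] by blast
  obtain q where q: "fls_eval (x_at N c) Q = fps_to_fls q" "fps_nth q 0 = poly Q c"
    using fls_eval_x_at[OF N] by blast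
  have "inverse q * q = 1" by (rule inverse_mult_eq_1) (simp add: q(2) Q)
  then have "fps_to_fls (inverse q) * fps_to_fls q = 1" by (simp flip: fls_times_fps_to_fls)
  moreover have "fps_to_fls q \<noteq> 0" using q(2) Q by auto
  ultimately have "fps_to_fls p / fps_to_fls q = fps_to_fls (p * inverse q)"
    by (simp add: fls_times_fps_to_fls field_simps)
  moreover have "fps_nth (p * inverse q) 0 = poly P c / poly Q c"
    by (simp add: p(2) q(2) divide_inverse)
  ultimately show ?thesis using that p(1) q(1) by metis
qed

lemma residue_regular:
  assumes "N > 0" "poly Q c \<noteq> 0"
  shows "puiseux_residue N (fls_eval (x_at N c) P / fls_eval (x_at N c) Q) = 0"
  using fls_eval_quotient_x_at[OF assms, of P] assms(1) by (metis puiseux_residue_def fps_to_fls_nth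
      neg_less_0_iff_less of_nat_0_less_iff)

lemma residue_simple_pole:
  fixes Q :: "'a::field poly"
  assumes "poly Q u = 0" "poly (pderiv Q) u \<noteq> 0"
  shows "puiseux_residue 1 (fls_eval (x_at 1 u) P / fls_eval (x_at 1 u) Q) = poly P u / poly (pderiv Q) u"
proof -
  obtain Q1 where Q1: "Q = [:- u, 1:] * Q1" using assms(1) by (auto simp: poly_eq_0_iff_dvd elim: dvdE)
  have dQ: "poly (pderiv Q) u = poly Q1 u"
    unfolding Q1 pderiv_mult by (simp add: pderiv_pCons)
  obtain f where f: "fls_eval (x_at 1 u) P / fls_eval (x_at 1 u) Q1 = fps_to_fls f"
    "fps_nth f 0 = poly P u / poly Q1 u"
    using fls_eval_quotient_x_at[of 1 Q1 u P] assms(2) dQ by auto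
  have "fls_eval (x_at 1 u) Q = fls_X * fls_eval (x_at 1 u) Q1"
    unfolding Q1 fls_eval_mult by (simp add: fls_eval_pCons fls_eval_0 fls_eval_1 x_at_def)
  then have "fls_eval (x_at 1 u) P / fls_eval (x_at 1 u) Q
     = inverse fls_X * (fls_eval (x_at 1 u) P / fls_eval (x_at 1 u) Q1)"
    by (simp add: divide_inverse)
  also have "\<dots> = fls_shift 1 (fps_to_fls f)"
    unfolding f fls_inverse_X by (rule fls_X_inv_times_conv_shift)
  finally show ?thesis by (simp add: puiseux_residue_def f(2) dQ)
qed

lemma Pi_polynomial:
  assumes M: "M > 0"
  shows "puiseux_Pi M (fls_eval (x_at_infinity M) p) = 0"
proof -
  have "\<forall>k>0. fls_nth (fls_eval (x_at_infinity M) p) k = 0"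
  proof (induction p)
    case (pCons a p)
    then show ?case
      using M by (simp add: fls_eval_pCons x_at_infinity_def fls_X_inv_power_times_conv_shift)
  qed (simp add: fls_eval_0)
  then show ?thesis using M by (simp add: puiseux_Pi_def)
qed

text \<open>With x = t^(-M) one has 1 / (x - c) = t^M / (1 - c t^M), so the k-th power starts at
  t^(M k) with coefficient 1, and only k = 1 reaches t^M.\<close>

lemma Pi_pole:
  assumes M: "M > 0" and k: "k > 0"
  shows "puiseux_Pi M (1 / fls_eval (x_at_infinity M) [:- c, 1:] ^ k) = (if k = 1 then 1 else 0)"
proof -
  define g where "g = 1 - fps_const c * fps_X ^ M"
  have g0: "fps_nth g 0 = 1" using M by (simp add: g_def fps_power_zeroth)
  have inv: "fps_to_fls (inverse g) * fps_to_fls g = 1"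
    using inverse_mult_eq_1[of g] g0 by (simp flip: fls_times_fps_to_fls)
  have XX: "fls_X ^ M * fls_X_inv ^ M = (1 :: 'a fls)"
    by (metis fls_X_nonzero fls_inverse_X power_inverse power_mult_distrib power_one right_inverse)
  have "fls_X ^ M * fls_eval (x_at_infinity M) [:- c, 1:] = fps_to_fls g"
    using XX by (simp add: fls_eval_pCons fls_eval_0 x_at_infinity_def g_def fls_times_fps_to_fls
        fps_to_fls_power right_diff_distrib mult.commute)
  then have "fls_X ^ M * fps_to_fls (inverse g) * fls_eval (x_at_infinity M) [:- c, 1:] = 1"
    using inv by (simp add: mult_ac)
  then have "1 / fls_eval (x_at_infinity M) [:- c, 1:] = fls_X ^ M * fps_to_fls (inverse g)"
    by (metis divide_eq_eq mult_zero_right zero_neq_one)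
  then have "1 / fls_eval (x_at_infinity M) [:- c, 1:] ^ k = fps_to_fls (fps_X ^ (M * k) * inverse g ^ k)"
    by (simp add: fls_times_fps_to_fls fps_to_fls_power power_mult_distrib power_mult flip: power_one_over)
  then show ?thesis
    using M k g0 by (auto simp: puiseux_Pi_def fps_X_power_mult_nth fps_power_zeroth)
qed

lemma residue_pole:
  assumes N: "N > 0"
  shows "puiseux_residue N (1 / fls_eval (x_at N c) [:- c, 1:] ^ k) = (if k = 1 then 1 else 0)"
proof -
  have "fls_eval (x_at N c) [:- c, 1:] = fls_X ^ N"
    by (simp add: fls_eval_pCons fls_eval_0 x_at_def)
  then have "1 / fls_eval (x_at N c) [:- c, 1:] ^ k = fls_X_inv ^ (N * k)"
    by (simp add: power_mult fls_inverse_X flip: inverse_eq_divide power_inverse)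
  then show ?thesis using N by (auto simp: puiseux_residue_def)
qed

text \<open>Partial fractions reduce the claim to polynomials and pure powers 1 / (x - c)^k, whose
  coefficients are read off directly. The residue is the coefficient of 1 / (x - c) and not that of
  a differential in t, so the ramification indices \<open>N c\<close> and M bring in no
  factors.\<close>

theorem sum_residues_eq_Pi:
  fixes P Q :: "'a::alg_closed_field poly"
  assumes C: "finite C" "\<And>c. poly Q c = 0 \<Longrightarrow> c \<in> C" and N: "\<And>c. c \<in> C \<Longrightarrow> N c > 0"
    and M: "M > 0" and Q: "Q \<noteq> 0"
  shows "(\<Sum>c\<in>C. puiseux_residue (N c) (fls_eval (x_at (N c) c) P / fls_eval (x_at (N c) c) Q))
    = puiseux_Pi M (fls_eval (x_at_infinity M) P / fls_eval (x_at_infinity M) Q)"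
proof -
  \<comment> \<open>The difference of the two sides, taken for any expression G in the expansion of
    x, so that it can be split linearly. In \<open>lin\<close> the splitting has to hold at the
    places only, where the denominators do not vanish.\<close>
  define res where "res G = (\<Sum>c\<in>C. puiseux_residue (N c) (G (x_at (N c) c))) - puiseux_Pi M (G (x_at_infinity M))"
    for G :: "'a fls \<Rightarrow> 'a fls"
  define places where "places = insert (x_at_infinity M) ((\<lambda>c. x_at (N c) c) ` C)"
  have "X \<noteq> fls_const z" if "X \<in> places" for X z
    using that unfolding places_def
    by (elim insertE imageE) (simp_all add: x_at_infinity_not_const[OF M] x_at_not_const[OF N])
  then have nz: "fls_eval X Q \<noteq> 0" if "X \<in> places" "Q \<noteq> 0" for X Q
    using that fls_eval_nonzero by blast
  have lin: "res G = a * res G1 + b * res G2"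
    if "\<And>X. X \<in> places \<Longrightarrow> G X = fls_const a * G1 X + fls_const b * G2 X" for G G1 G2 a b
    unfolding res_def
    by (simp add: that places_def puiseux_residue_def puiseux_Pi_def sum.distrib sum_distrib_left algebra_simps)
  have pole: "res (\<lambda>X. 1 / fls_eval X [:- c, 1:] ^ k) = 0" if c: "c \<in> C" and k: "k > 0" for c k
  proof -
    have 0: "puiseux_residue (N c') (1 / fls_eval (x_at (N c') c') [:- c, 1:] ^ k) = 0"
      if "c' \<in> C" "c' \<noteq> c" for c'
      using residue_regular[OF N[OF that(1)], where Q = "[:- c, 1:] ^ k" and P = 1] that
      by (simp add: fls_eval_power fls_eval_1)
    have "(\<Sum>c'\<in>C. puiseux_residue (N c') (1 / fls_eval (x_at (N c') c') [:- c, 1:] ^ k))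
       = (\<Sum>c'\<in>C. if c' = c then if k = 1 then 1 else 0 else 0)"
      using 0 residue_pole[OF N[OF c], of c k] by (intro sum.cong) auto
    then show ?thesis unfolding res_def Pi_pole[OF M k] using C(1) c by simp
  qed
  have "res (\<lambda>X. fls_eval X P / fls_eval X Q) = 0" using Q C(2)
  proof (induction "degree Q" arbitrary: P Q rule: less_induct)
    case less
    consider "degree Q = 0" | c where "poly Q c = 0" "\<And>d. poly Q d = 0 \<Longrightarrow> d = c"
      | c d where "poly Q c = 0" "poly Q d = 0" "c \<noteq> d"
      using alg_closed_imp_poly_has_root[of Q] by (metis neq0_conv)
    then show ?case
    proof cases
      case 1
      then obtain q where q: "Q = [:q:]" using degree_eq_zeroE by blast
      have "fls_eval X P / fls_eval X Q = fls_eval X (smult (1 / q) P)" for X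
      proof -
        have "fls_const (1 / q) * fls_const q = 1" using less.prems(1) q by simp
        then show ?thesis using less.prems(1) q
          by (simp add: fls_eval_smult fls_eval_pCons fls_eval_0 field_simps del: fls_const_mult_const)
      qed
      moreover have "puiseux_residue (N c) (fls_eval (x_at (N c) c) p) = 0" if "c \<in> C" for c p
        using residue_regular[OF N[OF that], where Q = 1 and P = p] by (simp add: fls_eval_1)
      ultimately show ?thesis unfolding res_def by (simp add: Pi_polynomial[OF M])
    next
      case (2 c)
      obtain Q1 where Q1: "Q = [:- c, 1:] * Q1" using 2(1) by (auto simp: poly_eq_0_iff_dvd elim: dvdE)
      then have Q10: "Q1 \<noteq> 0" using less.prems by auto
      then have deg: "degree Q1 < degree Q" unfolding Q1 by (subst degree_mult_eq) auto
      obtain k q where k: "Q = smult q ([:- c, 1:] ^ k)" "q \<noteq> 0" "k > 0"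
      proof -
        obtain q where q: "Q = [:- c, 1:] ^ order c Q * q" "\<not> [:- c, 1:] dvd q"
          using order_decomp[OF less.prems(1)] by blast
        have "degree q = 0"
        proof (rule ccontr)
          assume "degree q \<noteq> 0"
          then obtain z where z: "poly q z = 0" using alg_closed_imp_poly_has_root[of q] by auto
          then have "poly Q z = 0" by (subst q(1)) simp
          then have "z = c" using 2 by blast
          then show False using z q(2) by (simp add: poly_eq_0_iff_dvd)
        qed
        then obtain q0 where q0: "q = [:q0:]" using degree_eq_zeroE by blast
        have "q0 \<noteq> 0"
        proof
          assume "q0 = 0"
          then have "Q = 0" by (subst q(1)) (simp add: q0)
          then show False using less.prems(1) by simp
        qed
        moreover have "order c Q > 0" using 2(1) less.prems(1) by (simp add: order_root)
        moreover have "Q = smult q0 ([:- c, 1:] ^ order c Q)" using q(1) by (simp add: q0)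
        ultimately show ?thesis using that by blast
      qed
      \<comment> \<open>As Q is a constant multiple of (x - c)^k, splitting P(c) off P leaves a pure
        pole, and in the remaining part one factor x - c cancels.\<close>
      obtain P1 where P1: "P = [:- c, 1:] * P1 + [:poly P c:]"
        using synthetic_div_correct'[of c P] by metis
      have "res (\<lambda>X. fls_eval X P / fls_eval X Q)
        = 1 * res (\<lambda>X. fls_eval X P1 / fls_eval X Q1)
          + poly P c / q * res (\<lambda>X. 1 / fls_eval X [:- c, 1:] ^ k)"
      proof (rule lin)
        fix X assume X: "X \<in> places"
        let ?l = "fls_eval X [:- c, 1:]"
        have n: "?l \<noteq> 0" "fls_eval X Q1 \<noteq> 0" using nz[OF X] Q10 by auto
        have "fls_eval X P / fls_eval X Q
          = ?l * fls_eval X P1 / (?l * fls_eval X Q1) + fls_const (poly P c) / fls_eval X Q"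
        proof -
          have "fls_eval X P = ?l * fls_eval X P1 + fls_const (poly P c)"
            by (subst P1) (simp only: fls_eval_add fls_eval_mult fls_eval_pCons[of X "poly P c" 0] fls_eval_0 mult_zero_right add_0_right)
          moreover have "fls_eval X Q = ?l * fls_eval X Q1" by (simp only: Q1 fls_eval_mult)
          ultimately show ?thesis by (simp only: add_divide_distrib)
        qed
        also have "fls_const (poly P c) / fls_eval X Q = fls_const (poly P c / q) * (1 / ?l ^ k)"
        proof -
          have "fls_const (poly P c) = fls_const (poly P c / q) * fls_const q" using k(2) by simp
          then show ?thesis using k(2) unfolding k(1) fls_eval_smult fls_eval_power
            by (simp del: fls_const_mult_const)
        qed
        finally show "fls_eval X P / fls_eval X Q
          = fls_const 1 * (fls_eval X P1 / fls_eval X Q1) + fls_const (poly P c / q) * (1 / ?l ^ k)"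
          using n by simp
      qed
      also have "res (\<lambda>X. fls_eval X P1 / fls_eval X Q1) = 0"
        using less.hyps[OF deg Q10] less.prems(2) by (simp add: Q1)
      also have "res (\<lambda>X. 1 / fls_eval X [:- c, 1:] ^ k) = 0"
        using pole less.prems(2) 2 k by blast
      finally show ?thesis by simp
    next
      case (3 c d)
      obtain Q1 where Q1: "Q = [:- c, 1:] * Q1" using 3(1) by (auto simp: poly_eq_0_iff_dvd elim: dvdE)
      with 3 have "poly Q1 d = 0" by simp
      then obtain Q2 where Q2: "Q1 = [:- d, 1:] * Q2" by (auto simp: poly_eq_0_iff_dvd elim: dvdE)
      have Q20: "Q2 \<noteq> 0" using less.prems Q1 Q2 by auto
      have deg: "degree ([:- e, 1:] * Q2) < degree Q" for e
      proof -
        have lin: "degree ([:- a, 1:] * R) = Suc (degree R)" if "R \<noteq> 0" for a and R :: "'a poly"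
          using that by (subst degree_mult_eq) auto
        have "[:- d, 1:] * Q2 \<noteq> 0" using Q20 by (simp only: mult_eq_0_iff) simp
        then have "degree Q = Suc (Suc (degree Q2))"
          unfolding Q1 Q2 by (simp only: lin Q20 not_False_eq_True)
        moreover have "degree ([:- e, 1:] * Q2) = Suc (degree Q2)"
          using lin[OF Q20] .
        ultimately show ?thesis by simp
      qed
      have IH: "res (\<lambda>X. fls_eval X P / fls_eval X ([:- e, 1:] * Q2)) = 0" if "e = c \<or> e = d" for e
      proof (rule less.hyps[OF deg])
        show "[:- e, 1:] * Q2 \<noteq> 0" using Q20 by (simp only: mult_eq_0_iff) simp
        show "z \<in> C" if "poly ([:- e, 1:] * Q2) z = 0" for z
          using that \<open>e = c \<or> e = d\<close> less.prems(2)[of z] by (auto simp: Q1 Q2)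
      qed
      \<comment> \<open>From 1 / ((x - c) (x - d)) = (1 / (x - c) - 1 / (x - d)) / (c - d). Each new
        denominator has lost one linear factor, so the induction hypothesis applies to both.\<close>
      have "res (\<lambda>X. fls_eval X P / fls_eval X Q)
        = 1 / (c - d) * res (\<lambda>X. fls_eval X P / fls_eval X ([:- c, 1:] * Q2))
          + (- 1 / (c - d)) * res (\<lambda>X. fls_eval X P / fls_eval X ([:- d, 1:] * Q2))"
      proof (rule lin)
        fix X assume X: "X \<in> places"
        define p q lc ld where "p = fls_eval X P" and "q = fls_eval X Q2"
          and "lc = fls_eval X [:- c, 1:]" and "ld = fls_eval X [:- d, 1:]"
        have n: "lc \<noteq> 0" "ld \<noteq> 0" "q \<noteq> 0" using nz[OF X] Q20 by (auto simp: lc_def ld_def q_def)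
        define e where "e = fls_const (1 / (c - d))"
        have "lc - ld = fls_const (d - c)"
          by (simp add: lc_def ld_def fls_eval_pCons fls_eval_0 fls_eval_1 fls_minus_const)
        then have e: "e * (ld - lc) = 1"
          using 3(3) unfolding e_def
          by (metis fls_const_1 fls_const_mult_const fls_const_uminus minus_diff_eq nonzero_eq_divide_eq right_minus_eq)
        have "p / (lc * (ld * q)) = e * (ld - lc) * (p / (lc * (ld * q)))" by (simp add: e)
        also have "\<dots> = e * (p / (lc * q)) - e * (p / (ld * q))"
          using n by (simp add: field_simps)
        also have "\<dots> = e * (p / (lc * q)) + fls_const (- 1 / (c - d)) * (p / (ld * q))"
          unfolding e_def by (simp only: fls_const_uminus divide_minus_left minus_mult_left[symmetric]
              diff_conv_add_uminus)
        finally show "fls_eval X P / fls_eval X Q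
          = fls_const (1 / (c - d)) * (fls_eval X P / fls_eval X ([:- c, 1:] * Q2))
          + fls_const (- 1 / (c - d)) * (fls_eval X P / fls_eval X ([:- d, 1:] * Q2))"
          unfolding Q1 Q2 fls_eval_mult p_def q_def lc_def ld_def e_def .
      qed
      then show ?thesis using IH by simp
    qed
  qed
  then show ?thesis by (simp add: res_def)
qed

subsection \<open>Places and points of the curve\<close>

text \<open>\<open>bezout\<close> expresses that \<open>\<chi>\<close> is irreducible over the field of rational functions in \<open>x\<close> over \<open>K\<close>.\<close>
locale plane_curve =
  fixes K :: "'a::{alg_closed_field, field_char_0} set" and \<chi> :: "'a poly poly" and n :: nat
  assumes K: "is_subfield K"
    and chi: "poly2_over K \<chi>" "lead_coeff \<chi> = 1" "degree \<chi> = n" "n > 0"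
    and bezout: "\<And>g. poly2_over K g \<Longrightarrow> g \<noteq> 0 \<Longrightarrow> (\<And>j. j \<ge> n \<Longrightarrow> coeff g j = 0) \<Longrightarrow>
      \<exists>A B \<rho>. poly_over K \<rho> \<and> \<rho> \<noteq> 0 \<and> A * g + B * \<chi> = [:\<rho>:]"
begin

lemma sr: "is_subring K"
  by (rule is_subfield_imp_is_subring[OF K])

lemma hom_poly: "ring_hom_on UNIV H \<Longrightarrow> ring_hom_on UNIV (\<lambda>p. poly (map_poly H p) v)"
  using ring_hom_on_eval[OF is_subring_UNIV, of H v] by simp

text \<open>At a root v of \<open>\<chi>\<close> the Bezout identity becomes A(v) g(v) = H
  \<open>\<rho>\<close>, which is nonzero. H stands for the embedding \<open>emb\<close>, for the
  expansion at a place and for evaluation at a transcendental u.\<close>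

lemma nonzero_on_curve:
  fixes H :: "'a poly \<Rightarrow> 'b::field"
  assumes H: "ring_hom_on UNIV H" and inj: "\<And>\<rho>. poly_over K \<rho> \<Longrightarrow> \<rho> \<noteq> 0 \<Longrightarrow> H \<rho> \<noteq> 0"
    and v: "poly (map_poly H \<chi>) v = 0"
    and g: "poly2_over K g" "g \<noteq> 0" "\<And>j. j \<ge> n \<Longrightarrow> coeff g j = 0"
  shows "poly (map_poly H g) v \<noteq> 0"
proof
  assume g0: "poly (map_poly H g) v = 0"
  obtain A B \<rho> where AB: "poly_over K \<rho>" "\<rho> \<noteq> 0" "A * g + B * \<chi> = [:\<rho>:]"
    using bezout[OF g] by blast
  note e = hom_poly[OF H, of v]
  have "poly (map_poly H (A * g + B * \<chi>)) v = 0"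
    using hom_on_add[OF is_subring_UNIV e] hom_on_mult[OF is_subring_UNIV e] g0 v by simp
  then have "H \<rho> = 0" using AB(2) by (simp add: AB(3) map_poly_pCons)
  then show False using inj AB by blast
qed

lemma pderiv_chi: "poly2_over K (pderiv \<chi>)" "pderiv \<chi> \<noteq> 0" "\<And>j. j \<ge> n \<Longrightarrow> coeff (pderiv \<chi>) j = 0"
proof -
  show "poly2_over K (pderiv \<chi>)"
    using chi(1) poly_over_pderiv[OF is_subring_poly_over[OF sr]] by (simp add: poly2_over_eq)
  show "pderiv \<chi> \<noteq> 0" using chi by (simp add: pderiv_eq_0_iff)
  show "coeff (pderiv \<chi>) j = 0" if "j \<ge> n" for j
    using that chi by (simp add: coeff_pderiv coeff_eq_0)
qed

text \<open>A repeated root would be a common zero of \<open>\<chi>\<close> and its derivative in y,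
  which has smaller degree and is therefore nonzero on the curve.\<close>

lemma distinct_roots:
  fixes H :: "'a poly \<Rightarrow> 'b::field"
  assumes H: "ring_hom_on UNIV H" and inj: "\<And>\<rho>. poly_over K \<rho> \<Longrightarrow> \<rho> \<noteq> 0 \<Longrightarrow> H \<rho> \<noteq> 0"
    and y: "map_poly H \<chi> = (\<Prod>l<n. [:- y l, 1:])"
  shows "inj_on y {..<n}"
proof (rule inj_onI, rule ccontr)
  fix k l assume kl: "k \<in> {..<n}" "l \<in> {..<n}" "y k = y l" "k \<noteq> l"
  define g where "g = (\<Prod>i\<in>{..<n} - {k} - {l}. [:- y i, 1:])"
  define p1 p2 where "p1 = [:- y k, 1:]" and "p2 = [:- y l, 1:]"
  have "map_poly H \<chi> = p1 * (p2 * g)"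
    using kl(1,2,4) unfolding y g_def p1_def p2_def
    by (subst prod.remove[of _ k], simp, simp) (subst prod.remove[of _ l], auto)
  moreover have "poly p1 (y k) = 0" "poly p2 (y k) = 0" using kl(3) by (simp_all add: p1_def p2_def)
  ultimately have "poly (pderiv (map_poly H \<chi>)) (y k) = 0" "poly (map_poly H \<chi>) (y k) = 0"
    by (simp_all add: pderiv_mult)
  moreover have "map_poly H (pderiv \<chi>) = pderiv (map_poly H \<chi>)"
    by (rule map_poly_pderiv_on[OF is_subring_UNIV H]) simp
  ultimately show False using nonzero_on_curve[OF H inj, of "y k" "pderiv \<chi>"] pderiv_chi by simp
qed

lemma exists_roots:
  obtains y where "map_poly (\<lambda>q. poly q u) \<chi> = (\<Prod>l<n. [:- y l, 1:])"
proof -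
  let ?p = "map_poly (\<lambda>q. poly q u) \<chi>"
  have c: "coeff ?p n = 1" using chi by (simp add: coeff_map_poly)
  have "degree ?p = n"
  proof (rule antisym)
    show "degree ?p \<le> n" using degree_map_poly_le[of "\<lambda>q. poly q u" \<chi>] chi by simp
    show "n \<le> degree ?p" using c by (intro le_degree) simp
  qed
  moreover have "?p \<noteq> 0" using c by (metis coeff_0 zero_neq_one)
  ultimately obtain M where M: "size M = n" "?p = smult (lead_coeff ?p) (\<Prod>x\<in>#M. [:- x, 1:])"
    using alg_closed_imp_factorization[of ?p] by auto
  obtain xs where xs: "M = mset xs" by (metis ex_mset)
  have "lead_coeff ?p = 1" using c \<open>degree ?p = n\<close> by simp
  then have "?p = (\<Prod>x\<in>#M. [:- x, 1:])" using M(2) by (metis smult_1_left)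
  also have "\<dots> = (\<Prod>x\<leftarrow>xs. [:- x, 1:])"
    by (simp add: xs flip: prod_mset_prod_list)
  also have "\<dots> = (\<Prod>l<n. [:- xs ! l, 1:])"
    using M(1) by (simp add: xs prod.list_conv_set_nth atLeast0LessThan)
  finally show ?thesis using that by blast
qed

lemma sum_ratio_roots:
  fixes H :: "'a poly \<Rightarrow> 'b::field"
  assumes H: "ring_hom_on UNIV H" and inj: "\<And>\<rho>. poly_over K \<rho> \<Longrightarrow> \<rho> \<noteq> 0 \<Longrightarrow> H \<rho> \<noteq> 0"
    and y: "map_poly H \<chi> = (\<Prod>l<n. [:- y l, 1:])"
  shows "(\<Sum>l<n. poly (map_poly H g) (y l) / poly (map_poly H (pderiv \<chi>)) (y l))
    = H (coeff (monic_rem \<chi> g) (n - 1))"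
  using sum_ratio_eq_trace[OF chi(2) _ _ H, of "{..<n}" y g] distinct_roots[OF H inj y] chi y by simp

end

lemma eval2_conv_fls_eval: "eval2 fls_const p X Y = poly (map_poly (fls_eval X) p) Y"
  by (simp add: eval2_altdef fls_eval_def[abs_def])

lemma root_of_prod:
  fixes n :: nat
  assumes "p = (\<Prod>l<n. [:- y l, 1 :: 'b::idom:])" "l < n"
  shows "poly p (y l) = 0"
  unfolding assms(1) poly_prod using assms(2) by (intro prod_zero bexI[of _ l]) auto

text \<open>
  \<open>\<chi>\<close> divides the numerator of \<open>num / den - f\<^sub>1 / (f\<^sub>2 \<chi>')\<close>, and \<open>A \<theta> + B \<chi>\<close> is the norm \<open>r\<close>
  of \<open>\<theta>\<close>.
\<close>
locale abelian_integrand = plane_curve K \<chi> n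
  for K :: "'a::{alg_closed_field, field_char_0} set" and \<chi> :: "'a poly poly" and n :: nat +
  fixes num den f\<^sub>1 \<theta> A B :: "'a poly poly" and f\<^sub>2 r :: "'a poly" and D :: "'a \<Rightarrow> 'a"
  assumes num: "poly2_over K num" and den: "poly2_over K den"
    and den_bezout: "\<exists>A B \<rho>. poly_over K \<rho> \<and> \<rho> \<noteq> 0 \<and> A * den + B * \<chi> = [:\<rho>:]"
    and f2: "poly_over K f\<^sub>2" "f\<^sub>2 \<noteq> 0"
    and f_repr: "\<chi> dvd num * ([:f\<^sub>2:] * pderiv \<chi>) - f\<^sub>1 * den"
    and theta_bezout: "A * \<theta> + B * \<chi> = [:r:]" and r: "r \<noteq> 0"
    and D: "ring_derivation D" and D_K: "\<And>z. z \<in> K \<Longrightarrow> D z = 0"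
begin

text \<open>The numerator of R over the denominator \<open>f\<^sub>2 * r\<close>: on the curve 1 /
  \<open>\<theta>\<close> equals A / r, and the remaining sum of values divided by
  \<open>\<chi>'\<close> is a coefficient of a remainder by Lagrange's formula.\<close>

definition trace_num :: "'a poly" where
  "trace_num = coeff (monic_rem \<chi> (f\<^sub>1 * map_poly (map_poly D) \<theta> * A)) (n - 1)"

lemma D_0: "D 0 = 0"
  by (rule deriv_0[OF D])

lemma D_over_K: "poly2_over K p \<Longrightarrow> map_poly (map_poly D) p = 0"
  by (intro poly_eqI) (simp add: coeff_map_poly D_0 poly2_over_def poly_over_def D_K)

lemma ratio_eq:
  fixes H :: "'a poly \<Rightarrow> 'b::field"
  assumes H: "ring_hom_on UNIV H" and inj: "\<And>\<rho>. poly_over K \<rho> \<Longrightarrow> \<rho> \<noteq> 0 \<Longrightarrow> H \<rho> \<noteq> 0"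
    and v: "poly (map_poly H \<chi>) v = 0"
  shows "poly (map_poly H num) v / poly (map_poly H den) v
      = poly (map_poly H f\<^sub>1) v / (H f\<^sub>2 * poly (map_poly H (pderiv \<chi>)) v)"
proof -
  define e where "e p = poly (map_poly H p) v" for p
  have hom: "ring_hom_on UNIV e" unfolding e_def[abs_def] by (rule hom_poly[OF H])
  note hs = hom_on_add[OF is_subring_UNIV hom UNIV_I UNIV_I] hom_on_diff[OF is_subring_UNIV hom UNIV_I UNIV_I]
    hom_on_mult[OF is_subring_UNIV hom UNIV_I UNIV_I]
  have e_const: "e [:q:] = H q" for q
    using H by (cases "q = 0") (simp_all add: e_def map_poly_pCons ring_hom_on_def)
  have chi0: "e \<chi> = 0" using v by (simp add: e_def)
  obtain Ad Bd \<rho> where \<rho>: "poly_over K \<rho>" "\<rho> \<noteq> 0" "Ad * den + Bd * \<chi> = [:\<rho>:]"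
    using den_bezout by blast
  have "e Ad * e den = H \<rho>" using arg_cong[OF \<rho>(3), of e] by (simp add: hs chi0 e_const)
  then have den0: "e den \<noteq> 0" using inj[OF \<rho>(1,2)] by auto
  have chi'0: "e (pderiv \<chi>) \<noteq> 0"
    unfolding e_def by (rule nonzero_on_curve[OF H inj v pderiv_chi])
  have f20: "H f\<^sub>2 \<noteq> 0" by (rule inj[OF f2])
  obtain G where "num * ([:f\<^sub>2:] * pderiv \<chi>) - f\<^sub>1 * den = \<chi> * G" using f_repr by (elim dvdE)
  from arg_cong[OF this, of e] have "e num * (H f\<^sub>2 * e (pderiv \<chi>)) = e f\<^sub>1 * e den"
    by (simp only: hs chi0 e_const mult_zero_left right_minus_eq)
  then show ?thesis using den0 chi'0 f20 unfolding e_def[symmetric] by (simp add: field_simps)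
qed

lemma deriv_S_hat:
  assumes X: "\<And>z. X \<noteq> fls_const z" and Y: "map_poly (fls_eval X) \<chi> = (\<Prod>l<n. [:- Y l, 1:])"
    and DX: "fls_map D X = 0" and DY: "\<And>l. l < n \<Longrightarrow> fls_map D (Y l) = 0"
    and lg: "\<And>l c. l < n \<Longrightarrow> c = fls_lead (eval2 fls_const \<theta> X (Y l)) \<Longrightarrow> D (lg c) = 1 / c * D c"
  shows "fls_map D (S_hat (\<lambda>c. c) lg num den \<theta> n X Y) = fls_eval X trace_num / fls_eval X (f\<^sub>2 * r)"
proof -
  let ?H = "fls_eval X" and ?g = "f\<^sub>1 * map_poly (map_poly D) \<theta> * A"
  note H = ring_hom_on_fls_eval[of X]
  have inj: "?H \<rho> \<noteq> 0" if "\<rho> \<noteq> 0" for \<rho> using fls_eval_nonzero[OF X that] .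
  have inj': "\<And>\<rho>. poly_over K \<rho> \<Longrightarrow> \<rho> \<noteq> 0 \<Longrightarrow> ?H \<rho> \<noteq> 0" using inj by blast
  note dF = ring_derivation_fls_map[OF D]
  have d_eval2: "fls_map D (eval2 fls_const p X (Y l)) = eval2 fls_const (map_poly (map_poly D) p) X (Y l)"
    if "l < n" for p l
    by (rule deriv_eval2[OF dF]) (use DX DY[OF that] D_0 fls_map_const[of D] in auto)
  have summand: "fls_map D (ratfun2 fls_const num den X (Y l) * puiseux_log lg (eval2 fls_const \<theta> X (Y l)))
      = poly (map_poly ?H ?g) (Y l) / poly (map_poly ?H (pderiv \<chi>)) (Y l) / ?H (f\<^sub>2 * r)" if l: "l < n" for l
  proof -
    define e where "e p = poly (map_poly ?H p) (Y l)" for p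
    have hom: "ring_hom_on UNIV e" unfolding e_def[abs_def] by (rule hom_poly[OF H])
    note hs = hom_on_add[OF is_subring_UNIV hom UNIV_I UNIV_I] hom_on_mult[OF is_subring_UNIV hom UNIV_I UNIV_I]
    have eval2_e: "eval2 fls_const p X (Y l) = e p" for p
      by (simp add: eval2_conv_fls_eval e_def)
    have v: "poly (map_poly ?H \<chi>) (Y l) = 0" by (rule root_of_prod[OF Y l])
    then have chi0: "e \<chi> = 0" by (simp add: e_def)
    have "e [:r:] = ?H r" using r by (simp add: e_def map_poly_pCons)
    \<comment> \<open>This trades the denominator \<open>\<theta>\<close>, which depends on the
      root, for r, which is common to all roots.\<close>
    then have A: "e A * e \<theta> = ?H r" using arg_cong[OF theta_bezout, of e] by (simp add: hs chi0)
    then have theta0: "e \<theta> \<noteq> 0" using inj[OF r] by auto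
    have "fls_map D (e num) = 0" "fls_map D (e den) = 0"
      using d_eval2[OF l] D_over_K num den by (simp_all add: eval2_e) (simp_all add: e_def)
    then have 0: "fls_map D (e num / e den) = 0" by (rule derivation_divide_zero[OF dF])
    have 1: "fls_map D (puiseux_log lg (e \<theta>)) = e (map_poly (map_poly D) \<theta>) / e \<theta>"
      using fls_map_puiseux_log[OF D theta0, of lg] lg[OF l] d_eval2[OF l, of \<theta>] by (simp add: eval2_e)
    have chi'0: "e (pderiv \<chi>) \<noteq> 0"
      unfolding e_def by (rule nonzero_on_curve[OF H inj' v pderiv_chi])
    have 2: "e num / e den = e f\<^sub>1 / (?H f\<^sub>2 * e (pderiv \<chi>))"
      unfolding e_def by (rule ratio_eq[OF H inj' v])
    have "fls_map D (e num / e den * puiseux_log lg (e \<theta>))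
        = e f\<^sub>1 / (?H f\<^sub>2 * e (pderiv \<chi>)) * (e (map_poly (map_poly D) \<theta>) / e \<theta>)"
      unfolding deriv_mult[OF dF] 0 1 unfolding 2 by simp
    also have "\<dots> = e ?g / e (pderiv \<chi>) / (?H f\<^sub>2 * ?H r)"
      using chi'0 theta0 inj[OF f2(2)] inj[OF r] by (simp add: hs flip: A) 
    finally show ?thesis by (simp add: ratfun2_def eval2_e fls_eval_mult) (simp add: e_def)
  qed
  have "fls_map D (S_hat (\<lambda>c. c) lg num den \<theta> n X Y)
      = (\<Sum>l<n. poly (map_poly ?H ?g) (Y l) / poly (map_poly ?H (pderiv \<chi>)) (Y l)) / ?H (f\<^sub>2 * r)"
    unfolding S_hat_def deriv_sum[OF dF] sum_divide_distrib using summand by (intro sum.cong) auto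
  also have "(\<Sum>l<n. poly (map_poly ?H ?g) (Y l) / poly (map_poly ?H (pderiv \<chi>)) (Y l)) = ?H trace_num"
    unfolding trace_num_def by (rule sum_ratio_roots[OF H _ Y]) (rule inj')
  finally show ?thesis .
qed

text \<open>
  Differentiating \<open>A \<theta> + B \<chi> = r\<close> with respect to \<open>x\<close> and \<open>y\<close>, and \<open>\<chi>(u, v) = \<theta>(u, v) = 0\<close> with
  respect to \<open>D\<close>, shows that the summand of the trace at \<open>(u, v)\<close> is \<open>- f\<^sub>2(u) r'(u) f(u, v) D u\<close>, whereas
  \<open>A(u, v) = 0\<close> at the points over \<open>u\<close> with \<open>\<theta>(u, v) \<noteq> 0\<close>.
\<close>
lemma trace_num_at_root:
  assumes u: "\<not> algebraic_over K u" and ru: "poly r u = 0" "poly (pderiv r) u \<noteq> 0"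
  shows "poly trace_num u / poly (pderiv (f\<^sub>2 * r)) u
    = - (\<Sum>v | eval2 (\<lambda>c. c) \<chi> u v = 0 \<and> eval2 (\<lambda>c. c) \<theta> u v = 0. ratfun2 (\<lambda>c. c) num den u v * D u)"
proof -
  let ?H = "\<lambda>q. poly q u" and ?g = "f\<^sub>1 * map_poly (map_poly D) \<theta> * A"
  have H: "ring_hom_on UNIV ?H" by (rule ring_hom_on_poly)
  have inj: "\<And>\<rho>. poly_over K \<rho> \<Longrightarrow> \<rho> \<noteq> 0 \<Longrightarrow> ?H \<rho> \<noteq> 0" using u by (auto simp: algebraic_over_def)
  obtain y where y: "map_poly ?H \<chi> = (\<Prod>l<n. [:- y l, 1:])" by (rule exists_roots)
  have inj_y: "inj_on y {..<n}" by (rule distinct_roots[OF H inj y])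
  define e where "e v p = eval2 (\<lambda>c. c) p u v" for v p
  have e_alt: "e v p = poly (map_poly ?H p) v" for v p by (simp add: e_def eval2_altdef)
  have hom: "ring_hom_on UNIV (e v)" for v unfolding e_alt[abs_def] by (rule hom_poly[OF H])
  note hs = hom_on_0[OF is_subring_UNIV hom] hom_on_add[OF is_subring_UNIV hom UNIV_I UNIV_I]
    hom_on_mult[OF is_subring_UNIV hom UNIV_I UNIV_I]
  have e_const: "e v [:q:] = poly q u" for v q
    by (cases "q = 0") (simp_all add: e_alt map_poly_pCons)
  have dr: "poly (pderiv (f\<^sub>2 * r)) u = poly f\<^sub>2 u * poly (pderiv r) u"
    by (simp add: pderiv_mult ru)
  have f20: "poly f\<^sub>2 u \<noteq> 0" by (rule inj[OF f2])
  have roots: "{v. e v \<chi> = 0} = y ` {..<n}"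
    by (auto simp: e_alt y poly_prod)
  have summand: "e v ?g / e v (pderiv \<chi>) / (poly f\<^sub>2 u * poly (pderiv r) u)
      = (if e v \<theta> = 0 then - (e v num / e v den * D u) else 0)" if v: "e v \<chi> = 0" for v
  proof (cases "e v \<theta> = 0")
    case False
    have "e v A * e v \<theta> = 0"
      using arg_cong[OF theta_bezout, of "e v"] by (simp add: hs e_const v ru)
    then show ?thesis using False by (simp add: hs)
  next
    case True
    define a b \<theta>' \<theta>x \<theta>y \<chi>x \<chi>y r' where ab: "a = e v A" "b = e v B"
      and "\<theta>' = e v (map_poly (map_poly D) \<theta>)"
      and "\<theta>x = e v (map_poly pderiv \<theta>)" and "\<theta>y = e v (pderiv \<theta>)"
      and "\<chi>x = e v (map_poly pderiv \<chi>)" and "\<chi>y = e v (pderiv \<chi>)" and "r' = poly (pderiv r) u"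
    note defs = this
    note dx = ring_derivation_map_poly[OF ring_derivation_pderiv]
    have 1: "a * \<theta>x + b * \<chi>x = r'"
      using arg_cong[OF theta_bezout, of "\<lambda>p. e v (map_poly pderiv p)"] r
      by (simp add: deriv_add[OF dx] deriv_mult[OF dx] hs True v defs map_poly_pCons e_const)
    have 2: "a * \<theta>y + b * \<chi>y = 0"
      using arg_cong[OF theta_bezout, of "\<lambda>p. e v (pderiv p)"]
      by (simp add: pderiv_add pderiv_mult hs True v defs pderiv_pCons mult.commute)
    have 3: "\<theta>' + \<theta>x * D u + \<theta>y * D v = 0"
      using deriv_eval2_total[OF D, of \<theta> u v] True by (simp add: e_def defs D_0)
    have 4: "\<chi>x * D u + \<chi>y * D v = 0"
      using deriv_eval2_total[OF D, of \<chi> u v] v by (simp add: e_def defs D_0 D_over_K chi eval2_def subst_x_def)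
    have v': "poly (map_poly ?H \<chi>) v = 0" using v unfolding e_alt .
    have "\<chi>y \<noteq> 0"
      unfolding defs e_alt by (rule nonzero_on_curve[OF H inj v' pderiv_chi])
    \<comment> \<open>The right-hand side combines relations 3, 2 and 4 so that D v cancels; by
      relation 1 the coefficient of \<open>\<chi>y * D u\<close> becomes r'.\<close>
    have "a * \<theta>' * \<chi>y + \<chi>y * D u * r' = a * \<chi>y * (\<theta>' + \<theta>x * D u + \<theta>y * D v)
      - \<chi>y * D v * (a * \<theta>y + b * \<chi>y) + b * \<chi>y * (\<chi>x * D u + \<chi>y * D v)"
      unfolding 1[symmetric] by (simp add: algebra_simps)
    then have "\<chi>y * (a * \<theta>' + D u * r') = 0"
      unfolding 2 3 4 by (simp add: algebra_simps)
    then have 5: "a * \<theta>' = - (D u * r')" using \<open>\<chi>y \<noteq> 0\<close> by (simp add: eq_neg_iff_add_eq_0)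
    have 6: "e v num / e v den = e v f\<^sub>1 / (poly f\<^sub>2 u * \<chi>y)"
      using ratio_eq[OF H inj v'] unfolding defs e_alt .
    have "e v ?g = e v f\<^sub>1 * (a * \<theta>')" by (simp add: hs defs)
    then have eg: "e v ?g = - (e v f\<^sub>1 * (D u * r'))" unfolding 5 by simp
    have "r' \<noteq> 0" using ru(2) by (simp add: defs)
    then have "e v ?g / \<chi>y / (poly f\<^sub>2 u * r') = - (e v f\<^sub>1 / (poly f\<^sub>2 u * \<chi>y) * D u)"
      unfolding eg using f20 \<open>\<chi>y \<noteq> 0\<close> by (simp add: field_simps)
    then show ?thesis using True 6 by (simp add: defs)
  qed
  have "poly trace_num u = (\<Sum>l<n. e (y l) ?g / e (y l) (pderiv \<chi>))"
    using sum_ratio_roots[OF H inj y, of ?g] by (simp add: trace_num_def e_alt)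
  then have "poly trace_num u / poly (pderiv (f\<^sub>2 * r)) u
      = (\<Sum>v\<in>y ` {..<n}. e v ?g / e v (pderiv \<chi>) / (poly f\<^sub>2 u * poly (pderiv r) u))"
    by (simp add: dr sum.reindex[OF inj_y] sum_divide_distrib)
  also have "\<dots> = (\<Sum>v\<in>y ` {..<n}. if e v \<theta> = 0 then - (e v num / e v den * D u) else 0)"
  proof (intro sum.cong refl summand)
    show "e v \<chi> = 0" if "v \<in> y ` {..<n}" for v using that roots by blast
  qed
  also have "\<dots> = (\<Sum>v\<in>{v\<in>y ` {..<n}. e v \<theta> = 0}. - (e v num / e v den * D u))"
    by (rule sum.inter_filter[symmetric]) simp
  also have "{v\<in>y ` {..<n}. e v \<theta> = 0} = {v. e v \<chi> = 0 \<and> e v \<theta> = 0}"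
    using roots by auto
  finally show ?thesis by (simp add: e_def ratfun2_def sum_negf)
qed

end

subsection \<open>Transfer along the embedding of constants\<close>

lemma hom_on_poly:
  assumes S: "is_subring S" and h: "ring_hom_on S h" and p: "poly_over S p" and z: "z \<in> S"
  shows "h (poly p z) = poly (map_poly h p) (h z)"
  using p
proof (induction p)
  case (pCons c p)
  then have "c \<in> S" "poly_over S p" by (simp_all add: poly_over_pCons[OF S])
  moreover have "map_poly h (pCons c p) = pCons (h c) (map_poly h p)"
    using hom_on_0[OF S h] by (intro poly_eqI) (simp add: coeff_map_poly coeff_pCons split: nat.splits)
  ultimately show ?case
    using pCons.IH z poly_in_subring[OF S _ z]
    by (simp add: hom_on_add[OF S h] hom_on_mult[OF S h] subring_mult[OF S])
qed (simp add: hom_on_0[OF S h])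

lemma map_poly_zero_on_iff:
  assumes S: "is_subfield S" and h: "ring_hom_on S (h :: _ \<Rightarrow> 'b::field)" and p: "poly_over S p"
  shows "map_poly h p = 0 \<longleftrightarrow> p = 0"
proof -
  have h0: "h 0 = 0" by (rule hom_on_0[OF is_subfield_imp_is_subring[OF S] h])
  show ?thesis
    using p field_hom_zero_iff[OF S h] by (auto simp: poly_eq_iff coeff_map_poly h0 poly_over_def)
qed

text \<open>Linear factors are split off before applying h. Their roots lie in S, and division by a
  monic factor keeps the quotient over S, so the factorisation can be mapped and no new roots
  arise.\<close>

lemma roots_map_poly:
  fixes h :: "complex \<Rightarrow> 'b::field"
  assumes S: "is_subfield S" and h: "ring_hom_on S h" and p: "poly_over S p" "p \<noteq> 0"
    and roots: "\<And>z. poly p z = 0 \<Longrightarrow> z \<in> S"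
  shows "{w. poly (map_poly h p) w = 0} = h ` {z. poly p z = 0}"
  using p roots
proof (induction "degree p" arbitrary: p rule: less_induct)
  case less
  note sr = is_subfield_imp_is_subring[OF S]
  show ?case
  proof (cases "degree p = 0")
    case True
    then obtain c where c: "p = [:c:]" using degree_eq_zeroE by blast
    then have "c \<in> S" "c \<noteq> 0" using less.prems by (auto simp: poly_over_pCons[OF sr])
    then have "h c \<noteq> 0" using field_hom_zero_iff[OF S h] by blast
    then show ?thesis using \<open>c \<noteq> 0\<close> by (simp add: c map_poly_pCons)
  next
    case False
    then obtain z where z: "poly p z = 0" using alg_closed_imp_poly_has_root[of p] by auto
    then have zS: "z \<in> S" using less.prems by blast
    define l where "l = [:- z, 1:]"
    have l: "poly_over S l"
      using zS by (simp add: l_def poly_over_pCons[OF sr] subring_uminus[OF sr] subring_1[OF sr] poly_over_0[OF sr])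
    have "l dvd p" using z by (simp add: l_def poly_eq_0_iff_dvd)
    then obtain q where q: "poly_over S q" "p = l * q"
      using monic_dvd_over[OF sr l _ less.prems(1)] by (auto simp: l_def)
    have "q \<noteq> 0" "l \<noteq> 0" using q less.prems by auto
    then have "degree q < degree p" unfolding q(2) by (subst degree_mult_eq) (auto simp: l_def)
    then have IH: "{w. poly (map_poly h q) w = 0} = h ` {z. poly q z = 0}"
      using less.hyps q \<open>q \<noteq> 0\<close> less.prems(3) by simp
    have "map_poly h p = map_poly h l * map_poly h q"
      using hom_on_mult[OF is_subring_poly_over[OF sr] ring_hom_on_map_poly[OF sr h]] l q by simp
    moreover have "map_poly h l = [:- h z, 1:]"
      using zS hom_on_uminus[OF sr h] hom_on_1[OF sr h] by (simp add: l_def map_poly_pCons)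
    moreover have "{z. poly p z = 0} = insert z {z. poly q z = 0}" by (auto simp: q(2) l_def)
    ultimately show ?thesis using IH by auto
  qed
qed

text \<open>Differentiating p(z) = 0 for a p of minimal degree gives p'(z) D z = 0, and p'(z) is
  nonzero by minimality in characteristic 0.\<close>

lemma derivation_algebraic:
  fixes h :: "complex \<Rightarrow> 'b::field" and D :: "'b \<Rightarrow> 'b"
  assumes K: "is_subfield K" and h: "ring_hom_on {z. algebraic_over K z} h"
    and D: "ring_derivation D" and DK: "\<And>z. z \<in> K \<Longrightarrow> D (h z) = 0" and z: "algebraic_over K z"
  shows "D (h z) = 0"
proof -
  let ?S = "{z. algebraic_over K z}"
  note S = is_subfield_algebraic[OF K]
  note sr = is_subfield_imp_is_subring[OF S(1)] and srK = is_subfield_imp_is_subring[OF K]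
  define Q where "Q p \<longleftrightarrow> p \<noteq> 0 \<and> poly_over K p \<and> poly p z = 0" for p
  obtain p where p: "Q p" and min: "\<And>q. Q q \<Longrightarrow> degree p \<le> degree q"
    using ex_has_least_nat[of Q _ degree] z by (auto simp: algebraic_over_def Q_def)
  have deg: "degree p \<noteq> 0"
    using p by (auto simp: Q_def elim!: degree_eq_zeroE)
  then have dp: "pderiv p \<noteq> 0" "degree (pderiv p) < degree p"
    by (simp_all add: pderiv_eq_0_iff degree_pderiv)
  have over: "poly_over K (pderiv p)" using p poly_over_pderiv[OF srK] by (simp add: Q_def)
  have nz: "poly (pderiv p) z \<noteq> 0" using min[of "pderiv p"] dp over by (auto simp: Q_def)
  have pS: "poly_over ?S p" "poly_over ?S (pderiv p)"
    using p over S(2) poly_over_mono by (auto simp: Q_def)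
  have h0: "h 0 = 0" by (rule hom_on_0[OF sr h])
  have 1: "poly (map_poly h p) (h z) = 0"
    using hom_on_poly[OF sr h pS(1), of z] z p h0 by (simp add: Q_def)
  have "poly (pderiv (map_poly h p)) (h z) = h (poly (pderiv p) z)"
    using hom_on_poly[OF sr h pS(2), of z] z map_poly_pderiv_on[OF sr h pS(1)] by simp
  moreover have "poly (pderiv p) z \<in> ?S" using poly_in_subring[OF sr pS(2)] z by simp
  ultimately have 2: "poly (pderiv (map_poly h p)) (h z) \<noteq> 0"
    using field_hom_zero_iff[OF S(1) h] nz by simp
  have "map_poly D (map_poly h p) = 0"
    using p DK by (intro poly_eqI) (simp add: coeff_map_poly h0 deriv_0[OF D] Q_def poly_over_def)
  then have "poly (pderiv (map_poly h p)) (h z) * D (h z) = 0"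
    using deriv_poly[OF D, of "map_poly h p" "h z"] 1 deriv_0[OF D] by simp
  then show ?thesis using 2 by simp
qed

lemma fls_map_eq_0: "D 0 = 0 \<Longrightarrow> (\<And>k. D (fls_nth g k) = 0) \<Longrightarrow> fls_map D g = 0"
  by (intro fls_eqI) (simp add: fls_map_nth)

lemma fls_map_x_at: "ring_derivation D \<Longrightarrow> D c = 0 \<Longrightarrow> fls_map D (x_at N c) = 0"
  by (rule fls_map_eq_0) (auto simp: x_at_def deriv_0 deriv_1 deriv_add)

lemma fls_map_x_at_infinity: "ring_derivation D \<Longrightarrow> fls_map D (x_at_infinity N) = 0"
  by (rule fls_map_eq_0) (auto simp: x_at_infinity_def deriv_0 deriv_1)

lemma is_subfield_generated: "is_subfield (generated_subfield A)"
  by (auto simp: generated_subfield_def is_subfield_def)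

lemma generated_subfield_superset: "A \<subseteq> generated_subfield A"
  by (auto simp: generated_subfield_def)

lemma polynomials_in_subring:
  assumes T: "is_subring T" and S: "S \<subseteq> T" and v: "\<And>i. i \<in> I \<Longrightarrow> v i \<in> T"
  shows "polynomials_in S I v \<subseteq> T"
  unfolding polynomials_in_def mpoly_eval_def mpoly_over_def
  using S v by (auto intro!: subring_sum[OF T] subring_mult[OF T] subring_prod[OF T] subring_power[OF T]) blast

lemma subst_x_emb:
  fixes H :: "'a::idom poly \<Rightarrow> 'b::idom"
  assumes H: "ring_hom_on UNIV H"
  shows "subst_x (\<lambda>c. H [:c:]) p (H [:0, 1:]) = map_poly H p"
proof -
  note hs = hom_on_0[OF is_subring_UNIV H] hom_on_add[OF is_subring_UNIV H UNIV_I UNIV_I]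
    hom_on_mult[OF is_subring_UNIV H UNIV_I UNIV_I]
  have "poly (map_poly (\<lambda>c. H [:c:]) q) (H [:0, 1:]) = H q" for q
  proof (induction q)
    case (pCons c q)
    have "map_poly (\<lambda>c. H [:c:]) (pCons c q) = pCons (H [:c:]) (map_poly (\<lambda>c. H [:c:]) q)"
      using hs(1) by (intro poly_eqI) (simp add: coeff_map_poly coeff_pCons split: nat.splits)
    moreover have "H (pCons c q) = H [:c:] + H [:0, 1:] * H q"
      by (simp flip: hs(2,3))
    ultimately show ?case using pCons.IH by simp
  qed (simp add: hs)
  then show ?thesis by (simp add: subst_x_def)
qed

text \<open>If \<open>\<theta>\<close> vanished, so would every \<open>D i\<close>
  \<open>\<theta>\<close> at the same place, because X and Y are constants. These derivatives have
  coefficients in K since the parameters enter affinely, so they are zero as polynomials. Then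
  \<open>\<theta>\<close> itself has coefficients in K and degree below n in y, which contradicts
  irreducibility.\<close>

lemma (in plane_curve) nonzero_at_place:
  assumes D: "\<And>i. i \<in> I \<Longrightarrow> ring_derivation (D i)"
    and coeffs: "\<And>j k. (\<forall>i\<in>I. D i (coeff (coeff \<theta> j) k) \<in> K) \<and>
      (\<exists>\<kappa>\<in>K. coeff (coeff \<theta> j) k = \<kappa> + (\<Sum>i\<in>I. D i (coeff (coeff \<theta> j) k) * a i))"
    and theta: "\<theta> \<noteq> 0" "\<And>j. j \<ge> n \<Longrightarrow> coeff \<theta> j = 0"
    and X: "\<And>z. X \<noteq> fls_const z" and Y: "poly (map_poly (fls_eval X) \<chi>) Y = 0"
    and DX: "\<And>i. i \<in> I \<Longrightarrow> fls_map (D i) X = 0" and DY: "\<And>i. i \<in> I \<Longrightarrow> fls_map (D i) Y = 0"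
  shows "poly (map_poly (fls_eval X) \<theta>) Y \<noteq> 0"
proof
  assume 0: "poly (map_poly (fls_eval X) \<theta>) Y = 0"
  have nz: "poly (map_poly (fls_eval X) g) Y \<noteq> 0"
    if "poly2_over K g" "g \<noteq> 0" "\<And>j. j \<ge> n \<Longrightarrow> coeff g j = 0" for g
    by (rule nonzero_on_curve[OF ring_hom_on_fls_eval _ Y that]) (use fls_eval_nonzero[OF X] in auto)
  have D\<theta>: "map_poly (map_poly (D i)) \<theta> = 0" if i: "i \<in> I" for i
  proof (rule ccontr)
    assume nz': "map_poly (map_poly (D i)) \<theta> \<noteq> 0"
    note Di0 = deriv_0[OF D[OF i]]
    have "fls_map (D i) (eval2 fls_const \<theta> X Y) = eval2 fls_const (map_poly (map_poly (D i)) \<theta>) X Y"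
      by (rule deriv_eval2[OF ring_derivation_fls_map[OF D[OF i]]])
        (use DX[OF i] DY[OF i] Di0 fls_map_const[of "D i"] in auto)
    then have "poly (map_poly (fls_eval X) (map_poly (map_poly (D i)) \<theta>)) Y = 0"
      using 0 deriv_0[OF ring_derivation_fls_map[OF D[OF i]]] by (simp add: eval2_conv_fls_eval)
    moreover have "poly2_over K (map_poly (map_poly (D i)) \<theta>)"
      using coeffs i by (simp add: poly2_over_def poly_over_def coeff_map_poly Di0)
    ultimately show False using nz nz' theta(2) by (simp add: coeff_map_poly Di0)
  qed
  have "coeff (coeff \<theta> j) k \<in> K" for j k
  proof -
    have "D i (coeff (coeff \<theta> j) k) = 0" if "i \<in> I" for i
      using arg_cong[OF D\<theta>[OF that], of "\<lambda>p. coeff (coeff p j) k"] deriv_0[OF D[OF that]]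
      by (simp add: coeff_map_poly)
    then show ?thesis using coeffs[of j k] by auto
  qed
  then have "poly2_over K \<theta>" by (simp add: poly2_over_def poly_over_def)
  then show False using nz theta 0 by blast
qed

lemma S_hat_map_poly:
  assumes "\<iota> 0 = 0"
  shows "S_hat \<iota> lg num den \<theta> n X Y
    = S_hat (\<lambda>c. c) lg (map_poly (map_poly \<iota>) num) (map_poly (map_poly \<iota>) den) \<theta> n X Y"
  unfolding S_hat_def ratfun2_def by (simp add: eval2_map_poly assms)

lemma ratfun2_map_poly:
  assumes "\<iota> 0 = 0"
  shows "ratfun2 \<iota> num den u v
    = ratfun2 (\<lambda>c. c) (map_poly (map_poly \<iota>) num) (map_poly (map_poly \<iota>) den) u v"
  unfolding ratfun2_def by (simp add: eval2_map_poly assms)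

theorem theorem4p3:
  fixes K Kbar :: "complex set"
    and \<chi> num den f\<^sub>1 :: "complex poly poly" and f\<^sub>2 F\<^sub>0 :: "complex poly"
    and n m :: nat
    and \<iota> :: "complex \<Rightarrow> 'a::{alg_closed_field, field_char_0}"
    and a :: "nat \<Rightarrow> 'a" and I :: "nat set" and D :: "nat \<Rightarrow> 'a \<Rightarrow> 'a" and lg :: "'a \<Rightarrow> 'a"
    and q :: "nat \<Rightarrow> 'a poly" and \<theta> :: "'a poly poly" and r F :: "'a poly"
    and emb :: "'a poly \<Rightarrow> 'b::field" and y :: "nat \<Rightarrow> 'b"
    and N :: "complex \<Rightarrow> nat" and Y :: "complex \<Rightarrow> nat \<Rightarrow> 'a fls"
    and Ninf :: nat and Yinf :: "nat \<Rightarrow> 'a fls"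
    and sols :: "('a \<times> 'a) set" and B :: "complex set"
  \<comment> \<open>the field \<open>K\<close>, its algebraic closure, and the curve\<close>
  assumes K: "computable_field K"
    and Kbar: "Kbar = {z. algebraic_over K z}"
    and chi: "poly2_over K \<chi>" "lead_coeff \<chi> = 1" "degree \<chi> = n" "irreducible \<chi>"
  \<comment> \<open>the differential field \<open>'a\<close> contains \<open>Kbar\<close>, the parameters and the needed logarithms\<close>
    and iota: "field_hom_on Kbar \<iota>"
    and I: "I \<subseteq> {..<m}"
    and D_derivation: "\<And>i. i \<in> I \<Longrightarrow> derivation (D i)"
    and D_K: "\<And>i z. i \<in> I \<Longrightarrow> z \<in> K \<Longrightarrow> D i (\<iota> z) = 0"
    and D_a: "\<And>i j. i \<in> I \<Longrightarrow> j \<in> I \<Longrightarrow> D i (a j) = (if i = j then 1 else 0)"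
    and D_commute: "\<And>i j h. i \<in> I \<Longrightarrow> j \<in> I \<Longrightarrow> D i (D j h) = D j (D i h)"
  \<comment> \<open>the roots of \<open>\<chi>\<close> in an extension field of the rational functions in \<open>x\<close>\<close>
    and emb: "ring_embedding emb"
    and y: "roots_of (\<lambda>z. emb [:\<iota> z:]) \<chi> (emb [:0, 1:]) n y"
  \<comment> \<open>the parameters and \<open>\<theta>\<close>\<close>
    and a_indep: "algebraically_independent (rational_functions_in emb (\<iota> ` K)) I (\<lambda>i. emb [:a i:])"
    and a_dep: "\<And>k. k < m \<Longrightarrow> k \<notin> I \<Longrightarrow>
           \<exists>\<kappa>\<^sub>0\<in>K. \<exists>\<kappa>. (\<forall>i\<in>I. \<kappa> i \<in> K) \<and> a k = \<iota> \<kappa>\<^sub>0 + (\<Sum>i\<in>I. \<iota> (\<kappa> i) * a i)"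
    and q: "\<And>j. j < n \<Longrightarrow> poly_over (\<iota> ` K \<union> a ` {..<m}) (q j)"
    and theta: "\<theta> = (\<Sum>j<n. monom (q j) j)" "\<theta> \<noteq> 0"
  \<comment> \<open>the norm of \<open>\<theta>\<close> and its factorisation\<close>
    and r: "emb r = (\<Prod>l<n. eval2 (\<lambda>c. emb [:c:]) \<theta> (emb [:0, 1:]) (y l))"
    and r_factor: "r = map_poly \<iota> F\<^sub>0 * F"
    and F0: "poly_over K F\<^sub>0" "\<And>z. poly (map_poly \<iota> F\<^sub>0) z = 0 \<Longrightarrow> algebraic_over (\<iota> ` K) z"
    and F: "poly_over (polynomials_in (\<iota> ` K) {..<m} a) F"
           "\<And>z. poly F z = 0 \<Longrightarrow> \<not> algebraic_over (\<iota> ` K) z"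
  \<comment> \<open>the solutions of \<open>\<chi> = \<theta> = 0\<close> over an algebraic closure of \<open>K(a)\<close> with transcendental \<open>x\<close>\<close>
    and sols: "sols = {(u, v).
           algebraic_over (generated_subfield (\<iota> ` K \<union> a ` {..<m})) u \<and>
           algebraic_over (generated_subfield (\<iota> ` K \<union> a ` {..<m})) v \<and>
           eval2 \<iota> \<chi> u v = 0 \<and> eval2 (\<lambda>c. c) \<theta> u v = 0 \<and> \<not> algebraic_over (\<iota> ` K) u}"
  \<comment> \<open>the rational function \<open>f = num / den\<close>, congruent to \<open>f\<^sub>1 / (f\<^sub>2 \<chi>')\<close> modulo \<open>\<chi>\<close>\<close>
    and f: "poly2_over K num" "poly2_over K den" "\<not> \<chi> dvd den"
    and f12: "poly2_over K f\<^sub>1" "poly_over K f\<^sub>2" "f\<^sub>2 \<noteq> 0"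
    and f_repr: "\<chi> dvd num * ([:f\<^sub>2:] * pderiv \<chi>) - f\<^sub>1 * den"
  \<comment> \<open>the Puiseux expansions of the roots, and the logarithms of the leading coefficients\<close>
    and B: "B = {\<beta>\<in>Kbar. poly (f\<^sub>2 * F\<^sub>0) \<beta> = 0}"
    and Y: "\<And>\<beta>. \<beta> \<in> B \<Longrightarrow> N \<beta> > 0"
           "\<And>\<beta>. \<beta> \<in> B \<Longrightarrow> roots_of (\<lambda>z. fls_const (\<iota> z)) \<chi> (x_at (N \<beta>) (\<iota> \<beta>)) n (Y \<beta>)"
           "\<And>\<beta> l k. \<beta> \<in> B \<Longrightarrow> l < n \<Longrightarrow> fls_nth (Y \<beta> l) k \<in> \<iota> ` Kbar"
    and Y_inf: "Ninf > 0"
           "roots_of (\<lambda>z. fls_const (\<iota> z)) \<chi> (x_at_infinity Ninf) n Yinf"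
           "\<And>l k. l < n \<Longrightarrow> fls_nth (Yinf l) k \<in> \<iota> ` Kbar"
    and lg: "\<And>\<beta> l c. \<beta> \<in> B \<Longrightarrow> l < n \<Longrightarrow>
              c = fls_lead (eval2 fls_const \<theta> (x_at (N \<beta>) (\<iota> \<beta>)) (Y \<beta> l)) \<Longrightarrow>
              is_logarithm I D c (lg c)"
    and lg_inf: "\<And>l c. l < n \<Longrightarrow>
              c = fls_lead (eval2 fls_const \<theta> (x_at_infinity Ninf) (Yinf l)) \<Longrightarrow>
              is_logarithm I D c (lg c)"
  \<comment> \<open>the assumption of the theorem\<close>
    and coprime: "coprime F (pderiv F)"
  shows "(\<lambda>i. \<Sum>(u, v)\<in>sols. ratfun2 \<iota> num den u v * differential I D u i) =
         differential I D
           ((\<Sum>\<beta>\<in>B. puiseux_residue (N \<beta>)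
                (S_hat \<iota> lg num den \<theta> n (x_at (N \<beta>) (\<iota> \<beta>)) (Y \<beta>)))
            - puiseux_Pi Ninf (S_hat \<iota> lg num den \<theta> n (x_at_infinity Ninf) Yinf))"
proof -

  \<comment> \<open>Transport of K and its polynomials into the differential field\<close>
  note Kf = K[unfolded computable_field_def, THEN conjunct1]
  note srK = is_subfield_imp_is_subring[OF Kf]
  have Kbarf: "is_subfield Kbar" and KKbar: "K \<subseteq> Kbar"
    using is_subfield_algebraic[OF Kf] by (auto simp: Kbar)
  note srKbar = is_subfield_imp_is_subring[OF Kbarf]
  have hbar: "ring_hom_on Kbar \<iota>" using iota by (simp add: field_hom_on_def ring_hom_on_def)
  have h: "ring_hom_on K \<iota>" by (rule ring_hom_on_subset[OF hbar KKbar])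
  have \<iota>0: "\<iota> 0 = 0" by (rule hom_on_0[OF srK h])
  define KK where "KK = \<iota> ` K"
  have KKf: "is_subfield KK" unfolding KK_def by (rule is_subfield_hom_image[OF Kf h])
  note srKK = is_subfield_imp_is_subring[OF KKf]
  define \<phi> where "\<phi> = map_poly (map_poly \<iota>)"
  have sr2: "is_subring {p. poly2_over K p}" by (rule is_subring_poly2_over[OF srK])
  have h1: "ring_hom_on {p. poly_over K p} (map_poly \<iota>)" by (rule ring_hom_on_map_poly[OF srK h])
  have hom: "ring_hom_on {p. poly2_over K p} \<phi>"
    unfolding \<phi>_def poly2_over_eq by (rule ring_hom_on_map_poly[OF is_subring_poly_over[OF srK] h1])
  have \<phi>_over: "poly2_over KK (\<phi> p)" if "poly2_over K p" for p
    using that by (auto simp: poly2_over_def poly_over_def \<phi>_def KK_def coeff_map_poly \<iota>0)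
  have \<phi>_pderiv: "\<phi> (pderiv p) = pderiv (\<phi> p)" if "poly2_over K p" for p
    using map_poly_pderiv_on[OF is_subring_poly_over[OF srK] h1] that by (simp add: \<phi>_def poly2_over_eq)
  have \<phi>_const: "\<phi> [:q:] = [:map_poly \<iota> q:]" for q
    by (cases "q = 0") (simp_all add: \<phi>_def map_poly_pCons)
  have over_const: "poly2_over K [:q:] \<longleftrightarrow> poly_over K q" for q
    by (simp add: poly2_over_eq poly_over_pCons[OF is_subring_poly_over[OF srK]] poly_over_0[OF srK]
        poly_over_0[OF is_subring_poly_over[OF srK]])
  note map0 = map_poly_zero_on_iff[OF Kf h]
  have KKover: "poly_over KK (map_poly \<iota> p)" if "poly_over K p" for p
    using poly_over_map_poly[where h = \<iota>, OF \<iota>0 that] by (simp add: KK_def)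

  \<comment> \<open>Bezout identities for the embedded curve\<close>
  have n0: "n > 0"
  proof (rule ccontr)
    assume "\<not> n > 0"
    then have "\<chi> = 1" using chi(2,3) by (metis degree_0_id gr0I one_pCons)
    then show False using chi(4) by simp
  qed
  have prime: "prime_elem \<chi>" by (rule complex_poly2_prime_elem[OF chi(4)])
  have bez: "\<exists>A B \<rho>. poly_over KK \<rho> \<and> \<rho> \<noteq> 0 \<and> A * \<phi> g + B * \<phi> \<chi> = [:\<rho>:]"
    if g: "poly2_over K g" "\<not> \<chi> dvd g" for g
  proof (rule bezout_prime_over[OF is_subring_poly_over[OF srK] _ chi(2) prime _ g(2)])
    show "poly_over {p. poly_over K p} \<chi>" "poly_over {p. poly_over K p} g"
      using chi(1) g(1) by (simp_all add: poly2_over_eq)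
    fix A' B' \<rho> assume AB: "poly_over {p. poly_over K p} A'" "poly_over {p. poly_over K p} B'"
      "\<rho> \<in> {p. poly_over K p}" "\<rho> \<noteq> 0" "A' * g + B' * \<chi> = [:\<rho>:]"
    have over: "poly2_over K A'" "poly2_over K B'" using AB by (simp_all add: poly2_over_eq)
    have "\<phi> A' * \<phi> g + \<phi> B' * \<phi> \<chi> = \<phi> (A' * g + B' * \<chi>)"
      using hom_on_add[OF sr2 hom, of "A' * g" "B' * \<chi>"] hom_on_mult[OF sr2 hom, of A' g]
        hom_on_mult[OF sr2 hom, of B' \<chi>] subring_mult[OF sr2, of A' g] subring_mult[OF sr2, of B' \<chi>]
        over g chi(1) by simp
    also have "\<dots> = [:map_poly \<iota> \<rho>:]" by (simp add: AB \<phi>_const)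
    finally show "\<exists>A B \<rho>. poly_over KK \<rho> \<and> \<rho> \<noteq> 0 \<and> A * \<phi> g + B * \<phi> \<chi> = [:\<rho>:]"
      using AB(3,4) map0[of \<rho>] KKover[of \<rho>] by blast
  qed
  define \<chi>a where "\<chi>a = \<phi> \<chi>"
  have degchi: "degree \<chi>a = n"
  proof -
    have "map_poly \<iota> q \<noteq> 0" if "q = lead_coeff \<chi>" for q
      using that chi(2) hom_on_1[OF srK h] by simp
    then have "degree \<chi>a = degree \<chi>"
      unfolding \<chi>a_def \<phi>_def using chi(2) by (intro degree_map_poly) auto
    then show ?thesis using chi(3) by simp
  qed
  have lcchi: "lead_coeff \<chi>a = 1"
    unfolding degchi using chi(2,3) hom_on_1[OF srK h] by (simp add: \<chi>a_def \<phi>_def coeff_map_poly)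
  interpret C: plane_curve KK \<chi>a n
  proof
    show "is_subfield KK" "poly2_over KK \<chi>a" "lead_coeff \<chi>a = 1" "degree \<chi>a = n" "n > 0"
      using KKf \<phi>_over[OF chi(1)] lcchi degchi n0 by (simp_all add: \<chi>a_def)
    \<comment> \<open>The Bezout identity is available over the complex field, so g is pulled back
      coefficientwise to a g' over K. Its degree in y is below n, hence \<open>\<chi>\<close> does
      not divide it.\<close>
    fix g assume g: "poly2_over KK g" "g \<noteq> 0" "\<And>j. j \<ge> n \<Longrightarrow> coeff g j = 0"
    have "poly_over (map_poly \<iota> ` {p. poly_over K p}) g"
      unfolding poly_over_def[of _ g]
    proof
      fix j
      have "poly_over (\<iota> ` K) (coeff g j)" using g(1) by (simp add: poly2_over_def KK_def)
      then obtain p' where "poly_over K p'" "map_poly \<iota> p' = coeff g j" by (rule map_poly_preimage[OF srK h])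
      then show "coeff g j \<in> map_poly \<iota> ` {p. poly_over K p}" by (intro image_eqI[of _ _ p']) simp_all
    qed
    then obtain g' where g': "poly2_over K g'" "\<phi> g' = g"
      using map_poly_preimage[OF is_subring_poly_over[OF srK] h1] unfolding \<phi>_def poly2_over_eq by blast
    have "coeff g' j = 0" if "j \<ge> n" for j
    proof -
      have "map_poly \<iota> (coeff g' j) = coeff g j" by (simp add: g'(2)[symmetric] \<phi>_def coeff_map_poly)
      then show ?thesis using map0[of "coeff g' j"] g'(1) g(3)[OF that] by (simp add: poly2_over_def)
    qed
    moreover have "g' \<noteq> 0" using g(2) g'(2) by (auto simp: \<phi>_def)
    ultimately have "\<not> \<chi> dvd g'" using monic_dvd_small_imp_0[of \<chi> g'] chi(3) by blast
    then show "\<exists>A B \<rho>. poly_over KK \<rho> \<and> \<rho> \<noteq> 0 \<and> A * g + B * \<chi>a = [:\<rho>:]"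
      using bez[OF g'(1)] by (simp add: g'(2) \<chi>a_def)
  qed

  \<comment> \<open>Constants of the derivations and affine dependence on the parameters\<close>
  have Dr: "ring_derivation (D i)" if "i \<in> I" for i
    by (rule derivation_imp_ring_derivation[OF D_derivation[OF that]])
  have DKK: "D i z = 0" if "i \<in> I" "z \<in> KK" for i z using D_K that by (auto simp: KK_def)
  have DKbar: "D i z = 0" if "i \<in> I" "z \<in> \<iota> ` Kbar" for i z
    using derivation_algebraic[OF Kf _ Dr[OF that(1)] D_K[OF that(1)]] that(2) hbar by (auto simp: Kbar)
  have finI: "finite I" using I finite_subset by blast

  have coeff_theta: "coeff \<theta> j = (if j < n then q j else 0)" for j
    by (simp add: theta(1) coeff_sum)
  \<comment> \<open>Each admissible coefficient is an affine form in the independent parameters; as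
    \<open>D i (a j)\<close> is the Kronecker delta, the slopes of the form are its
    derivatives.\<close>
  have lin: "(\<forall>i\<in>I. D i z \<in> KK) \<and> (\<exists>\<kappa>\<in>KK. z = \<kappa> + (\<Sum>i\<in>I. D i z * a i))"
    if z: "z \<in> KK \<union> a ` {..<m}" for z
  proof (cases "z \<in> KK")
    case True
    then show ?thesis using DKK subring_0[OF srKK] by (auto intro!: bexI[of _ z])
  next
    case False
    then obtain k where k: "k < m" "z = a k" using z by auto
    show ?thesis
    proof (cases "k \<in> I")
      case True
      have "(\<Sum>i\<in>I. D i z * a i) = (\<Sum>i\<in>I. if i = k then a k else 0)"
        using True k by (intro sum.cong) (auto simp: D_a)
      then have "z = 0 + (\<Sum>i\<in>I. D i z * a i)" using True finI k by simp
      moreover have "\<forall>i\<in>I. D i z \<in> KK"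
        using True k D_a subring_0[OF srKK] subring_1[OF srKK] by simp
      ultimately show ?thesis using subring_0[OF srKK] by blast
    next
      case False
      obtain \<kappa>\<^sub>0 \<kappa> where \<kappa>: "\<kappa>\<^sub>0 \<in> K" "\<forall>i\<in>I. \<kappa> i \<in> K" "z = \<iota> \<kappa>\<^sub>0 + (\<Sum>i\<in>I. \<iota> (\<kappa> i) * a i)"
        using a_dep[OF k(1) False] k(2) by blast
      have Dz: "D i z = \<iota> (\<kappa> i)" if i: "i \<in> I" for i
      proof -
        note d = Dr[OF i]
        have "D i z = (\<Sum>j\<in>I. if j = i then \<iota> (\<kappa> i) else 0)"
          unfolding \<kappa>(3) deriv_add[OF d] deriv_sum[OF d] deriv_mult[OF d]
          using \<kappa> D_K[OF i] by (simp add: D_a i) (intro sum.cong, auto simp: D_a i)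
        then show ?thesis using finI i by simp
      qed
      then have "z = \<iota> \<kappa>\<^sub>0 + (\<Sum>i\<in>I. D i z * a i)" using \<kappa>(3) by (simp cong: sum.cong)
      then show ?thesis using \<kappa> Dz by (auto simp: KK_def)
    qed
  qed
  have theta_coeffs: "(\<forall>i\<in>I. D i (coeff (coeff \<theta> j) k) \<in> KK) \<and>
      (\<exists>\<kappa>\<in>KK. coeff (coeff \<theta> j) k = \<kappa> + (\<Sum>i\<in>I. D i (coeff (coeff \<theta> j) k) * a i))" for j k
  proof -
    have "coeff (coeff \<theta> j) k \<in> KK \<union> a ` {..<m}"
      using q[of j] subring_0[OF srKK] by (auto simp: coeff_theta poly_over_def KK_def)
    then show ?thesis by (rule lin)
  qed

  \<comment> \<open>The norm as a determinant, and its nonvanishing\<close>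
  have embH: "ring_hom_on UNIV emb"
  proof -
    have "emb 0 = 0" using emb unfolding ring_embedding_def by (metis add.right_neutral add_left_cancel)
    then show ?thesis using emb by (simp add: ring_embedding_def ring_hom_on_def)
  qed
  have emb_inj: "emb p = 0 \<longleftrightarrow> p = 0" for p
    using emb hom_on_0[OF is_subring_UNIV embH] by (auto simp: ring_embedding_def inj_def)
  have chi_emb: "map_poly emb \<chi>a = (\<Prod>l<n. [:- y l, 1:])"
    using y subst_x_map_poly[of "\<lambda>c. emb [:c:]" \<iota> \<chi> "emb [:0, 1:]"] hom_on_0[OF is_subring_UNIV embH] \<iota>0
    by (simp add: roots_of_def subst_x_emb[OF embH] \<chi>a_def \<phi>_def)
  have "emb r = (\<Prod>l<n. poly (map_poly emb \<theta>) (y l))"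
    unfolding r eval2_def subst_x_emb[OF embH] ..
  also have "\<dots> = emb (det (norm_matrix \<chi>a \<theta>))"
    using det_norm_matrix_eq_prod[OF lcchi degchi embH _ chi_emb] C.distinct_roots[OF embH _ chi_emb] emb_inj
    by simp
  \<comment> \<open>Injectivity of \<open>emb\<close> frees r from the splitting field, so the same
    product formula can be used for the roots at a place.\<close>
  finally have r_det: "r = det (norm_matrix \<chi>a \<theta>)" using emb by (simp add: ring_embedding_def inj_eq)
  obtain A B' where theta_bez: "A * \<theta> + B' * \<chi>a = [:r:]"
    using det_norm_matrix_bezout[OF lcchi, of \<theta>] degchi n0 unfolding r_det by auto

  have places: "map_poly (fls_eval X) \<chi>a = (\<Prod>l<n. [:- Y l, 1:])"
    if "roots_of (\<lambda>z. fls_const (\<iota> z)) \<chi> X n Y" for X Y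
    using that subst_x_map_poly[of fls_const \<iota> \<chi> X] \<iota>0
    by (simp add: roots_of_def \<chi>a_def \<phi>_def subst_x_def fls_eval_def[abs_def])
  let ?Xinf = "x_at_infinity Ninf :: 'a fls"
  note Xinf = x_at_infinity_not_const[OF Y_inf(1)]
  have DYinf: "fls_map (D i) (Yinf l) = 0" if "i \<in> I" "l < n" for i l
    using DKbar[OF that(1)] Y_inf(3)[OF that(2)] deriv_0[OF Dr[OF that(1)]] by (intro fls_map_eq_0) auto
  note chi_inf = places[OF Y_inf(2)]
  \<comment> \<open>The factors of r are tested at infinity: there the roots have expansions with
    constant coefficients, as \<open>nonzero_at_place\<close> demands, whereas B may be
    empty.\<close>
  have r0: "r \<noteq> 0"
  proof -
    have "poly (map_poly (fls_eval ?Xinf) \<theta>) (Yinf l) \<noteq> 0" if l: "l < n" for l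
    proof (rule C.nonzero_at_place[OF Dr theta_coeffs theta(2) _ Xinf root_of_prod[OF chi_inf l]])
      show "\<And>j. j \<ge> n \<Longrightarrow> coeff \<theta> j = 0" by (simp add: coeff_theta)
      show "\<And>i. i \<in> I \<Longrightarrow> fls_map (D i) ?Xinf = 0" by (rule fls_map_x_at_infinity[OF Dr])
      show "\<And>i. i \<in> I \<Longrightarrow> fls_map (D i) (Yinf l) = 0" by (rule DYinf[OF _ l])
    qed
    moreover have "fls_eval ?Xinf r = (\<Prod>l<n. poly (map_poly (fls_eval ?Xinf) \<theta>) (Yinf l))"
      unfolding r_det
    proof (rule det_norm_matrix_eq_prod[OF lcchi degchi ring_hom_on_fls_eval _ chi_inf])
      show "inj_on Yinf {..<n}"
        by (rule C.distinct_roots[OF ring_hom_on_fls_eval _ chi_inf]) (use fls_eval_nonzero[OF Xinf] in auto)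
    qed
    ultimately show ?thesis using fls_eval_0[of ?Xinf] by auto
  qed

  \<comment> \<open>Algebraic and transcendental poles of the trace\<close>
  define f2a F0a where "f2a = map_poly \<iota> f\<^sub>2" and "F0a = map_poly \<iota> F\<^sub>0"
  have f2a: "poly_over KK f2a" "f2a \<noteq> 0"
    using KKover[OF f12(2)] map0[OF f12(2)] f12(3) by (simp_all add: f2a_def)
  have F00: "F\<^sub>0 \<noteq> 0" using r0 r_factor by auto
  have F0': "F \<noteq> 0" using r0 r_factor by auto
  have fF: "poly_over K (f\<^sub>2 * F\<^sub>0)" "f\<^sub>2 * F\<^sub>0 \<noteq> 0"
    using subring_mult[OF is_subring_poly_over[OF srK], of f\<^sub>2 F\<^sub>0] f12 F0(1) F00 by auto
  have fFa: "map_poly \<iota> (f\<^sub>2 * F\<^sub>0) = f2a * F0a"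
    using hom_on_mult[OF is_subring_poly_over[OF srK] h1, of f\<^sub>2 F\<^sub>0] f12 F0(1) by (simp add: f2a_def F0a_def)
  \<comment> \<open>Every root of a nonzero polynomial over K is algebraic over K, so restricting to
    \<open>Kbar\<close> discards no root.\<close>
  have B_eq: "B = {\<beta>. poly (f\<^sub>2 * F\<^sub>0) \<beta> = 0}"
    using fF unfolding B Kbar algebraic_over_def by blast
  have finB: "finite B" unfolding B_eq by (rule poly_roots_finite[OF fF(2)])
  have BKbar: "B \<subseteq> Kbar" using B by auto
  have \<iota>B: "\<iota> ` B = {w. poly (f2a * F0a) w = 0}"
    using roots_map_poly[OF Kbarf hbar poly_over_mono[OF fF(1) KKbar] fF(2)] B
    unfolding fFa B_eq by (auto simp: B_eq)
  have injB: "inj_on \<iota> B" by (rule inj_on_subset[OF field_hom_inj_on[OF Kbarf hbar] BKbar])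
  have algB: "algebraic_over KK w" if "w \<in> \<iota> ` B" for w
  proof -
    have "poly_over KK (f2a * F0a)" "f2a * F0a \<noteq> 0"
      using KKover[OF fF(1)] map0[OF fF(1)] fF(2) by (simp_all add: fFa)
    then show ?thesis using that unfolding \<iota>B algebraic_over_def by blast
  qed
  define U where "U = {u. poly F u = 0}"
  have finU: "finite U" unfolding U_def by (rule poly_roots_finite[OF F0'])
  have U_trans: "\<not> algebraic_over KK u" if "u \<in> U" for u using F(2) that by (simp add: U_def KK_def)
  have disj: "\<iota> ` B \<inter> U = {}" using algB U_trans by blast

  \<comment> \<open>The integrand with embedded constants\<close>
  define numa dena where "numa = \<phi> num" and "dena = \<phi> den"
  have integrand: "abelian_integrand KK \<chi>a n numa dena (\<phi> f\<^sub>1) \<theta> A B' f2a r (D i)" if i: "i \<in> I" for i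
  proof
    show "poly2_over KK numa" "poly2_over KK dena"
      using \<phi>_over f by (simp_all add: numa_def dena_def)
    \<comment> \<open>The degree of \<open>den\<close> in y may be n or more, so its identity comes
      from indivisibility by \<open>\<chi>\<close> instead of a degree bound.\<close>
    show "\<exists>A B \<rho>. poly_over KK \<rho> \<and> \<rho> \<noteq> 0 \<and> A * dena + B * \<chi>a = [:\<rho>:]"
      using bez[OF f(2,3)] by (simp add: dena_def \<chi>a_def)
    show "poly_over KK f2a" "f2a \<noteq> 0" by (rule f2a)+
    let ?d = "[:f\<^sub>2:] * pderiv \<chi>"
    have over: "poly2_over K (pderiv \<chi>)" "poly2_over K [:f\<^sub>2:]"
      using chi(1) poly_over_pderiv[OF is_subring_poly_over[OF srK]] f12(2)
      by (simp_all add: poly2_over_eq over_const[unfolded poly2_over_eq])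
    have over': "poly2_over K ?d" "poly2_over K (num * ?d)" "poly2_over K (f\<^sub>1 * den)"
      using subring_mult[OF sr2] over f f12 by (simp_all only: mem_Collect_eq)
    then have "poly2_over K (num * ?d - f\<^sub>1 * den)"
      using subring_diff[OF sr2] by (simp only: mem_Collect_eq)
    then obtain G where G: "poly2_over K G" "num * ?d - f\<^sub>1 * den = \<chi> * G"
      using monic_dvd_over[OF is_subring_poly_over[OF srK] _ chi(2) _ f_repr] chi(1)
      unfolding poly2_over_eq by blast
    have "\<phi> num * (\<phi> [:f\<^sub>2:] * \<phi> (pderiv \<chi>)) - \<phi> f\<^sub>1 * \<phi> den = \<phi> (num * ?d - f\<^sub>1 * den)"
      using hom_on_diff[OF sr2 hom, of "num * ?d" "f\<^sub>1 * den"] hom_on_mult[OF sr2 hom, of num ?d]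
        hom_on_mult[OF sr2 hom, of "[:f\<^sub>2:]" "pderiv \<chi>"] hom_on_mult[OF sr2 hom, of f\<^sub>1 den] over over' f f12
      by (simp only: mem_Collect_eq)
    also have "\<dots> = \<phi> \<chi> * \<phi> G"
      unfolding G(2) using hom_on_mult[OF sr2 hom, of \<chi> G] G chi(1) by simp
    finally show "\<chi>a dvd numa * ([:f2a:] * pderiv \<chi>a) - \<phi> f\<^sub>1 * dena"
      unfolding \<phi>_const \<phi>_pderiv[OF chi(1)] numa_def dena_def \<chi>a_def f2a_def by (simp only: dvd_triv_left)
    show "A * \<theta> + B' * \<chi>a = [:r:]" by (rule theta_bez)
    show "r \<noteq> 0" by (rule r0)
    show "ring_derivation (D i)" by (rule Dr[OF i])
    show "\<And>z. z \<in> KK \<Longrightarrow> D i z = 0" by (rule DKK[OF i])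
  qed

  \<comment> \<open>The solutions as points of the curve over the roots of F\<close>
  define G where "G = generated_subfield (KK \<union> a ` {..<m})"
  have Gf: "is_subfield G" unfolding G_def by (rule is_subfield_generated)
  have Gsup: "KK \<subseteq> G" "a ` {..<m} \<subseteq> G"
    using generated_subfield_superset[of "KK \<union> a ` {..<m}"] by (auto simp: G_def)
  define V where "V u = {v. eval2 (\<lambda>c. c) \<chi>a u v = 0 \<and> eval2 (\<lambda>c. c) \<theta> u v = 0}" for u
  have eval_chi: "eval2 \<iota> \<chi> u v = eval2 (\<lambda>c. c) \<chi>a u v" for u v
    by (simp add: \<chi>a_def \<phi>_def eval2_map_poly \<iota>0)
  have finV: "finite (V u)" for u
  proof -
    have "coeff (subst_x (\<lambda>c. c) \<chi>a u) n = 1" using lcchi degchi by (simp add: subst_x_def coeff_map_poly)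
    then have "subst_x (\<lambda>c. c) \<chi>a u \<noteq> 0" by auto
    then show ?thesis
      by (rule finite_subset[OF _ poly_roots_finite, rotated]) (auto simp: V_def eval2_def)
  qed
  have "(u, v) \<in> sols \<longleftrightarrow> (u, v) \<in> Sigma U V" for u v
  proof -
    have hom_uv: "ring_hom_on UNIV (\<lambda>p. eval2 (\<lambda>c. c) p u v)"
      using ring_hom_on_eval2[OF is_subring_UNIV ring_hom_on_id, of u v] by (simp add: poly2_over_def)
    have "poly r u = eval2 (\<lambda>c. c) A u v * eval2 (\<lambda>c. c) \<theta> u v + eval2 (\<lambda>c. c) B' u v * eval2 (\<lambda>c. c) \<chi>a u v"
    proof -
      have "eval2 (\<lambda>c. c) [:r:] u v = poly r u" using r0 by (simp add: eval2_altdef map_poly_pCons)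
      then show ?thesis
        using hom_on_add[OF is_subring_UNIV hom_uv] hom_on_mult[OF is_subring_UNIV hom_uv]
        by (simp flip: theta_bez)
    qed
    \<comment> \<open>At a common zero r(u) = 0, and the factor \<open>F\<^sub>0\<close> cannot
      vanish at a transcendental u.\<close>
    then have 1: "u \<in> U" if "v \<in> V u" "\<not> algebraic_over KK u"
      using that F0(2)[of u] by (auto simp: V_def U_def r_factor KK_def)
    \<comment> \<open>The algebraicity required in \<open>sols\<close> is automatic: F has
      coefficients in the field generated by K and the parameters, and \<open>\<chi>\<close> is
      monic in y.\<close>
    have 2: "algebraic_over G u \<and> algebraic_over G v" if "u \<in> U" "v \<in> V u"
    proof -
      have "polynomials_in (\<iota> ` K) {..<m} a \<subseteq> G"
        by (rule polynomials_in_subring[OF is_subfield_imp_is_subring[OF Gf]]) (use Gsup in \<open>auto simp: KK_def\<close>)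
      then have "poly_over G F" using F(1) poly_over_mono by blast
      then have u: "algebraic_over G u" using that F0' by (auto simp: algebraic_over_def U_def)
      moreover have "poly2_over G \<chi>a"
        using \<phi>_over[OF chi(1)] Gsup(1) poly_over_mono unfolding poly2_over_def \<chi>a_def by blast
      ultimately show ?thesis
        using algebraic_over_y[OF Gf u _ lcchi] that by (auto simp: V_def)
    qed
    show ?thesis
      using 1 2 U_trans unfolding sols eval_chi KK_def[symmetric] G_def[symmetric] by (auto simp: V_def)
  qed
  then have sols_eq: "sols = Sigma U V" by auto

  \<comment> \<open>Comparison of residues for a single derivation\<close>
  have main: "(\<Sum>(u, v)\<in>sols. ratfun2 \<iota> num den u v * D i u)
      = D i ((\<Sum>\<beta>\<in>B. puiseux_residue (N \<beta>) (S_hat \<iota> lg num den \<theta> n (x_at (N \<beta>) (\<iota> \<beta>)) (Y \<beta>)))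
          - puiseux_Pi Ninf (S_hat \<iota> lg num den \<theta> n ?Xinf Yinf))" if i: "i \<in> I" for i
  proof -
    interpret J: abelian_integrand KK \<chi>a n numa dena "\<phi> f\<^sub>1" \<theta> A B' f2a r "D i" by (rule integrand[OF i])
    note Di0 = deriv_0[OF Dr[OF i]]
    define Q where "Q = f2a * r"
    define ratio where "ratio X = fls_eval X J.trace_num / fls_eval X Q" for X
    have S\<beta>: "fls_map (D i) (S_hat \<iota> lg num den \<theta> n (x_at (N \<beta>) (\<iota> \<beta>)) (Y \<beta>)) = ratio (x_at (N \<beta>) (\<iota> \<beta>))"
      if \<beta>: "\<beta> \<in> B" for \<beta>
      unfolding S_hat_map_poly[where \<iota> = \<iota>, OF \<iota>0] ratio_def Q_def numa_def[unfolded \<phi>_def, symmetric] dena_def[unfolded \<phi>_def, symmetric]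
    proof (rule J.deriv_S_hat[OF x_at_not_const[OF Y(1)[OF \<beta>]] places[OF Y(2)[OF \<beta>]]])
      show "fls_map (D i) (x_at (N \<beta>) (\<iota> \<beta>)) = 0"
        using fls_map_x_at[OF Dr[OF i]] DKbar[OF i] BKbar \<beta> by blast
      show "fls_map (D i) (Y \<beta> l) = 0" if "l < n" for l
        using DKbar[OF i] Y(3)[OF \<beta> that] Di0 by (intro fls_map_eq_0) auto
      show "D i (lg c) = 1 / c * D i c" if "l < n" "c = fls_lead (eval2 fls_const \<theta> (x_at (N \<beta>) (\<iota> \<beta>)) (Y \<beta> l))"
        for l c using lg[OF \<beta> that] i by (simp add: is_logarithm_def)
    qed
    have Sinf: "fls_map (D i) (S_hat \<iota> lg num den \<theta> n ?Xinf Yinf) = ratio ?Xinf"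
      unfolding S_hat_map_poly[where \<iota> = \<iota>, OF \<iota>0] ratio_def Q_def numa_def[unfolded \<phi>_def, symmetric] dena_def[unfolded \<phi>_def, symmetric]
    proof (rule J.deriv_S_hat[OF Xinf chi_inf])
      show "fls_map (D i) ?Xinf = 0" by (rule fls_map_x_at_infinity[OF Dr[OF i]])
      show "fls_map (D i) (Yinf l) = 0" if "l < n" for l by (rule DYinf[OF i that])
      show "D i (lg c) = 1 / c * D i c" if "l < n" "c = fls_lead (eval2 fls_const \<theta> ?Xinf (Yinf l))" for l c
        using lg_inf[OF that] i by (simp add: is_logarithm_def)
    qed
    \<comment> \<open>At the roots of F the index 1 is chosen, since the rational function
      \<open>ratio\<close> is expanded there in x - u itself.\<close>
    define N' where "N' c = (if c \<in> \<iota> ` B then N (inv_into B \<iota> c) else 1)" for c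
    have N'B: "N' (\<iota> \<beta>) = N \<beta>" if "\<beta> \<in> B" for \<beta> using that injB by (simp add: N'_def)
    have N'U: "N' u = 1" if "u \<in> U" for u using that disj by (auto simp: N'_def)
    have "(\<Sum>c\<in>\<iota> ` B \<union> U. puiseux_residue (N' c) (ratio (x_at (N' c) c))) = puiseux_Pi Ninf (ratio ?Xinf)"
      unfolding ratio_def
    proof (rule sum_residues_eq_Pi[OF _ _ _ Y_inf(1)])
      show "finite (\<iota> ` B \<union> U)" using finB finU by simp
      show "c \<in> \<iota> ` B \<union> U" if "poly Q c = 0" for c
        using that unfolding \<iota>B U_def Q_def r_factor F0a_def by auto
      show "N' c > 0" if "c \<in> \<iota> ` B \<union> U" for c using that N'B N'U Y(1) by auto
      show "Q \<noteq> 0" using f2a r0 by (simp add: Q_def)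
    qed
    then have residues: "(\<Sum>\<beta>\<in>B. puiseux_residue (N \<beta>) (ratio (x_at (N \<beta>) (\<iota> \<beta>))))
        + (\<Sum>u\<in>U. puiseux_residue 1 (ratio (x_at 1 u))) = puiseux_Pi Ninf (ratio ?Xinf)"
      using finB finU disj
      by (simp add: sum.union_disjoint sum.reindex[OF injB] N'B N'U cong: sum.cong)
    \<comment> \<open>Coprimality makes u a simple root of F, and transcendence keeps the embedded
      \<open>F\<^sub>0\<close> and \<open>f\<^sub>2\<close> nonzero at u, so the denominator Q has a
      simple zero.\<close>
    have at_root: "puiseux_residue 1 (ratio (x_at 1 u)) = - (\<Sum>v\<in>V u. ratfun2 (\<lambda>c. c) numa dena u v * D i u)"
      if u: "u \<in> U" for u
    proof -
      have Fu: "poly F u = 0" using u by (simp add: U_def)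
      have "poly (pderiv F) u \<noteq> 0"
      proof
        assume "poly (pderiv F) u = 0"
        then have "[:- u, 1:] dvd F" "[:- u, 1:] dvd pderiv F" using Fu by (simp_all add: poly_eq_0_iff_dvd)
        then have "is_unit [:- u, 1:]" using coprime coprime_common_divisor by blast
        then show False by (simp add: is_unit_iff_degree)
      qed
      moreover have "poly F0a u \<noteq> 0" using F0(2)[of u] U_trans[OF u] by (auto simp: F0a_def KK_def)
      ultimately have r': "poly r u = 0" "poly (pderiv r) u \<noteq> 0"
        using Fu by (simp_all add: r_factor pderiv_mult F0a_def)
      have "poly f2a u \<noteq> 0" using U_trans[OF u] f2a by (auto simp: algebraic_over_def)
      then have Q': "poly Q u = 0" "poly (pderiv Q) u \<noteq> 0" using r' by (simp_all add: Q_def pderiv_mult)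
      show ?thesis
        unfolding ratio_def residue_simple_pole[OF Q']
        using J.trace_num_at_root[OF U_trans[OF u] r'] by (simp add: Q_def V_def)
    qed
    have "(\<Sum>(u, v)\<in>sols. ratfun2 \<iota> num den u v * D i u)
        = (\<Sum>u\<in>U. \<Sum>v\<in>V u. ratfun2 (\<lambda>c. c) numa dena u v * D i u)"
      unfolding sols_eq ratfun2_map_poly[where \<iota> = \<iota> and num = num, OF \<iota>0] numa_def dena_def \<phi>_def
      using finU finV by (simp add: sum.Sigma)
    also have "\<dots> = - (\<Sum>u\<in>U. puiseux_residue 1 (ratio (x_at 1 u)))"
      using at_root by (simp add: sum_negf)
    also have "\<dots> = (\<Sum>\<beta>\<in>B. puiseux_residue (N \<beta>) (ratio (x_at (N \<beta>) (\<iota> \<beta>)))) - puiseux_Pi Ninf (ratio ?Xinf)"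
      using residues by (simp add: algebra_simps flip: residues)
    also have "\<dots> = D i ((\<Sum>\<beta>\<in>B. puiseux_residue (N \<beta>) (S_hat \<iota> lg num den \<theta> n (x_at (N \<beta>) (\<iota> \<beta>)) (Y \<beta>)))
          - puiseux_Pi Ninf (S_hat \<iota> lg num den \<theta> n ?Xinf Yinf))"
      \<comment> \<open>Residue and \<open>puiseux_Pi\<close> each read off one coefficient, so they
        commute with the coefficientwise action of \<open>D i\<close>.\<close>
      unfolding deriv_diff[OF Dr[OF i]] deriv_sum[OF Dr[OF i]]
      by (simp add: puiseux_residue_def puiseux_Pi_def Di0 flip: S\<beta> Sinf fls_map_nth[of "D i"])
    finally show ?thesis .
  qed
  show ?thesis
    \<comment> \<open>For indices outside I both sides are 0 by the default value in
      \<open>differential\<close>.\<close>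
    by (rule ext) (use main in \<open>simp add: differential_def case_prod_unfold\<close>)
qed

end
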